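(* Let $n\ge 2$ be an integer, let $k,j\ge 0$ be integers, and let $\mathbf{q}=(q_1,\ldots,q_k)$ and $\mathbf{u}=(u_1,\ldots,u_j)$. The $\mathbf{q},\mathbf{u}$-graded character series of the dihedral coinvariant ring $R^{(k,j)}_{\mathfrak{I}_2(n)}$ is $$\mathrm{Char}(R_{\mathfrak{I}_{2}(n)}^{(k,j)}; \mathbf{q};\mathbf{u}) = \chi_1 + s_{(1,1)}(\mathbf{q}/\mathbf{u})\,\chi_2 + s_{(n)}(\mathbf{q}/\mathbf{u})\,\chi_2+ \sum_{i=1}^{\lfloor \frac{n-1}{2} \rfloor} \bigl(s_{(i)}(\mathbf{q}/\mathbf{u}) + s_{(n-i)}(\mathbf{q}/\mathbf{u})\bigr) \chi^i + \varepsilon_n,$$ where $\varepsilon_n = s_{(\frac{n}{2})}(\mathbf{q}/\mathbf{u})(\chi_3+\chi_4)$ if $n$ is even, and $\varepsilon_n = 0$ if $n$ is odd.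
   Context: **The group.** $\mathfrak{I}_2(n)$ is the dihedral group of order $2n$, with presentation $\langle \rho,\phi \mid \rho^n=\phi^2=1,\ \phi^{-1}\rho\phi=\rho^{-1}\rangle$, realized inside $\mathrm{GL}_2(\mathbb{C})$ by $$\rho=\begin{bmatrix}\cos\frac{2\pi}{n}&-\sin\frac{2\pi}{n}\\ \sin\frac{2\pi}{n}&\cos\frac{2\pi}{n}\end{bmatrix},\qquad \phi=\begin{bmatrix}1&0\\0&-1\end{bmatrix}.$$ **The ring.** Let $S=\mathbb{C}[\boldsymbol{x}^{(1)},\ldots,\boldsymbol{x}^{(k)},\boldsymbol{\theta}^{(1)},\ldots,\boldsymbol{\theta}^{(j)}]$ be the $\mathbb{C}$-algebra generated by commuting (bosonic) variables $x_1^{(a)},x_2^{(a)}$ ($1\le a\le k$) and anticommuting (fermionic) variables $\theta_1^{(b)},\theta_2^{(b)}$ ($1\le b\le j$). The bosonic variables commute with all variables; the fermionic variables anticommute with each other, and in particular square to zero. Thus $S\cong(\mathrm{Sym}\,\mathbb{C}^2)^{\otimes k}\otimes(\wedge\,\mathbb{C}^2)^{\otimes j}$, with fermionic variables from different sets also anticommuting. The group $\mathfrak{I}_2(n)$ acts diagonally on $S$ by algebra automorphisms: each $g$ acts on each pair $(x_1^{(a)},x_2^{(a)})$ and each pair $(\theta_1^{(b)},\theta_2^{(b)})$ as a basis of $\mathbb{C}^2$ through the $2\times2$ matrix of $g$, i.e. $g\cdot v_s=\sum_r g_{rs}v_r$. Let $I^{(k,j)}_{\mathfrak{I}_2(n)}$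 be the ideal of $S$ generated by all $\mathfrak{I}_2(n)$-invariant elements with zero constant term, and let $R^{(k,j)}_{\mathfrak{I}_2(n)}=S/I^{(k,j)}_{\mathfrak{I}_2(n)}$. **Grading and character series.** $S$ and $R^{(k,j)}_{\mathfrak{I}_2(n)}$ are multigraded by $(\mathbf{a},\mathbf{b})\in\mathbb{Z}_{\ge0}^k\times\mathbb{Z}_{\ge0}^j$, where $a_r$ is the total degree in $x_1^{(r)},x_2^{(r)}$ and $b_r$ is the total degree in $\theta_1^{(r)},\theta_2^{(r)}$. Define $$\mathrm{Char}(R;\mathbf{q};\mathbf{u})=\sum_{\mathbf{a},\mathbf{b}}q_1^{a_1}\cdots q_k^{a_k}u_1^{b_1}\cdots u_j^{b_j}\,\mathrm{char}(R_{\mathbf{a},\mathbf{b}}),$$ where $\mathrm{char}(R_{\mathbf{a},\mathbf{b}})$ is the character of the $\mathfrak{I}_2(n)$-module $R_{\mathbf{a},\mathbf{b}}$. **Irreducible characters.** The one-dimensional ones are: $\chi_1$ with $\chi_1(\rho)=1,\chi_1(\phi)=1$; $\chi_2$ (the sign, i.e. determinant, character) with $\chi_2(\rho)=1,\chi_2(\phi)=-1$; and, only when $n$ is even, $\chi_3$ with $\chi_3(\rho)=-1,\chi_3(\phi)=1$ and $\chi_4$ with $\chi_4(\rho)=-1,\chi_4(\phi)=-1$. The two-dimensional ones are $\chi^h$ for $1\le h\le\lfloor\frac{n-1}{2}\rfloor$, the characters of the two-dimensional irreducible representations with $\chi^h(\rho)=2\cos(\frac{2h\pi}{n})$ and $\chi^h(\phi)=0$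 (equivalently $\chi^h(\rho^\ell)=2\cos(\frac{2h\ell\pi}{n})$, $\chi^h(\rho^\ell\phi)=0$). **Super Schur functions.** For a partition $\lambda$, $$s_\lambda(\mathbf{q}/\mathbf{u})=\sum_{\nu\subseteq\lambda}s_\nu(\mathbf{q})\,s_{\lambda'/\nu'}(\mathbf{u}),$$ where $\lambda'$ is the transpose of $\lambda$, and $s_\nu$, $s_{\lambda'/\nu'}$ are ordinary Schur and skew Schur polynomials (in an empty set of variables, a Schur polynomial is $1$ for the empty shape and $0$ otherwise). In particular $s_{(m)}(\mathbf{q}/\mathbf{u})=\sum_{i=0}^m s_{(m-i)}(\mathbf{q})s_{(1^i)}(\mathbf{u})$, with $(0)$ meaning the empty partition. *)

theory Defs
  imports
    "HOL-Analysis.Analysis"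
    "HOL-Algebra.Algebra"
    "HOL-Algebra.Algebraic_Closure_Type"
    "HOL-Library.Poly_Mapping"
    "HOL-Library.FSet"
    "Jordan_Normal_Form.Missing_VectorSpace"
begin

section \<open>Superpolynomials\<close>

text \<open>
  \<open>Gen a s\<close> indexes the \<open>s\<close>-th variable of the \<open>a\<close>-th pair of variables. It is used for bosonic
  and for fermionic variables. Pairs are numbered from \<open>0\<close>. In the two-element type \<open>2\<close> the
  numeral \<open>2\<close> equals \<open>0\<close>, so its elements are \<open>1\<close> and \<open>2\<close>, as for the indices of \<open>complex^2^2\<close>.
\<close>

datatype gen = Gen (pair_of: nat) (comp_of: 2)

instantiation gen :: linorder
begin

definition less_gen :: "gen \<Rightarrow> gen \<Rightarrow> bool" where
  "v < w \<longleftrightarrow> pair_of v < pair_of w \<or> (pair_of v = pair_of w \<and> comp_of v < comp_of w)"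

definition less_eq_gen :: "gen \<Rightarrow> gen \<Rightarrow> bool" where
  "v \<le> w \<longleftrightarrow> v < w \<or> v = (w :: gen)"

instance
  by standard (auto simp: less_gen_def less_eq_gen_def intro: gen.expand)

end

text \<open>
  The monomial \<open>(e, A)\<close> stands for the product of all \<open>x\<^sub>v\<close> to the power \<open>e v\<close>, times the product
  of the \<open>\<theta>\<^sub>v\<close> for \<open>v \<in> A\<close> taken in increasing order of \<open>v\<close>.
\<close>

type_synonym smon = "(gen \<Rightarrow>\<^sub>0 nat) \<times> gen fset"

text \<open>
  \<open>\<theta>\<^sub>A \<theta>\<^sub>B = koszul_sign A B \<theta>\<^bsub>A \<union> B\<^esub>\<close>: sorting the product takes one transposition for each pair
  \<open>(a, b)\<close> in \<open>A \<times> B\<close> with \<open>b < a\<close>.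
\<close>

definition koszul_sign :: "gen fset \<Rightarrow> gen fset \<Rightarrow> complex" where
  "koszul_sign A B =
     (if A |\<inter>| B = {||} then (-1) ^ card {(a, b). a |\<in>| A \<and> b |\<in>| B \<and> b < a} else 0)"

typedef superpoly = "UNIV :: (smon \<Rightarrow>\<^sub>0 complex) set"
  morphisms coeffs of_coeffs by simp

setup_lifting type_definition_superpoly

lemma coeffs_of_coeffs [simp]: "coeffs (of_coeffs p) = p"
  by (simp add: of_coeffs_inverse)

definition smon_times :: "smon \<Rightarrow> smon \<Rightarrow> smon" where
  "smon_times m m' = (fst m + fst m', snd m |\<union>| snd m')"

definition smult_coeffs :: "(smon \<Rightarrow>\<^sub>0 complex) \<Rightarrow> (smon \<Rightarrow>\<^sub>0 complex) \<Rightarrow> (smon \<Rightarrow>\<^sub>0 complex)" where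
  "smult_coeffs p q =
     (\<Sum>m\<in>Poly_Mapping.keys p. \<Sum>m'\<in>Poly_Mapping.keys q.
        Poly_Mapping.single (smon_times m m')
          (koszul_sign (snd m) (snd m') * Poly_Mapping.lookup p m * Poly_Mapping.lookup q m'))"

lemma smult_coeffs_superset:
  assumes "finite M" "finite N" "Poly_Mapping.keys p \<subseteq> M" "Poly_Mapping.keys q \<subseteq> N"
  shows "smult_coeffs p q =
     (\<Sum>m\<in>M. \<Sum>m'\<in>N.
        Poly_Mapping.single (smon_times m m')
          (koszul_sign (snd m) (snd m') * Poly_Mapping.lookup p m * Poly_Mapping.lookup q m'))"
proof -
  let ?t = "\<lambda>m m'. Poly_Mapping.single (smon_times m m')
          (koszul_sign (snd m) (snd m') * Poly_Mapping.lookup p m * Poly_Mapping.lookup q m')"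
  have "smult_coeffs p q = (\<Sum>m\<in>Poly_Mapping.keys p. \<Sum>m'\<in>N. ?t m m')"
    unfolding smult_coeffs_def
    by (intro sum.cong refl sum.mono_neutral_left assms) (simp add: in_keys_iff)
  also have "\<dots> = (\<Sum>m\<in>M. \<Sum>m'\<in>N. ?t m m')"
    by (intro sum.mono_neutral_left assms) (simp add: in_keys_iff)
  finally show ?thesis .
qed

lemma smult_coeffs_add_left:
  "smult_coeffs (p + p') q = smult_coeffs p q + smult_coeffs p' q"
proof -
  let ?M = "Poly_Mapping.keys p \<union> Poly_Mapping.keys p'"
  show ?thesis
    by (subst (1 2 3) smult_coeffs_superset[where M = ?M and N = "Poly_Mapping.keys q"])
       (use keys_add[of p p'] in \<open>auto simp: lookup_add single_add algebra_simps sum.distrib\<close>)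
qed

lemma smult_coeffs_add_right:
  "smult_coeffs p (q + q') = smult_coeffs p q + smult_coeffs p q'"
proof -
  let ?N = "Poly_Mapping.keys q \<union> Poly_Mapping.keys q'"
  show ?thesis
    by (subst (1 2 3) smult_coeffs_superset[where N = ?N and M = "Poly_Mapping.keys p"])
       (use keys_add[of q q'] in \<open>auto simp: lookup_add single_add algebra_simps sum.distrib\<close>)
qed

lemma smult_coeffs_zero [simp]: "smult_coeffs 0 q = 0" "smult_coeffs p 0 = 0"
  by (simp_all add: smult_coeffs_def)

lemma smult_coeffs_single:
  "smult_coeffs (Poly_Mapping.single m c) (Poly_Mapping.single m' c') =
     Poly_Mapping.single (smon_times m m') (koszul_sign (snd m) (snd m') * c * c')"
  by (subst smult_coeffs_superset[where M = "{m}" and N = "{m'}"]) simp_all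

lemma koszul_sign_assoc:
  "koszul_sign A B * koszul_sign (A |\<union>| B) C = koszul_sign A (B |\<union>| C) * koszul_sign B C"
proof (cases "A |\<inter>| B = {||} \<and> A |\<inter>| C = {||} \<and> B |\<inter>| C = {||}")
  case True
  define iv where "iv = (\<lambda>A B :: gen fset. {(a, b). a |\<in>| A \<and> b |\<in>| B \<and> b < a})"
  have fin: "finite (iv A B)" for A B
    by (rule finite_subset[of _ "fset A \<times> fset B"]) (auto simp: iv_def)
  have "iv (A |\<union>| B) C = iv A C \<union> iv B C" "iv A C \<inter> iv B C = {}"
       "iv A (B |\<union>| C) = iv A B \<union> iv A C" "iv A B \<inter> iv A C = {}"
    using True by (auto simp: iv_def)
  hence "card (iv (A |\<union>| B) C) = card (iv A C) + card (iv B C)"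
        "card (iv A (B |\<union>| C)) = card (iv A B) + card (iv A C)"
    using fin by (simp_all add: card_Un_disjoint)
  moreover have "(A |\<union>| B) |\<inter>| C = {||}" "A |\<inter>| (B |\<union>| C) = {||}"
    using True by auto
  ultimately show ?thesis
    using True by (simp add: koszul_sign_def iv_def power_add mult_ac)
next
  case False
  thus ?thesis by (auto simp: koszul_sign_def)
qed

lemma smon_times_assoc: "smon_times (smon_times a b) c = smon_times a (smon_times b c)"
  by (simp add: smon_times_def add.assoc sup.assoc)

lemma poly_mapping_add_induct [case_names single add]:
  fixes p :: "'a \<Rightarrow>\<^sub>0 'b::comm_monoid_add"
  assumes "\<And>m c. P (Poly_Mapping.single m c)" "\<And>p q. P p \<Longrightarrow> P q \<Longrightarrow> P (p + q)"
  shows "P p"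
proof (induction p rule: update_induct)
  case const
  show ?case using assms(1)[of undefined 0] by simp
next
  case (update f a b)
  have "Poly_Mapping.update a b f = f + Poly_Mapping.single a b"
    using update by (intro poly_mapping_eqI)
      (auto simp: lookup_update lookup_add lookup_single in_keys_iff when_def)
  thus ?case using assms update by simp
qed

lemma smult_coeffs_assoc: "smult_coeffs (smult_coeffs p q) r = smult_coeffs p (smult_coeffs q r)"
proof (induction p rule: poly_mapping_add_induct)
  case (single m c)
  show ?case
  proof (induction q rule: poly_mapping_add_induct)
    case (single m' c')
    show ?case
    proof (induction r rule: poly_mapping_add_induct)
      case (single m'' c'')
      have "koszul_sign (snd m) (snd m') * koszul_sign (snd m |\<union>| snd m') (snd m'') =
            koszul_sign (snd m) (snd m' |\<union>| snd m'') * koszul_sign (snd m') (snd m'')"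
        by (rule koszul_sign_assoc)
      hence "koszul_sign (snd (smon_times m m')) (snd m'') * (koszul_sign (snd m) (snd m') * c * c') * c''
           = koszul_sign (snd m) (snd (smon_times m' m'')) * c * (koszul_sign (snd m') (snd m'') * c' * c'')"
        by (simp add: smon_times_def mult_ac)
      thus ?case by (simp only: smult_coeffs_single smon_times_assoc)
    qed (simp add: smult_coeffs_add_right)
  qed (simp add: smult_coeffs_add_right smult_coeffs_add_left)
qed (simp add: smult_coeffs_add_left)

instantiation superpoly :: ring_1
begin

lift_definition zero_superpoly :: superpoly is 0 .
lift_definition one_superpoly :: superpoly is "Poly_Mapping.single (0, {||}) 1" .
lift_definition plus_superpoly :: "superpoly \<Rightarrow> superpoly \<Rightarrow> superpoly" is "(+)" .
lift_definition uminus_superpoly :: "superpoly \<Rightarrow> superpoly" is uminus .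
lift_definition minus_superpoly :: "superpoly \<Rightarrow> superpoly \<Rightarrow> superpoly" is "(-)" .
lift_definition times_superpoly :: "superpoly \<Rightarrow> superpoly \<Rightarrow> superpoly" is smult_coeffs .

instance
proof
  fix a b c :: superpoly
  show "a * b * c = a * (b * c)" by transfer (rule smult_coeffs_assoc)
  show "(a + b) * c = a * c + b * c" by transfer (rule smult_coeffs_add_left)
  show "a * (b + c) = a * b + a * c" by transfer (rule smult_coeffs_add_right)
  show "1 * a = a"
  proof transfer
    fix p :: "smon \<Rightarrow>\<^sub>0 complex"
    show "smult_coeffs (Poly_Mapping.single (0, {||}) 1) p = p"
      by (induction p rule: poly_mapping_add_induct)
         (simp_all add: smult_coeffs_single smult_coeffs_add_right smon_times_def koszul_sign_def)
  qed
  show "a * 1 = a"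
  proof transfer
    fix p :: "smon \<Rightarrow>\<^sub>0 complex"
    show "smult_coeffs p (Poly_Mapping.single (0, {||}) 1) = p"
      by (induction p rule: poly_mapping_add_induct)
         (simp_all add: smult_coeffs_single smult_coeffs_add_left smon_times_def koszul_sign_def)
  qed
  show "(0 :: superpoly) \<noteq> 1"
    by transfer (metis lookup_single_eq lookup_zero zero_neq_one)
qed (transfer; simp add: algebra_simps)+

end

definition smonom :: "smon \<Rightarrow> complex \<Rightarrow> superpoly" where
  "smonom m c = of_coeffs (Poly_Mapping.single m c)"

definition Const :: "complex \<Rightarrow> superpoly" where
  "Const c = smonom (0, {||}) c"

definition Xvar :: "gen \<Rightarrow> superpoly" where
  "Xvar v = smonom (Poly_Mapping.single v 1, {||}) 1"

definition Thetavar :: "gen \<Rightarrow> superpoly" where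
  "Thetavar v = smonom (0, {|v|}) 1"

definition monoms :: "superpoly \<Rightarrow> smon set" where
  "monoms f = Poly_Mapping.keys (coeffs f)"

definition coeff_of :: "superpoly \<Rightarrow> smon \<Rightarrow> complex" where
  "coeff_of f m = Poly_Mapping.lookup (coeffs f) m"

lemma smonom_mult:
  "smonom m c * smonom m' c' = smonom (smon_times m m') (koszul_sign (snd m) (snd m') * c * c')"
  unfolding smonom_def by (rule coeffs_inject[THEN iffD1])
    (simp add: times_superpoly.rep_eq smult_coeffs_single)

lemma Xvar_commute: "Xvar v * Xvar w = Xvar w * Xvar v"
  by (simp add: Xvar_def smonom_mult smon_times_def koszul_sign_def add.commute)

lemma Xvar_Thetavar_commute: "Xvar v * Thetavar w = Thetavar w * Xvar v"
  by (simp add: Xvar_def Thetavar_def smonom_mult smon_times_def koszul_sign_def add.commute)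

lemma Thetavar_square: "Thetavar v * Thetavar v = 0"
  by (simp add: Thetavar_def smonom_mult koszul_sign_def)
     (simp add: smonom_def zero_superpoly.abs_eq)

lemma Thetavar_anticommute: "Thetavar v * Thetavar w = - (Thetavar w * Thetavar v)"
proof (cases "v = w")
  case True
  thus ?thesis by (simp add: Thetavar_square)
next
  case False
  have "{(a, b). a = v \<and> b = w \<and> b < a} = (if w < v then {(v, w)} else {})" for v w :: gen
    by auto
  hence "koszul_sign {|v|} {|w|} = - koszul_sign {|w|} {|v|}"
    using False by (auto simp: koszul_sign_def)
  thus ?thesis
    by (simp add: Thetavar_def smonom_mult smon_times_def finsert_commute)
       (simp add: smonom_def uminus_superpoly.abs_eq single_uminus)
qed

text \<open>The ring \<open>S\<close> with \<open>k\<close> pairs of bosonic and \<open>j\<close> pairs of fermionic variables.\<close>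

definition superpoly_ring :: "nat \<Rightarrow> nat \<Rightarrow> superpoly ring" where
  "superpoly_ring k j = ring_of_type_algebra
     \<lparr>carrier := {f. \<forall>m\<in>monoms f. (\<forall>v\<in>Poly_Mapping.keys (fst m). pair_of v < k) \<and>
                                  (\<forall>v\<in>fset (snd m). pair_of v < j)}\<rparr>"

lemma monoms_mult_subset:
  "monoms (f * g) \<subseteq> (\<Union>a\<in>monoms f. \<Union>b\<in>monoms g. {smon_times a b})"
proof -
  have "Poly_Mapping.keys (smult_coeffs p q) \<subseteq>
          (\<Union>a\<in>Poly_Mapping.keys p. \<Union>b\<in>Poly_Mapping.keys q. {smon_times a b})" for p q
    unfolding smult_coeffs_def
    by (intro order.trans[OF keys_sum] UN_mono order.refl) simp
  thus ?thesis by (simp add: monoms_def times_superpoly.rep_eq)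
qed

lemma ring_superpoly_ring: "ring (superpoly_ring k j)"
proof -
  define S where "S = carrier (superpoly_ring k j)"
  have S: "S = {f. \<forall>m\<in>monoms f. (\<forall>v\<in>Poly_Mapping.keys (fst m). pair_of v < k) \<and>
                                 (\<forall>v\<in>fset (snd m). pair_of v < j)}"
    by (simp add: S_def superpoly_ring_def)
  have R: "superpoly_ring k j =
      \<lparr>carrier = S, monoid.mult = (*), one = 1, ring.zero = 0, ring.add = (+)\<rparr>"
    by (simp add: S superpoly_ring_def ring_of_type_algebra_def)
  have zero: "0 \<in> S" and one: "1 \<in> S" and uminus: "f \<in> S \<Longrightarrow> - f \<in> S" for f
    by (auto simp: S monoms_def zero_superpoly.rep_eq one_superpoly.rep_eq
                   uminus_superpoly.rep_eq in_keys_iff lookup_single when_def)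
  have add: "f + g \<in> S" if "f \<in> S" "g \<in> S" for f g
    using that keys_add[of "coeffs f" "coeffs g"]
    by (auto simp: S monoms_def plus_superpoly.rep_eq)
  have times: "f * g \<in> S" if fg: "f \<in> S" "g \<in> S" for f g
    unfolding S mem_Collect_eq
  proof (rule ballI)
    fix m assume "m \<in> monoms (f * g)"
    then obtain a b where "a \<in> monoms f" "b \<in> monoms g" "m = smon_times a b"
      using monoms_mult_subset by blast
    thus "(\<forall>v\<in>Poly_Mapping.keys (fst m). pair_of v < k) \<and> (\<forall>v\<in>fset (snd m). pair_of v < j)"
      using fg keys_add[of "fst a" "fst b"] unfolding S smon_times_def by auto
  qed
  have inverse: "\<exists>g\<in>S. g + f = 0" "\<exists>g\<in>S. f + g = 0" if "f \<in> S" for f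
    using uminus[OF that] by (auto intro: bexI[of _ "- f"])
  show ?thesis
    unfolding R
    by unfold_locales (auto simp: algebra_simps Units_def zero one add times inverse)
qed


section \<open>The dihedral group and its action\<close>

definition rho :: "nat \<Rightarrow> complex^2^2" where
  "rho n = vector [vector [of_real (cos (2 * pi / n)), of_real (- sin (2 * pi / n))],
                   vector [of_real (sin (2 * pi / n)), of_real (cos (2 * pi / n))]]"

definition phi :: "complex^2^2" where
  "phi = vector [vector [1, 0], vector [0, -1]]"

definition GL2 :: "(complex^2^2) monoid" where
  "GL2 = \<lparr>carrier = {A. invertible A}, monoid.mult = (**), one = mat 1\<rparr>"

definition dihedral :: "nat \<Rightarrow> (complex^2^2) monoid" where
  "dihedral n = subgroup_generated GL2 {rho n, phi}"

text \<open>
  \<open>act g\<close> is the algebra endomorphism sending \<open>v\<^sub>s\<close> to \<open>\<Sum>\<^sub>r g\<^sub>r\<^sub>s v\<^sub>r\<close> for every pair \<open>(v\<^sub>1, v\<^sub>2)\<close> of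
  variables. The products are formed as lists because \<open>superpoly\<close> is not commutative; the order of
  the fermionic factors is the one fixed for \<open>smon\<close>.
\<close>

definition act_X :: "complex^2^2 \<Rightarrow> gen \<Rightarrow> superpoly" where
  "act_X g v = (\<Sum>r\<in>UNIV. Const (g $ r $ comp_of v) * Xvar (Gen (pair_of v) r))"

definition act_Theta :: "complex^2^2 \<Rightarrow> gen \<Rightarrow> superpoly" where
  "act_Theta g v = (\<Sum>r\<in>UNIV. Const (g $ r $ comp_of v) * Thetavar (Gen (pair_of v) r))"

definition act_smon :: "complex^2^2 \<Rightarrow> smon \<Rightarrow> superpoly" where
  "act_smon g m =
     prod_list (map (\<lambda>v. act_X g v ^ Poly_Mapping.lookup (fst m) v)
                    (sorted_list_of_set (Poly_Mapping.keys (fst m)))) *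
     prod_list (map (act_Theta g) (sorted_list_of_set (fset (snd m))))"

definition act :: "complex^2^2 \<Rightarrow> superpoly \<Rightarrow> superpoly" where
  "act g f = (\<Sum>m\<in>monoms f. Const (coeff_of f m) * act_smon g m)"


section \<open>The coinvariant ring\<close>

definition coinvariant_ideal :: "nat \<Rightarrow> nat \<Rightarrow> nat \<Rightarrow> superpoly set" where
  "coinvariant_ideal n k j = Idl\<^bsub>superpoly_ring k j\<^esub>
     {f \<in> carrier (superpoly_ring k j).
        (\<forall>g\<in>carrier (dihedral n). act g f = f) \<and> coeff_of f (0, {||}) = 0}"

definition coinvariant_ring :: "nat \<Rightarrow> nat \<Rightarrow> nat \<Rightarrow> superpoly set ring" where
  "coinvariant_ring n k j = superpoly_ring k j Quot coinvariant_ideal n k j"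

text \<open>
  A multidegree \<open>(a, b)\<close> is a single exponent vector \<open>d\<close>, with \<open>a\<^sub>r = d (Inl r)\<close> and
  \<open>b\<^sub>r = d (Inr r)\<close>.
\<close>

type_synonym multidegree = "(nat + nat) \<Rightarrow>\<^sub>0 nat"

definition has_multidegree :: "multidegree \<Rightarrow> smon \<Rightarrow> bool" where
  "has_multidegree d m \<longleftrightarrow>
     (\<forall>r. Poly_Mapping.lookup d (Inl r) = (\<Sum>s\<in>UNIV. Poly_Mapping.lookup (fst m) (Gen r s))) \<and>
     (\<forall>r. Poly_Mapping.lookup d (Inr r) = card {s. Gen r s |\<in>| snd m})"

definition homogeneous :: "nat \<Rightarrow> nat \<Rightarrow> multidegree \<Rightarrow> superpoly set" where
  "homogeneous k j d = {f \<in> carrier (superpoly_ring k j). \<forall>m\<in>monoms f. has_multidegree d m}"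

abbreviation complex_field :: "complex ring" where
  "complex_field \<equiv> ring_of_type_algebra"

text \<open>
  The graded piece of \<open>R\<close> of multidegree \<open>d\<close>, as a complex vector space. Its elements are cosets
  in \<open>R\<close>; the scalar \<open>c\<close> acts as multiplication by the class of the constant \<open>c\<close>. The fields
  \<open>mult\<close> and \<open>one\<close> are irrelevant for a module.
\<close>

definition graded_piece ::
    "nat \<Rightarrow> nat \<Rightarrow> nat \<Rightarrow> multidegree \<Rightarrow> (complex, superpoly set) module" where
  "graded_piece n k j d =
     (let S = superpoly_ring k j; I = coinvariant_ideal n k j; R = coinvariant_ring n k j in
      \<lparr>carrier = (\<lambda>f. I +>\<^bsub>S\<^esub> f) ` homogeneous k j d,
       monoid.mult = monoid.mult R, one = \<one>\<^bsub>R\<^esub>,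
       ring.zero = \<zero>\<^bsub>R\<^esub>, ring.add = add R,
       smult = (\<lambda>c Y. (I +>\<^bsub>S\<^esub> Const c) \<otimes>\<^bsub>R\<^esub> Y)\<rparr>)"


section \<open>Characters\<close>

text \<open>Only meaningful for a finite basis \<open>B\<close> of \<open>V\<close> and \<open>v\<close> in \<open>V\<close>.\<close>

definition coord ::
    "('a, 'm) ring_scheme \<Rightarrow> ('a, 'v, 'n) module_scheme \<Rightarrow> 'v set \<Rightarrow> 'v \<Rightarrow> 'v \<Rightarrow> 'a" where
  "coord K V B v = (THE a. a \<in> B \<rightarrow>\<^sub>E carrier K \<and> LinearCombinations.module.lincomb V a B = v)"

definition endo_trace ::
    "('a, 'm) ring_scheme \<Rightarrow> ('a, 'v, 'n) module_scheme \<Rightarrow> ('v \<Rightarrow> 'v) \<Rightarrow> 'a" where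
  "endo_trace K V T =
     (let B = (SOME B. finite B \<and> vectorspace.basis K V B)
      in \<Oplus>\<^bsub>K\<^esub>b\<in>B. coord K V B (T b) b)"

text \<open>
  The coefficient at \<open>d\<close> of the character series, evaluated at the group element \<open>g\<close>. A coset
  \<open>Y = I + f\<close> is mapped by \<open>g\<close> to \<open>I + g f\<close>, which is the image \<open>act g ` Y\<close> since \<open>act g\<close> permutes
  \<open>I\<close>.
\<close>

definition char_series :: "nat \<Rightarrow> nat \<Rightarrow> nat \<Rightarrow> complex^2^2 \<Rightarrow> multidegree \<Rightarrow> complex" where
  "char_series n k j g d = endo_trace complex_field (graded_piece n k j d) (\<lambda>Y. act g ` Y)"

text \<open>
  The class function with value \<open>u l\<close> at \<open>\<rho>\<^sup>l\<close> and \<open>w l\<close> at \<open>\<rho>\<^sup>l \<phi>\<close>. It is well defined if \<open>u\<close> and \<open>w\<close>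
  have period \<open>n\<close>.
\<close>

definition dihedral_fun ::
    "nat \<Rightarrow> (nat \<Rightarrow> complex) \<Rightarrow> (nat \<Rightarrow> complex) \<Rightarrow> complex^2^2 \<Rightarrow> complex" where
  "dihedral_fun n u w g =
     (THE z. \<exists>l. (g = rho n [^]\<^bsub>GL2\<^esub> l \<and> z = u l) \<or>
                 (g = rho n [^]\<^bsub>GL2\<^esub> l \<otimes>\<^bsub>GL2\<^esub> phi \<and> z = w l))"

definition chi1 :: "nat \<Rightarrow> complex^2^2 \<Rightarrow> complex" where
  "chi1 n = dihedral_fun n (\<lambda>l. 1) (\<lambda>l. 1)"

definition chi2 :: "nat \<Rightarrow> complex^2^2 \<Rightarrow> complex" where
  "chi2 n = dihedral_fun n (\<lambda>l. 1) (\<lambda>l. -1)"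

text \<open>\<open>chi3\<close> and \<open>chi4\<close> are meaningful for even \<open>n\<close> only.\<close>

definition chi3 :: "nat \<Rightarrow> complex^2^2 \<Rightarrow> complex" where
  "chi3 n = dihedral_fun n (\<lambda>l. (-1) ^ l) (\<lambda>l. (-1) ^ l)"

definition chi4 :: "nat \<Rightarrow> complex^2^2 \<Rightarrow> complex" where
  "chi4 n = dihedral_fun n (\<lambda>l. (-1) ^ l) (\<lambda>l. - ((-1) ^ l))"

definition chi_dim2 :: "nat \<Rightarrow> nat \<Rightarrow> complex^2^2 \<Rightarrow> complex" where
  "chi_dim2 n h = dihedral_fun n (\<lambda>l. of_real (2 * cos (2 * h * l * pi / n))) (\<lambda>l. 0)"


section \<open>Super Schur functions\<close>

text \<open>
  Polynomials in \<open>\<^bold>q\<close> and \<open>\<^bold>u\<close>: their exponent vectors are multidegrees.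
\<close>

type_synonym qu_poly = "multidegree \<Rightarrow>\<^sub>0 complex"

definition q_var :: "nat \<Rightarrow> qu_poly" where
  "q_var r = Poly_Mapping.single (Poly_Mapping.single (Inl r) 1) 1"

definition u_var :: "nat \<Rightarrow> qu_poly" where
  "u_var r = Poly_Mapping.single (Poly_Mapping.single (Inr r) 1) 1"

definition qu_const :: "complex \<Rightarrow> qu_poly" where
  "qu_const c = Poly_Mapping.single 0 c"

text \<open>Shapes are sets of cells \<open>(row, column)\<close>, both counted from \<open>0\<close>.\<close>

definition diagram :: "nat list \<Rightarrow> (nat \<times> nat) set" where
  "diagram la = {(r, c). r < length la \<and> c < la ! r}"

definition is_partition :: "nat list \<Rightarrow> bool" where
  "is_partition la \<longleftrightarrow> sorted_wrt (\<ge>) la \<and> 0 \<notin> set la"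

definition ssyt :: "(nat \<times> nat) set \<Rightarrow> nat \<Rightarrow> (nat \<times> nat \<Rightarrow> nat) set" where
  "ssyt D m = {T \<in> D \<rightarrow>\<^sub>E {..<m}.
     (\<forall>r c c'. (r, c) \<in> D \<longrightarrow> (r, c') \<in> D \<longrightarrow> c < c' \<longrightarrow> T (r, c) \<le> T (r, c')) \<and>
     (\<forall>r r' c. (r, c) \<in> D \<longrightarrow> (r', c) \<in> D \<longrightarrow> r < r' \<longrightarrow> T (r, c) < T (r', c))}"

text \<open>The Schur polynomial of the (possibly skew) shape \<open>D\<close> in the variables \<open>v 0, \<dots>, v (m - 1)\<close>.\<close>

definition schur :: "(nat \<times> nat) set \<Rightarrow> nat \<Rightarrow> (nat \<Rightarrow> qu_poly) \<Rightarrow> qu_poly" where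
  "schur D m v = (\<Sum>T\<in>ssyt D m. \<Prod>x\<in>D. v (T x))"

text \<open>The transpose of a shape is its image under \<open>prod.swap\<close>.\<close>

definition super_schur :: "nat \<Rightarrow> nat \<Rightarrow> nat list \<Rightarrow> qu_poly" where
  "super_schur k j la =
     (\<Sum>\<nu> | is_partition \<nu> \<and> diagram \<nu> \<subseteq> diagram la.
        schur (diagram \<nu>) k q_var *
        schur (prod.swap ` diagram la - prod.swap ` diagram \<nu>) j u_var)"

end

theory Submission imports Defs begin

text \<open>
  The rotation \<open>\<rho>\<close> is diagonal in the coordinates \<open>z = x\<^sub>1 + i x\<^sub>2\<close>, \<open>w = x\<^sub>1 - i x\<^sub>2\<close> (and likewise for the
  fermionic pairs), and \<open>\<phi>\<close> exchanges \<open>z\<close> and \<open>w\<close>. The substitution of \<open>z, w\<close> for the two components is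
  the algebra automorphism \<open>act Pmat\<close>, so that monomials in the eigen-coordinates are images of ordinary
  monomials and no second polynomial ring is introduced. Call \<open>(p, q)\<close> the bidegree of a monomial with \<open>p\<close>
  factors \<open>z\<close> and \<open>q\<close> factors \<open>w\<close>. A \<open>\<rho>\<close>-invariant contains only bidegrees with \<open>n\<close> dividing \<open>p - q\<close>.

  The coinvariant ideal \<open>I\<close> is determined first. From the invariants \<open>z\<^sub>a w\<^sub>b + w\<^sub>a z\<^sub>b\<close> one obtains that the
  sum of any two of \<open>z\<^sub>a z\<^sub>b w\<^sub>c\<close>, \<open>z\<^sub>a w\<^sub>b z\<^sub>c\<close>, \<open>w\<^sub>a z\<^sub>b z\<^sub>c\<close> lies in \<open>I\<close>, hence each of them does
  (\<open>cubic_in_pullback_ideal\<close>). So every monomial with \<open>p, q \<ge> 1\<close> and \<open>p + q \<ge> 3\<close> lies in \<open>I\<close>. Multiplying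
  an invariant \<open>m + \<phi> m\<close>, with \<open>m\<close> of bidegree \<open>(n, 0)\<close>, by a further \<open>z\<close> shows the same for pure monomials of
  degree greater than \<open>n\<close>. Conversely, these high monomials together with the invariants without constant
  term span an ideal, because such an invariant has only high terms and terms of bidegree \<open>(1, 1)\<close>, \<open>(n, 0)\<close>
  or \<open>(0, n)\<close>, and multiplying the latter by any variable gives something high. Hence \<open>I\<close> is that span
  (\<open>coinvariant_ideal_iff\<close>).

  What survives in the quotient is therefore: \<open>1\<close>; the pure monomials of degrees \<open>1, \<dots>, n - 1\<close> in \<open>z\<close> or in
  \<open>w\<close>; the pure monomials of degree \<open>n\<close>, with \<open>m\<close> identified with \<open>- \<phi> m\<close>; and the monomials
  \<open>z\<^sub>a w\<^sub>b\<close>, identified with \<open>- w\<^sub>a z\<^sub>b\<close>. In a fixed multidegree \<open>d\<close> there is at most one pure monomial of each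
  kind, and it exists exactly if no fermionic exponent exceeds \<open>1\<close>; this is the coefficient of \<open>d\<close> in
  \<open>s\<^bsub>(m)\<^esub>\<close>. The mixed part in multidegree \<open>d\<close> is one-dimensional exactly if \<open>d\<close> is the sum of two unit
  vectors which are not the same bosonic one; this is the coefficient of \<open>d\<close> in \<open>s\<^bsub>(1,1)\<^esub>\<close>. On the pair
  \<open>z\<^sup>d, w\<^sup>d\<close> of degree \<open>0 < N < n\<close> the rotation by \<open>t\<close> has trace \<open>2 cos (t N)\<close> and reflections have trace \<open>0\<close>; on
  the identified monomials the group acts by the determinant. Since \<open>cos (t N) = cos (t (n - N))\<close> for
  \<open>t = 2 \<pi> l / n\<close>, the degrees \<open>i\<close> and \<open>n - i\<close> contribute to the same character.

  The trace is computed with the theorem \<open>endo_trace_eq\<close>, which needs vectors and separating dual functionals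
  only (\<open>char_series_eq_sum\<close>); the coefficients of the super Schur functions come from counting tableaux
  (\<open>lookup_super_schur_row\<close>, \<open>lookup_super_schur_column\<close>).
\<close>

section \<open>Arithmetic of superpolynomials\<close>

lemma coeff_of_simps [simp]:
  "coeff_of 0 m = 0" "coeff_of (f + g) m = coeff_of f m + coeff_of g m"
  "coeff_of (- f) m = - coeff_of f m" "coeff_of (f - g) m = coeff_of f m - coeff_of g m"
  by (simp_all add: coeff_of_def zero_superpoly.rep_eq plus_superpoly.rep_eq uminus_superpoly.rep_eq
      minus_superpoly.rep_eq lookup_add lookup_minus)

lemma coeff_of_smonom: "coeff_of (smonom m c) m' = (if m = m' then c else 0)"
  by (simp add: coeff_of_def smonom_def lookup_single when_def)

lemma coeff_of_sum: "coeff_of (sum f A) m = (\<Sum>x\<in>A. coeff_of (f x) m)"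
  by (induction A rule: infinite_finite_induct) simp_all

lemma superpoly_eqI: "(\<And>m. coeff_of f m = coeff_of g m) \<Longrightarrow> f = g"
  unfolding coeff_of_def by (metis coeffs_inject poly_mapping_eqI)

lemma in_monoms_iff: "m \<in> monoms f \<longleftrightarrow> coeff_of f m \<noteq> 0"
  by (simp add: monoms_def coeff_of_def in_keys_iff)

lemma finite_monoms [simp]: "finite (monoms f)"
  by (simp add: monoms_def)

lemma smonom_0 [simp]: "smonom m 0 = 0"
  by (rule superpoly_eqI) (simp add: coeff_of_smonom)

lemma smonom_add: "smonom m (c + d) = smonom m c + smonom m d"
  by (rule superpoly_eqI) (simp add: coeff_of_smonom)

lemma Const_mult_smonom: "Const c * smonom m d = smonom m (c * d)"
  by (simp add: Const_def smonom_mult smon_times_def koszul_sign_def)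

lemma smonom_mult_Const: "smonom m d * Const c = smonom m (c * d)"
  by (simp add: Const_def smonom_mult smon_times_def koszul_sign_def mult.commute)

lemma superpoly_expand: "f = (\<Sum>m\<in>monoms f. smonom m (coeff_of f m))"
proof (rule superpoly_eqI)
  fix m
  show "coeff_of f m = coeff_of (\<Sum>m\<in>monoms f. smonom m (coeff_of f m)) m"
    by (cases "m \<in> monoms f") (simp_all add: coeff_of_sum coeff_of_smonom in_monoms_iff)
qed

lemma Const_commute: "Const c * f = f * Const c"
proof -
  have "Const c * (\<Sum>m\<in>A. smonom m (a m)) = (\<Sum>m\<in>A. smonom m (a m)) * Const c" for A a
    by (simp add: sum_distrib_left sum_distrib_right Const_mult_smonom smonom_mult_Const)
  then show ?thesis using superpoly_expand[of f] by metis
qed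

lemma Const_sum: "Const (sum c A) = (\<Sum>x\<in>A. Const (c x))"
  by (rule superpoly_eqI) (simp add: Const_def coeff_of_sum coeff_of_smonom)

lemma Const_left_commute: "f * (Const c * g) = Const c * (f * g)"
  by (metis Const_commute mult.assoc)

lemma Const_simps: "Const (c + d) = Const c + Const d" "Const (c * d) = Const c * Const d"
   "Const 0 = 0" "Const 1 = 1" "Const (- c) = - Const c"
     apply (simp_all add: Const_def smonom_add smonom_mult koszul_sign_def smon_times_def)
   apply (simp add: smonom_def one_superpoly.abs_eq)
  by (rule superpoly_eqI) (simp add: coeff_of_smonom)

lemma coeff_of_Const_mult [simp]: "coeff_of (Const c * f) m = c * coeff_of f m"
proof -
  have "coeff_of (Const c * (\<Sum>m\<in>A. smonom m (a m))) m' = c * coeff_of (\<Sum>m\<in>A. smonom m (a m)) m'" for A a m'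
    by (auto simp add: sum_distrib_left Const_mult_smonom coeff_of_sum coeff_of_smonom intro!: sum.cong)
  then show ?thesis using superpoly_expand[of f] by metis
qed

lemma koszul_sign_square: "A |\<inter>| B = {||} \<Longrightarrow> koszul_sign A B * koszul_sign A B = 1"
  by (simp add: koszul_sign_def flip: power_mult_distrib)

lemma koszul_sign_empty [simp]: "koszul_sign {||} A = 1" "koszul_sign A {||} = 1"
  by (simp_all add: koszul_sign_def)

lemma koszul_sign_least:
  assumes "\<And>w. w |\<in>| A \<Longrightarrow> v < w" shows "koszul_sign {|v|} A = 1"
proof -
  have "{|v|} |\<inter>| A = {||}" using assms by fastforce
  moreover have "{(a, b). a |\<in>| {|v|} \<and> b |\<in>| A \<and> b < a} = {}" using assms by fastforce
  ultimately show ?thesis unfolding koszul_sign_def by (metis card.empty power_0)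
qed

text \<open>
  A bosonic or fermionic pair of variables is named by an element of \<open>nat + nat\<close>, as for multidegrees, so
  that bosonic and fermionic variables can be treated alike.
\<close>

fun var :: "nat + nat \<Rightarrow> 2 \<Rightarrow> smon" where
  "var (Inl a) s = (Poly_Mapping.single (Gen a s) 1, {||})"
| "var (Inr b) s = (0, {|Gen b s|})"

definition letter :: "nat + nat \<Rightarrow> 2 \<Rightarrow> superpoly" where
  "letter a s = smonom (var a s) 1"

definition compat :: "smon \<Rightarrow> smon \<Rightarrow> bool" where
  "compat m m' \<longleftrightarrow> snd m |\<inter>| snd m' = {||}"

lemma smon_times_0 [simp]: "smon_times m (0, {||}) = m" "smon_times (0, {||}) m = m"
  by (simp_all add: smon_times_def)

lemma smon_times_commute: "smon_times m m' = smon_times m' m"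
  by (simp add: smon_times_def add.commute sup.commute)

text \<open>
  Every monomial arises from \<open>1\<close> by multiplying with single variables, where a fermionic variable is
  only multiplied to a monomial not containing it. Statements about monomials are reduced to single variables
  in this way, with no reference to exponents or to the ordering of the fermionic factors.
\<close>

lemma smon_induct [case_names one var]:
  assumes "P (0, {||})" and step: "\<And>a s m. compat (var a s) m \<Longrightarrow> P m \<Longrightarrow> P (smon_times (var a s) m)"
  shows "P m"
proof -
  have fermion: "P (0, A)" for A
  proof (induction A)
    case (insert v A)
    have "smon_times (var (Inr (pair_of v)) (comp_of v)) (0, A) = (0, finsert v A)"
      by (simp add: smon_times_def)
    moreover have "compat (var (Inr (pair_of v)) (comp_of v)) (0, A)"
      using insert by (simp add: compat_def)
    ultimately show ?case using step[OF _ insert(2)] by metis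
  qed fact
  have "\<forall>m. P m \<longrightarrow> P (smon_times (e, {||}) m)" for e
  proof (induction e rule: poly_mapping_add_induct)
    case (single v c)
    show ?case
    proof (induction c)
      case (Suc c)
      have "smon_times (Poly_Mapping.single v (Suc c), {||}) m
          = smon_times (var (Inl (pair_of v)) (comp_of v)) (smon_times (Poly_Mapping.single v c, {||}) m)" for m
        by (simp add: smon_times_def single_add[symmetric] flip: add.assoc)
      moreover have "compat (var (Inl (pair_of v)) (comp_of v)) m" for m by (simp add: compat_def)
      ultimately show ?case using Suc step by metis
    qed simp
  next
    case (add p q)
    have "smon_times (p + q, {||}) m = smon_times (p, {||}) (smon_times (q, {||}) m)" for m
      by (simp add: smon_times_def add.assoc)
    then show ?case using add by metis
  qed
  from this[of "fst m", rule_format, OF fermion[of "snd m"]]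
  show ?thesis by (simp add: smon_times_def)
qed

text \<open>
  The Koszul sign of disjoint monomials is \<open>\<plusminus>1\<close>, so it can be moved to the other side; later arguments need
  only that such a scalar exists.
\<close>

lemma smonom_split:
  assumes "compat m m'"
  obtains e where "e * e = 1" "\<And>c. smonom (smon_times m m') c = Const e * (smonom m 1 * smonom m' c)"
proof -
  let ?e = "koszul_sign (snd m) (snd m')"
  have "?e * ?e = 1" using assms by (simp add: compat_def koszul_sign_square)
  then show ?thesis using that[of ?e] 
    by (simp add: smonom_mult Const_mult_smonom flip: mult.assoc)
qed

lemma Const_mult_cancel: "c * c' = 1 \<Longrightarrow> Const c * (Const c' * f) = f"
  by (simp add: Const_simps(2,4) flip: mult.assoc) (metis Const_simps(2,4) mult_1)

text \<open>
  Two algebra homomorphisms that agree on constants and variables are equal; this rule is the source of the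
  functoriality of \<open>act\<close>.
\<close>

lemma superpoly_induct [case_names const var mult add]:
  assumes "\<And>c. P (Const c)" "\<And>a s. P (letter a s)"
    and "\<And>f g. P f \<Longrightarrow> P g \<Longrightarrow> P (f * g)" "\<And>f g. P f \<Longrightarrow> P g \<Longrightarrow> P (f + g)"
  shows "P f"
proof -
  have m: "P (smonom m 1)" for m
  proof (induction m rule: smon_induct)
    case one
    show ?case using assms(1)[of 1] by (simp add: Const_def)
  next
    case (var a s m)
    then show ?case by (metis smonom_split assms(1,2,3) letter_def)
  qed
  have "P (\<Sum>m\<in>A. smonom m (a m))" if "finite A" for A a
    using that
  proof induction
    case empty
    show ?case using assms(1)[of 0] by (simp add: Const_simps)
  next
    case (insert x F)
    have "P (smonom x (a x))" using assms(3)[OF assms(1) m, of "a x" x] by (simp add: Const_mult_smonom)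
    then show ?case using insert assms(4) by simp
  qed
  then show ?thesis using superpoly_expand[of f] finite_monoms by metis
qed

lemma letter_simps: "letter (Inl a) s = Xvar (Gen a s)" "letter (Inr b) s = Thetavar (Gen b s)"
  by (simp_all add: letter_def Xvar_def Thetavar_def)

lemma Const_Const: "Const c * (Const d * f) = Const (c * d) * f"
  by (simp add: Const_simps mult.assoc)

section \<open>The action is by algebra homomorphisms\<close>

lemma act_superset:
  assumes "finite M" "monoms f \<subseteq> M"
  shows "act g f = (\<Sum>m\<in>M. Const (coeff_of f m) * act_smon g m)"
  unfolding act_def by (rule sum.mono_neutral_left) (use assms in \<open>auto simp: in_monoms_iff Const_simps\<close>)

lemma act_add: "act g (f + h) = act g f + act g h"
proof -
  let ?M = "monoms f \<union> monoms h"
  have "monoms (f + h) \<subseteq> ?M" by (auto simp: in_monoms_iff)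
  then show ?thesis
    by (subst (1 2 3) act_superset[where M = ?M])
       (auto simp: Const_simps distrib_right sum.distrib)
qed

lemma act_smonom: "act g (smonom m c) = Const c * act_smon g m"
  by (subst act_superset[where M = "{m}"]) (auto simp: in_monoms_iff coeff_of_smonom split: if_splits)

lemma act_0 [simp]: "act g 0 = 0"
  by (subst act_superset[where M = "{}"]) (auto simp: in_monoms_iff)

lemma act_sum: "act g (sum f A) = (\<Sum>x\<in>A. act g (f x))"
  by (induction A rule: infinite_finite_induct) (simp_all add: act_add)

lemma prod_list_mult_commuting:
  fixes a b :: "'b \<Rightarrow> 'a::monoid_mult"
  assumes "\<And>v w. a v * b w = b w * a v"
  shows "prod_list (map (\<lambda>v. a v * b v) xs) = prod_list (map a xs) * prod_list (map b xs)"
proof (induction xs)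
  case (Cons x xs)
  let ?A = "prod_list (map a xs)" and ?B = "prod_list (map b xs)"
  have comm: "b x * prod_list (map a ys) = prod_list (map a ys) * b x" for ys
    by (induction ys) (simp_all add: assms[symmetric] mult.assoc, metis assms mult.assoc)
  have "a x * b x * (?A * ?B) = a x * (b x * ?A) * ?B" by (simp only: mult.assoc)
  also have "\<dots> = a x * ?A * (b x * ?B)" by (simp only: comm) (simp only: mult.assoc)
  finally show ?case using Cons by simp
qed simp

lemma prod_list_sorted_superset:
  fixes t :: "'b::linorder \<Rightarrow> 'a::monoid_mult"
  assumes "finite M" "Poly_Mapping.keys e \<subseteq> M"
  shows "prod_list (map (\<lambda>v. t v ^ Poly_Mapping.lookup e v) (sorted_list_of_set (Poly_Mapping.keys e)))
       = prod_list (map (\<lambda>v. t v ^ Poly_Mapping.lookup e v) (sorted_list_of_set M))"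
proof -
  have "sorted_list_of_set (Poly_Mapping.keys e)
      = filter (\<lambda>v. v \<in> Poly_Mapping.keys e) (sorted_list_of_set M)"
    by (rule sorted_distinct_set_unique) (use assms in \<open>auto simp: sorted_wrt_filter\<close>)
  moreover have "prod_list (map (\<lambda>v. t v ^ Poly_Mapping.lookup e v) (filter (\<lambda>v. v \<in> Poly_Mapping.keys e) xs))
       = prod_list (map (\<lambda>v. t v ^ Poly_Mapping.lookup e v) xs)" for xs
    by (induction xs) (simp_all add: in_keys_iff)
  ultimately show ?thesis by simp
qed

text \<open>
  The bosonic factors commute, so the ordered products multiply by adding exponents. Extending both products
  over a common set of variables makes the two lists of factors equal.
\<close>

lemma prod_list_exponents_add:
  fixes t :: "'b::linorder \<Rightarrow> 'a::monoid_mult" and e e' :: "'b \<Rightarrow>\<^sub>0 nat"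
  assumes comm: "\<And>v w. t v * t w = t w * t v"
  defines "B \<equiv> \<lambda>e. prod_list (map (\<lambda>v. t v ^ Poly_Mapping.lookup e v) (sorted_list_of_set (Poly_Mapping.keys e)))"
  shows "B (e + e') = B e * B e'"
proof -
  let ?M = "Poly_Mapping.keys e \<union> Poly_Mapping.keys e'"
  have powcomm: "t v ^ a * t w ^ b = t w ^ b * t v ^ a" for v w a b
    by (metis comm power_commuting_commutes)
  show ?thesis
    unfolding B_def
    apply (subst (1 2 3) prod_list_sorted_superset[where M = ?M])
    using keys_add[of e e'] 
    by (auto simp: lookup_add power_add intro!: prod_list_mult_commuting powcomm)
qed

text \<open>
  Products of arbitrary anticommuting elements of square zero multiply with the same signs as the
  variables themselves. Both factors are built up from their least elements, for which no sign occurs; the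
  sign in general then follows from the cocycle identity \<open>koszul_sign_assoc\<close>.
\<close>

lemma prod_list_anticommuting:
  fixes t :: "gen \<Rightarrow> superpoly"
  assumes anti: "\<And>v w. t v * t w = - (t w * t v)" and sq: "\<And>v. t v * t v = 0"
  defines "F \<equiv> \<lambda>A. prod_list (map t (sorted_list_of_set (fset A)))"
  shows "F A * F B = Const (koszul_sign A B) * F (A |\<union>| B)"
proof -
  have F_empty [simp]: "F {||} = 1" by (simp add: F_def)
  have F_least: "F (finsert v A) = t v * F A" if "\<And>w. w |\<in>| A \<Longrightarrow> v < w" for v A
  proof -
    have "sorted_list_of_set (fset (finsert v A)) = v # sorted_list_of_set (fset A)"
    proof -
      have "v \<notin> fset A" using that by (metis order.irrefl)
      moreover have "insort v (sorted_list_of_set (fset A)) = v # sorted_list_of_set (fset A)"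
        by (rule insort_is_Cons) (metis that less_imp_le set_sorted_list_of_set finite_fset)
      ultimately show ?thesis by simp
    qed
    then show ?thesis by (simp add: F_def)
  qed
  have induct: "Q A" if "Q {||}" "\<And>v A. Q A \<Longrightarrow> (\<And>w. w |\<in>| A \<Longrightarrow> v < w) \<Longrightarrow> Q (finsert v A)" for Q and A :: "gen fset"
  proof (induction "fcard A" arbitrary: A)
    case 0
    then show ?case using that(1) by simp
  next
    case (Suc n)
    then have ne: "fset A \<noteq> {}" by (metis bot_fset.rep_eq fcard_fempty fset_inject nat.distinct(1))
    define v where "v = Min (fset A)"
    have v: "v |\<in>| A" using ne by (simp add: v_def)
    have "v < w" if "w |\<in>| A |-| {|v|}" for w
      using that by (auto simp: v_def order.strict_iff_order)
    moreover have "fcard (A |-| {|v|}) = n" using Suc v by (simp add: fcard_fminus_fsingleton)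
    ultimately have "Q (finsert v (A |-| {|v|}))" using that(2) Suc(1) by blast
    then show ?case using v by (simp add: finsert_absorb)
  qed
  have single: "t v * F B = Const (koszul_sign {|v|} B) * F (finsert v B)" for v B
  proof (induction B rule: induct)
    case 1
    show ?case using F_least[of "{||}" v] by (simp add: Const_simps)
  next
    case (2 w B)
    note least = 2(2)
    consider "v < w" | "v = w" | "w < v" by fastforce
    then show ?case
    proof cases
      case 1
      then have "\<And>u. u |\<in>| finsert w B \<Longrightarrow> v < u" using 1 2(2) by (auto intro: order.strict_trans)
      then show ?thesis using F_least[of "finsert w B" v] koszul_sign_least[of "finsert w B" v] by (simp add: Const_simps)
    next
      case 2
      have "koszul_sign {|v|} (finsert w B) = 0" using 2 by (simp add: koszul_sign_def)
      moreover have "t v * F (finsert w B) = t v * t v * F B"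
        using \<open>v = w\<close> F_least[OF least] by (simp add: mult.assoc)
      ultimately show ?thesis by (simp add: sq Const_simps)
    next
      case 3
      have "t v * F (finsert w B) = - (t w * (t v * F B))"
        using F_least[OF least] anti[of v w] by (simp flip: mult.assoc)
      also have "\<dots> = Const (- koszul_sign {|v|} B) * (t w * F (finsert v B))"
        by (simp add: "2.IH" Const_simps(5) Const_left_commute[of "t w"])
      also have "t w * F (finsert v B) = F (finsert v (finsert w B))"
        using F_least[of "finsert v B" w] least 3 by (metis finsert_commute finsert_iff)
      also have "- koszul_sign {|v|} B = koszul_sign {|v|} (finsert w B)"
      proof -
        have vw: "koszul_sign {|v|} {|w|} = -1" 
        proof -
          have "{(a, b). a = v \<and> b = w \<and> b < a} = {(v, w)}" using 3 by auto
          then show ?thesis using 3 by (simp add: koszul_sign_def)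
        qed
        have wB: "koszul_sign {|w|} B = 1" using koszul_sign_least least by blast
        have wvB: "koszul_sign {|w|} ({|v|} |\<union>| B) = 1" 
          by (rule koszul_sign_least) (use least 3 in auto)
        have wv: "koszul_sign {|w|} {|v|} = 1" by (rule koszul_sign_least) (use 3 in auto)
        have "koszul_sign ({|v|} |\<union>| {|w|}) B = - koszul_sign {|v|} (finsert w B)"
          using koszul_sign_assoc[of "{|v|}" "{|w|}" B] vw wB by (simp; metis minus_minus)
        moreover have "koszul_sign ({|w|} |\<union>| {|v|}) B = koszul_sign {|v|} B"
          using koszul_sign_assoc[of "{|w|}" "{|v|}" B] wv wvB by simp
        ultimately show ?thesis by (metis sup.commute minus_minus)
      qed
      finally show ?thesis .
    qed
  qed
  show ?thesis
  proof (induction A rule: induct)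
    case 1
    show ?case by (simp add: Const_simps)
  next
    case (2 v A)
    have "F (finsert v A) * F B = t v * (F A * F B)" using F_least 2 by (simp add: mult.assoc)
    also have "\<dots> = Const (koszul_sign A B * koszul_sign {|v|} (A |\<union>| B)) * F (finsert v (A |\<union>| B))"
      by (simp add: 2 Const_left_commute[of "t v"] single Const_Const)
    also have "koszul_sign A B * koszul_sign {|v|} (A |\<union>| B) = koszul_sign (finsert v A) B"
      using koszul_sign_assoc[of "{|v|}" A B] koszul_sign_least[of A v] 2 by simp
    finally show ?case by simp
  qed
qed

lemma sum_mult_sum_commute:
  fixes a b :: "'i \<Rightarrow> 'a::semiring_0"
  assumes "\<And>i j. a i * b j = b j * a i"
  shows "sum a A * sum b B = sum b B * sum a A"
  unfolding sum_product by (subst sum.swap) (simp add: assms)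

lemma sum_mult_sum_anticommute:
  fixes a b :: "'i \<Rightarrow> 'a::ring"
  assumes "\<And>i j. a i * b j = - (b j * a i)"
  shows "sum a A * sum b B = - (sum b B * sum a A)"
  unfolding sum_product by (subst sum.swap) (simp add: assms sum_negf)

lemma act_X_commute: "act_X g v * act_X g w = act_X g w * act_X g v"
proof -
  have "(Const c * Xvar v) * (Const d * Xvar w) = (Const d * Xvar w) * (Const c * Xvar v)" for c d v w
    by (metis Const_commute Xvar_commute mult.assoc)
  then show ?thesis unfolding act_X_def by (rule sum_mult_sum_commute)
qed

lemma act_X_Theta_commute: "act_X g v * act_Theta g w = act_Theta g w * act_X g v"
proof -
  have "(Const c * Xvar v) * (Const d * Thetavar w) = (Const d * Thetavar w) * (Const c * Xvar v)" for c d v w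
    by (metis Const_commute Xvar_Thetavar_commute mult.assoc)
  then show ?thesis unfolding act_X_def act_Theta_def by (rule sum_mult_sum_commute)
qed

lemma Const_Theta_anti: "(Const c * Thetavar v) * (Const d * Thetavar w) = - ((Const d * Thetavar w) * (Const c * Thetavar v))"
proof -
  have "(Const c * Thetavar v) * (Const d * Thetavar w) = Const (c * d) * (Thetavar v * Thetavar w)" for c d v w
    by (simp add: mult.assoc Const_left_commute[of "Thetavar v"] Const_Const)
  then show ?thesis using Thetavar_anticommute[of v w] by (simp add: mult.commute)
qed

lemma act_Theta_anti: "act_Theta g v * act_Theta g w = - (act_Theta g w * act_Theta g v)"
  unfolding act_Theta_def by (rule sum_mult_sum_anticommute) (rule Const_Theta_anti)

text \<open>
  In characteristic \<open>0\<close> an element that anticommutes with itself has square zero.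
\<close>

lemma act_Theta_square: "act_Theta g v * act_Theta g v = 0"
proof -
  have "act_Theta g v * act_Theta g v = - (act_Theta g v * act_Theta g v)" by (rule act_Theta_anti)
  then have "coeff_of (act_Theta g v * act_Theta g v) m = - coeff_of (act_Theta g v * act_Theta g v) m" for m
    using coeff_of_simps(3) by metis
  then show ?thesis by (intro superpoly_eqI) simp
qed

lemma act_smon_times:
  "act_smon g m * act_smon g m' = Const (koszul_sign (snd m) (snd m')) * act_smon g (smon_times m m')"
proof -
  define B where "B = (\<lambda>e. prod_list (map (\<lambda>v. act_X g v ^ Poly_Mapping.lookup e v) (sorted_list_of_set (Poly_Mapping.keys e))))"
  define F where "F = (\<lambda>A. prod_list (map (act_Theta g) (sorted_list_of_set (fset A))))"
  have act: "act_smon g m = B (fst m) * F (snd m)" for m by (simp add: act_smon_def B_def F_def)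
  have BB: "B (e + e') = B e * B e'" for e e'
    unfolding B_def by (rule prod_list_exponents_add) (rule act_X_commute)
  have FF: "F A * F A' = Const (koszul_sign A A') * F (A |\<union>| A')" for A A'
    unfolding F_def by (rule prod_list_anticommuting) (rule act_Theta_anti act_Theta_square)+
  have XF: "act_X g v * prod_list (map (act_Theta g) ws) = prod_list (map (act_Theta g) ws) * act_X g v" for v ws
    by (induction ws) (simp_all add: mult.assoc, metis act_X_Theta_commute mult.assoc)
  then have XF: "act_X g v ^ n * prod_list (map (act_Theta g) ws) = prod_list (map (act_Theta g) ws) * act_X g v ^ n" for v ws n
    by (rule power_commuting_commutes)
  have "prod_list (map (\<lambda>v. act_X g v ^ Poly_Mapping.lookup e v) vs) * F A = F A * prod_list (map (\<lambda>v. act_X g v ^ Poly_Mapping.lookup e v) vs)" for e vs A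
    unfolding F_def by (induction vs) (simp_all add: mult.assoc, metis XF mult.assoc)
  then have BF: "B e * F A = F A * B e" for e A by (simp add: B_def)
  have "act_smon g m * act_smon g m' = B (fst m) * B (fst m') * (F (snd m) * F (snd m'))"
    unfolding act by (metis BF mult.assoc)
  then show ?thesis by (simp add: FF BB act smon_times_def Const_left_commute[of "B _ * B _"])
qed

text \<open>
  By bilinearity it suffices to multiply monomials, for which \<open>act_smon_times\<close> says that the images satisfy
  the same sign rule.
\<close>

lemma act_mult: "act g (f * h) = act g f * act g h"
proof -
  have 1: "act g (smonom m c * smonom m' c') = act g (smonom m c) * act g (smonom m' c')" for m m' c c'
  proof -
    have "act g (smonom m c) * act g (smonom m' c') = Const c * (act_smon g m * (Const c' * act_smon g m'))"
      by (simp add: act_smonom mult.assoc)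
    also have "\<dots> = Const (c * c') * (act_smon g m * act_smon g m')"
      by (simp only: Const_left_commute[of "act_smon g m"] Const_Const)
    finally show ?thesis by (simp add: act_smon_times Const_Const smonom_mult act_smonom mult_ac)
  qed
  have "act g ((\<Sum>m\<in>A. smonom m (a m)) * (\<Sum>m\<in>B. smonom m (b m))) = act g (\<Sum>m\<in>A. smonom m (a m)) * act g (\<Sum>m\<in>B. smonom m (b m))" for a A b B
    by (simp add: sum_distrib_left sum_distrib_right act_sum 1)
  from this[of "coeff_of f" "monoms f" "coeff_of h" "monoms h"]
  show ?thesis by (simp only: superpoly_expand[symmetric])
qed

lemma act_Const [simp]: "act g (Const c) = Const c"
  by (simp add: Const_def act_smonom) (simp add: act_smon_def Const_def flip: one_superpoly.abs_eq)

lemma act_letter: "act g (letter a s) = (\<Sum>r\<in>UNIV. Const (g $ r $ s) * letter a r)"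
  by (cases a) (simp_all add: letter_def act_smonom act_smon_def Const_simps act_X_def act_Theta_def Xvar_def Thetavar_def)

lemma act_minus: "act g (f - h) = act g f - act g h"
  by (metis act_add add_diff_cancel diff_add_cancel)

lemma act_compose: "act (A ** B) f = act A (act B f)"
proof (induction f rule: superpoly_induct)
  case (var a s)
  show ?case
  proof -
    have "act A (act B (letter a s)) = (\<Sum>t\<in>UNIV. \<Sum>r\<in>UNIV. Const (A $ r $ t * B $ t $ s) * letter a r)"
      by (simp add: act_letter act_sum act_mult sum_distrib_left Const_Const mult.commute)
    also have "\<dots> = act (A ** B) (letter a s)"
      by (subst sum.swap) (simp add: act_letter matrix_matrix_mult_def Const_sum sum_distrib_right)
    finally show ?thesis ..
  qed
qed (simp_all add: act_add act_mult)

lemma act_id: "act (mat 1) f = f"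
proof (induction f rule: superpoly_induct)
  case (var a s)
  have "letter a s = (\<Sum>r\<in>UNIV. (if r = s then letter a s else 0))" by simp
  also have "\<dots> = act (mat 1) (letter a s)"
    unfolding act_letter by (rule sum.cong) (auto simp: mat_def Const_simps)
  finally show ?case ..
qed (simp_all add: act_add act_mult)

section \<open>Weights of monomials\<close>

text \<open>
  The degree obtained by giving weight \<open>w a s\<close> to the \<open>s\<close>-th variable of pair \<open>a\<close>. Multidegree, bidegree and
  membership in \<open>S\<close> (variables outside the allowed range have weight \<open>1\<close>, and the degree is \<open>0\<close>) are all instances,
  so that the effect of a substitution on all of them is treated once.
\<close>

definition wdeg :: "(nat + nat \<Rightarrow> 2 \<Rightarrow> nat) \<Rightarrow> smon \<Rightarrow> nat" where
  "wdeg w m = (\<Sum>v\<in>Poly_Mapping.keys (fst m). Poly_Mapping.lookup (fst m) v * w (Inl (pair_of v)) (comp_of v))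
     + (\<Sum>v\<in>fset (snd m). w (Inr (pair_of v)) (comp_of v))"

lemma wdeg_one [simp]: "wdeg w (0, {||}) = 0"
  by (simp add: wdeg_def)

lemma wdeg_var [simp]: "wdeg w (var a s) = w a s"
  by (cases a) (simp_all add: wdeg_def)

lemma wdeg_times:
  assumes "compat m m'" shows "wdeg w (smon_times m m') = wdeg w m + wdeg w m'"
proof -
  define B where "B = (\<lambda>e. \<Sum>v\<in>Poly_Mapping.keys e. Poly_Mapping.lookup e v * w (Inl (pair_of v)) (comp_of v))"
  have B: "B e = (\<Sum>v\<in>M. Poly_Mapping.lookup e v * w (Inl (pair_of v)) (comp_of v))"
    if "finite M" "Poly_Mapping.keys e \<subseteq> M" for e M
    unfolding B_def by (rule sum.mono_neutral_left) (use that in \<open>auto simp: in_keys_iff\<close>)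
  have "B (e + e') = B e + B e'" for e e'
    using keys_add[of e e']
    by (subst (1 2 3) B[of "Poly_Mapping.keys e \<union> Poly_Mapping.keys e'"])
       (auto simp: lookup_add distrib_right sum.distrib)
  moreover have "fset (snd m) \<inter> fset (snd m') = {}"
    using assms by (auto simp: compat_def)
  ultimately show ?thesis
    by (simp add: wdeg_def smon_times_def sum.union_disjoint B_def)
qed

lemma wdeg_add: "wdeg (\<lambda>a s. w a s + w' a s) m = wdeg w m + wdeg w' m"
  by (simp add: wdeg_def sum.distrib distrib_left)

text \<open>
  A monomial of positive weight contains a variable of positive weight, which can be split off.
\<close>

lemma wdeg_split:
  assumes "wdeg w m > 0"
  obtains a s m' where "w a s > 0" "compat (var a s) m'" "m = smon_times (var a s) m'"
proof -
  have "wdeg w m > 0 \<longrightarrow> (\<exists>a s m'. w a s > 0 \<and> compat (var a s) m' \<and> m = smon_times (var a s) m')"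
  proof (induction m rule: smon_induct)
    case (var a s m)
    show ?case
    proof (intro impI, cases "w a s > 0")
      case False
      moreover assume "wdeg w (smon_times (var a s) m) > 0"
      ultimately have "wdeg w m > 0" using var(1) by (simp add: wdeg_times)
      with var obtain b t m' where *: "w b t > 0" "compat (var b t) m'" "m = smon_times (var b t) m'"
        by blast
      have "compat (var b t) (smon_times (var a s) m')"
        using * var(1) by (auto simp: compat_def smon_times_def)
      moreover have "smon_times (var a s) m = smon_times (var b t) (smon_times (var a s) m')"
        using *(3) by (metis smon_times_assoc smon_times_commute)
      ultimately show "\<exists>b t m'. w b t > 0 \<and> compat (var b t) m' \<and> smon_times (var a s) m = smon_times (var b t) m'"
        using * by blast
    qed (use var in blast)
  qed simp
  then show ?thesis using assms that by blast
qed

lemma wdeg_total_0_iff: "wdeg (\<lambda>_ _. 1) m = 0 \<longleftrightarrow> m = (0, {||})"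
proof -
  have "wdeg (\<lambda>_ _. 1) m = 0 \<longrightarrow> m = (0, {||})"
    by (induction m rule: smon_induct) (simp_all add: wdeg_times)
  then show ?thesis by auto
qed

definition homog :: "(nat + nat \<Rightarrow> 2 \<Rightarrow> nat) \<Rightarrow> nat \<Rightarrow> superpoly \<Rightarrow> bool" where
  "homog w c f \<longleftrightarrow> (\<forall>m\<in>monoms f. wdeg w m = c)"

lemma monoms_0 [simp]: "monoms 0 = {}" by (auto simp: in_monoms_iff)

lemma monoms_smonom: "monoms (smonom m c) = (if c = 0 then {} else {m})"
  by (auto simp: in_monoms_iff coeff_of_smonom split: if_splits)

lemma monoms_add: "monoms (f + g) \<subseteq> monoms f \<union> monoms g" by (auto simp: in_monoms_iff)
lemma monoms_diff: "monoms (f - g) \<subseteq> monoms f \<union> monoms g" by (auto simp: in_monoms_iff)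
lemma monoms_Const_mult: "monoms (Const c * f) \<subseteq> monoms f" by (auto simp: in_monoms_iff)
lemma monoms_sum: "monoms (sum f A) \<subseteq> (\<Union>x\<in>A. monoms (f x))"
  by (auto simp: in_monoms_iff coeff_of_sum) (meson sum.neutral)

text \<open>
  A product of monomials sharing a fermionic variable vanishes, so every monomial of a product comes from
  compatible factors, whose weights add up.
\<close>

lemma monoms_mult:
  assumes "m \<in> monoms (f * g)"
  obtains a b where "a \<in> monoms f" "b \<in> monoms g" "compat a b" "m = smon_times a b"
proof -
  have "(\<Sum>a\<in>A. smonom a (x a)) * (\<Sum>b\<in>B. smonom b (y b))
     = (\<Sum>a\<in>A. \<Sum>b\<in>B. smonom (smon_times a b) (koszul_sign (snd a) (snd b) * x a * y b))" for x A y B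
    by (simp add: sum_product smonom_mult)
  from this[of "coeff_of f" "monoms f" "coeff_of g" "monoms g"]
  have "f * g = (\<Sum>a\<in>monoms f. \<Sum>b\<in>monoms g. smonom (smon_times a b) (koszul_sign (snd a) (snd b) * coeff_of f a * coeff_of g b))"
    by (simp only: superpoly_expand[symmetric])
  then have "monoms (f * g) \<subseteq> (\<Union>a\<in>monoms f. \<Union>b\<in>monoms g.
      monoms (smonom (smon_times a b) (koszul_sign (snd a) (snd b) * coeff_of f a * coeff_of g b)))"
    by (simp only:) (intro order.trans[OF monoms_sum] UN_mono order.refl)
  with assms obtain a b where "a \<in> monoms f" "b \<in> monoms g" 
    "m \<in> monoms (smonom (smon_times a b) (koszul_sign (snd a) (snd b) * coeff_of f a * coeff_of g b))"
    by blast
  then show ?thesis using that[of a b] 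
    by (auto simp: monoms_smonom compat_def koszul_sign_def split: if_splits)
qed

lemma homog_0 [simp]: "homog w c 0" by (simp add: homog_def)
lemma homog_smonom: "wdeg w m = c \<Longrightarrow> homog w c (smonom m x)" by (simp add: homog_def monoms_smonom)
lemma homog_add: "homog w c f \<Longrightarrow> homog w c g \<Longrightarrow> homog w c (f + g)" using monoms_add by (fastforce simp: homog_def)
lemma homog_diff: "homog w c f \<Longrightarrow> homog w c g \<Longrightarrow> homog w c (f - g)" using monoms_diff by (fastforce simp: homog_def)
lemma homog_Const_mult: "homog w c f \<Longrightarrow> homog w c (Const x * f)" using monoms_Const_mult by (fastforce simp: homog_def)
lemma homog_sum: "(\<And>x. x \<in> A \<Longrightarrow> homog w c (f x)) \<Longrightarrow> homog w c (sum f A)" 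
  by (induction A rule: infinite_finite_induct) (auto intro: homog_add)
lemma homog_mult: "homog w c f \<Longrightarrow> homog w d g \<Longrightarrow> homog w (c + d) (f * g)"
  unfolding homog_def by (metis monoms_mult wdeg_times)
lemma homog_Const: "homog w 0 (Const c)" by (simp add: Const_def homog_smonom)

lemma homog_unique: "homog w c f \<Longrightarrow> coeff_of f m \<noteq> 0 \<Longrightarrow> wdeg w m = c"
  by (simp add: homog_def in_monoms_iff)

text \<open>
  A substitution sending each variable of \<open>w'\<close>-weight \<open>c\<close> to something homogeneous of \<open>w\<close>-weight \<open>c\<close> does the same
  with monomials.
\<close>

lemma homog_act_smonom:
  assumes "\<And>a s. homog w (w' a s) (act g (letter a s))"
  shows "homog w (wdeg w' m) (act g (smonom m c))"
proof -
  have "homog w (wdeg w' m) (act g (smonom m 1))"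
  proof (induction m rule: smon_induct)
    case one
    show ?case using homog_Const[of w 1] by (metis Const_def act_Const wdeg_one)
  next
    case (var a s m)
    obtain e where "smonom (smon_times (var a s) m) 1 = Const e * (smonom (var a s) 1 * smonom m 1)"
      using smonom_split[OF var(1)] by metis
    then have "act g (smonom (smon_times (var a s) m) 1) = Const e * (act g (letter a s) * act g (smonom m 1))"
      by (simp add: act_mult letter_def)
    then show ?case using homog_Const_mult[OF homog_mult[OF assms var(2)]] var(1) by (simp add: wdeg_times)
  qed
  from homog_Const_mult[OF this, of c] show ?thesis
    by (metis Const_mult_smonom act_Const act_mult mult.right_neutral)
qed

lemma act_expand: "act g f = (\<Sum>m\<in>monoms f. act g (smonom m (coeff_of f m)))"
  by (simp add: act_smonom act_def[of g f])

lemma homog_act: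
  assumes "\<And>a s. homog w (w' a s) (act g (letter a s))" "homog w' c f"
  shows "homog w c (act g f)"
  unfolding act_expand[of g f]
  by (rule homog_sum) (use homog_act_smonom[OF assms(1)] assms(2) in \<open>force simp: homog_def\<close>)

lemma homog_letter: "homog w (w a s) (letter a s)" by (simp add: letter_def homog_smonom)

text \<open>
  The group mixes only the two variables of a pair, so weights that depend on the pair alone are preserved.
\<close>

lemma homog_act_pairwise:
  assumes "homog (\<lambda>a s. u a) c f"
  shows "homog (\<lambda>a s. u a) c (act g f)"
proof (rule homog_act[OF _ assms])
  fix a s show "homog (\<lambda>a s. u a) (u a) (act g (letter a s))"
    unfolding act_letter using homog_letter[of "\<lambda>a s. u a"] by (intro homog_sum homog_Const_mult) simp
qed

text \<open>
  A nonconstant monomial is sent to something homogeneous of positive total degree.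
\<close>

lemma coeff_of_act_const: "coeff_of (act g f) (0, {||}) = coeff_of f (0, {||})"
proof -
  have "coeff_of (act g (smonom m c)) (0, {||}) = coeff_of (smonom m c) (0, {||})" for m c
  proof (cases "m = (0, {||})")
    case True then show ?thesis by (simp flip: Const_def)
  next
    case False
    have "homog (\<lambda>a s. 1) (wdeg (\<lambda>a s. 1) m) (act g (smonom m c))"
      by (rule homog_act_pairwise) (simp add: homog_smonom)
    then show ?thesis using False homog_unique wdeg_total_0_iff by (metis coeff_of_smonom wdeg_one)
  qed
  then have "coeff_of (act g f) (0, {||}) = coeff_of (\<Sum>m\<in>monoms f. smonom m (coeff_of f m)) (0, {||})"
    unfolding act_expand[of g f] by (simp only: coeff_of_sum)
  then show ?thesis by (simp only: superpoly_expand[symmetric])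
qed

definition pairw :: "nat + nat \<Rightarrow> nat + nat \<Rightarrow> 2 \<Rightarrow> nat" where
  "pairw a b s = (if b = a then 1 else 0)"

definition cdeg :: "2 \<Rightarrow> smon \<Rightarrow> nat" where
  "cdeg s = wdeg (\<lambda>b t. if t = s then 1 else 0)"

definition valid :: "nat \<Rightarrow> nat \<Rightarrow> nat + nat \<Rightarrow> bool" where
  "valid k j a = (case a of Inl r \<Rightarrow> r < k | Inr r \<Rightarrow> r < j)"

definition outw :: "nat \<Rightarrow> nat \<Rightarrow> nat + nat \<Rightarrow> 2 \<Rightarrow> nat" where
  "outw k j a s = (if valid k j a then 0 else 1)"

lemma has_multidegree_iff: "has_multidegree d m \<longleftrightarrow> (\<forall>a. wdeg (pairw a) m = Poly_Mapping.lookup d a)"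
proof -
  have l: "wdeg (pairw (Inl r)) m = (\<Sum>s\<in>UNIV. Poly_Mapping.lookup (fst m) (Gen r s))" for r
  proof -
    have "wdeg (pairw (Inl r)) m = (\<Sum>v\<in>Poly_Mapping.keys (fst m). if pair_of v = r then Poly_Mapping.lookup (fst m) v else 0)"
      by (auto simp: wdeg_def pairw_def intro!: sum.cong)
    also have "\<dots> = (\<Sum>v\<in>Poly_Mapping.keys (fst m) \<inter> {v. pair_of v = r}. Poly_Mapping.lookup (fst m) v)"
      by (simp add: sum.inter_restrict)
    also have "\<dots> = (\<Sum>v\<in>Gen r ` UNIV. Poly_Mapping.lookup (fst m) v)"
    proof (rule sum.mono_neutral_left)
      show "Poly_Mapping.keys (fst m) \<inter> {v. pair_of v = r} \<subseteq> range (Gen r)"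
        by (auto simp: image_iff) (metis gen.collapse)
    qed (auto simp: in_keys_iff)
    finally show ?thesis by (simp add: sum.reindex inj_on_def)
  qed
  have r: "wdeg (pairw (Inr r)) m = card {s. Gen r s |\<in>| snd m}" for r
  proof -
    have "wdeg (pairw (Inr r)) m = card (fset (snd m) \<inter> {v. pair_of v = r})"
      by (auto simp: wdeg_def pairw_def sum.If_cases)
    also have "fset (snd m) \<inter> {v. pair_of v = r} = Gen r ` {s. Gen r s |\<in>| snd m}"
      by (auto simp: image_iff) (metis gen.collapse)
    finally show ?thesis by (simp add: card_image inj_on_def)
  qed
  show ?thesis unfolding has_multidegree_def
    by (metis l r sum.exhaust_sel)
qed

lemma carrier_iff: "f \<in> carrier (superpoly_ring k j) \<longleftrightarrow> homog (outw k j) 0 f"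
  unfolding superpoly_ring_def homog_def wdeg_def outw_def valid_def
  by (auto simp: ring_of_type_algebra_def in_keys_iff)

lemma homogeneous_iff: "f \<in> homogeneous k j d \<longleftrightarrow>
    homog (outw k j) 0 f \<and> (\<forall>a. homog (pairw a) (Poly_Mapping.lookup d a) f)"
  by (auto simp: homogeneous_def carrier_iff has_multidegree_iff homog_def)

lemma act_carrier: "f \<in> carrier (superpoly_ring k j) \<Longrightarrow> act g f \<in> carrier (superpoly_ring k j)"
  unfolding carrier_iff outw_def by (rule homog_act_pairwise)

lemma act_homogeneous: "f \<in> homogeneous k j d \<Longrightarrow> act g f \<in> homogeneous k j d"
  unfolding homogeneous_iff outw_def pairw_def by (auto intro: homog_act_pairwise)

text \<open>
  The matrices of the rotation by \<open>t\<close> and of \<open>\<phi>\<close> in the eigenbasis are \<open>dmat t\<close> and \<open>swapmat\<close>.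
\<close>

definition dmat :: "real \<Rightarrow> complex^2^2" where
  "dmat t = vector [vector [cis (- t), 0], vector [0, cis t]]"

definition swapmat :: "complex^2^2" where
  "swapmat = vector [vector [0, 1], vector [1, 0]]"

lemma one_neq_two [simp]: "(1::2) \<noteq> 2" "(2::2) \<noteq> 1"
  by simp_all

definition other :: "2 \<Rightarrow> 2" where "other s = (if s = 1 then 2 else 1)"

lemma other_other [simp]: "other (other s) = s"
  using exhaust_2[of s] by (auto simp: other_def)

lemma act_dmat_letter: "act (dmat t) (letter a 1) = Const (cis (- t)) * letter a 1" "act (dmat t) (letter a 2) = Const (cis t) * letter a 2"
  by (simp_all add: act_letter sum_2 dmat_def Const_simps)

lemma act_swapmat_letter: "act swapmat (letter a s) = letter a (other s)"
  using exhaust_2[of s] by (auto simp add: act_letter sum_2 swapmat_def Const_simps other_def)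

lemma cdeg_times: "compat m m' \<Longrightarrow> cdeg s (smon_times m m') = cdeg s m + cdeg s m'"
  by (simp add: cdeg_def wdeg_times)

lemma cdeg_simps [simp]: "cdeg s (0, {||}) = 0" "cdeg s (var a t) = (if t = s then 1 else 0)"
  by (simp_all add: cdeg_def)

lemma act_dmat_smonom:
  "act (dmat t) (smonom m c) = smonom m (c * cis (t * (real (cdeg 2 m) - real (cdeg 1 m))))"
proof -
  have "act (dmat t) (smonom m 1) = smonom m (cis (t * (real (cdeg 2 m) - real (cdeg 1 m))))"
  proof (induction m rule: smon_induct)
    case one
    show ?case by (simp flip: Const_def)
  next
    case (var a s m)
    obtain e where e: "\<And>c. smonom (smon_times (var a s) m) c = Const e * (letter a s * smonom m c)"
      using smonom_split[OF var(1)] unfolding letter_def by metis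
    define x where "x = (if s = 1 then cis (- t) else cis t)"
    let ?y = "cis (t * (real (cdeg 2 m) - real (cdeg 1 m)))"
    have letter: "act (dmat t) (letter a s) = Const x * letter a s"
      using exhaust_2[of s] by (auto simp: x_def act_dmat_letter)
    have "act (dmat t) (smonom (smon_times (var a s) m) 1) = Const e * (Const x * letter a s * smonom m ?y)"
      by (simp add: e act_mult letter var(2))
    also have "\<dots> = Const x * smonom (smon_times (var a s) m) ?y"
      unfolding e by (simp add: Const_left_commute[of "letter a s"] Const_Const mult.assoc mult.commute)
    also have "x * ?y = cis (t * (real (cdeg 2 (smon_times (var a s) m)) - real (cdeg 1 (smon_times (var a s) m))))"
      using exhaust_2[of s] by (auto simp: x_def cdeg_times[OF var(1)] cis_mult algebra_simps)
    then have "Const x * smonom (smon_times (var a s) m) ?y = smonom (smon_times (var a s) m) 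
        (cis (t * (real (cdeg 2 (smon_times (var a s) m)) - real (cdeg 1 (smon_times (var a s) m)))))"
      by (simp add: Const_mult_smonom)
    finally show ?case .
  qed
  then show ?thesis 
    by (metis Const_mult_smonom act_Const act_mult mult.right_neutral)
qed

lemma homog_act_swapmat:
  assumes "homog w c f" shows "homog (\<lambda>a s. w a (other s)) c (act swapmat f)"
proof (rule homog_act[OF _ assms])
  fix a s show "homog (\<lambda>a s. w a (other s)) (w a s) (act swapmat (letter a s))"
    using homog_letter[of "\<lambda>a s. w a (other s)" a "other s"] by (simp add: act_swapmat_letter)
qed

lemma cdeg_act_swapmat:
  assumes "m' \<in> monoms (act swapmat (smonom m c))"
  shows "cdeg s m' = cdeg (other s) m"
proof -
  have "homog (\<lambda>b t. if other t = other s then 1 else 0) (cdeg (other s) m) (act swapmat (smonom m c))"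
    using homog_act_swapmat[OF homog_smonom[OF refl, of "\<lambda>b t. if t = other s then 1 else 0" m c]]
    by (simp add: cdeg_def)
  moreover have "other t = other s \<longleftrightarrow> t = s" for t using exhaust_2[of t] exhaust_2[of s] by (auto simp: other_def)
  ultimately show ?thesis using assms by (simp add: homog_def cdeg_def)
qed

section \<open>The dihedral group and its characters\<close>

definition rot :: "real \<Rightarrow> complex^2^2" where
  "rot t = vector [vector [of_real (cos t), of_real (- sin t)], vector [of_real (sin t), of_real (cos t)]]"

text \<open>
  The columns of \<open>Pmat\<close> are the common eigenvectors \<open>(1, i)\<close> and \<open>(1, -i)\<close> of all rotations.
\<close>

definition Pmat :: "complex^2^2" where
  "Pmat = vector [vector [1, 1], vector [\<i>, - \<i>]]"

definition Pinv :: "complex^2^2" where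
  "Pinv = vector [vector [1/2, - \<i> / 2], vector [1/2, \<i> / 2]]"

lemmas mat2_simps = vec_eq_iff forall_2 matrix_matrix_mult_def sum_2 mat_def

lemma Pmat_Pinv: "Pmat ** Pinv = mat 1" "Pinv ** Pmat = mat 1"
  by (simp_all add: mat2_simps Pmat_def Pinv_def)

lemma rot_Pmat: "rot t ** Pmat = Pmat ** dmat t"
  by (simp add: mat2_simps Pmat_def rot_def dmat_def complex_eq_iff)

lemma phi_Pmat: "phi ** Pmat = Pmat ** swapmat"
  by (simp add: mat2_simps Pmat_def phi_def swapmat_def)

lemma rot_add: "rot s ** rot t = rot (s + t)"
  by (simp add: mat2_simps rot_def cos_add sin_add algebra_simps)

lemma rot_0: "rot 0 = mat 1"
  by (simp add: mat2_simps rot_def)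

lemma phi_rot: "phi ** rot t = rot (- t) ** phi"
  by (simp add: mat2_simps rot_def phi_def)

lemma phi_phi: "phi ** phi = mat 1"
  by (simp add: mat2_simps phi_def)

lemma rot_eq_iff: "rot s = rot t \<longleftrightarrow> cis s = cis t"
  by (auto simp add: mat2_simps rot_def complex_eq_iff)

lemma rot_neq_rot_phi: "rot s \<noteq> rot t ** phi"
proof
  assume *: "rot s = rot t ** phi"
  then have "cos s = cos t" "cos s = - cos t" "sin s = sin t" "sin s = - sin t"
    by (simp_all add: mat2_simps rot_def phi_def flip: of_real_minus)
  then show False using sin_cos_squared_add[of s] by simp
qed

lemma rho_eq_rot: "rho n = rot (2 * pi / n)"
  by (simp add: rho_def rot_def)

lemma GL2_simps [simp]: "x \<otimes>\<^bsub>GL2\<^esub> y = x ** y" "\<one>\<^bsub>GL2\<^esub> = mat 1" "x \<in> carrier GL2 \<longleftrightarrow> invertible x"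
  by (simp_all add: GL2_def)

lemma group_GL2: "group GL2"
proof (rule groupI)
  show "x \<otimes>\<^bsub>GL2\<^esub> y \<in> carrier GL2" if "x \<in> carrier GL2" "y \<in> carrier GL2" for x y
    using that by (simp add: invertible_mult)
  show "\<exists>y\<in>carrier GL2. y \<otimes>\<^bsub>GL2\<^esub> x = \<one>\<^bsub>GL2\<^esub>" if x: "x \<in> carrier GL2" for x
  proof -
    obtain y where "x ** y = mat 1" "y ** x = mat 1" using x by (auto simp: invertible_def)
    then have "invertible y" by (auto simp: invertible_def)
    with \<open>y ** x = mat 1\<close> show ?thesis by (intro bexI[of _ y]) simp_all
  qed
  show "\<one>\<^bsub>GL2\<^esub> \<in> carrier GL2"
    unfolding GL2_simps invertible_def by (metis matrix_mul_lid)
qed (simp_all add: matrix_mul_assoc)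

lemma invertible_rot: "invertible (rot t)"
  unfolding invertible_def by (metis rot_add rot_0 add.right_inverse add.left_inverse)

lemma invertible_phi: "invertible phi"
  unfolding invertible_def by (metis phi_phi)

lemma rho_pow: "rho n [^]\<^bsub>GL2\<^esub> (l::nat) = rot (2 * pi * l / n)"
proof (induction l)
  case 0
  show ?case using group.is_monoid[OF group_GL2] by (simp add: monoid.nat_pow_0 rot_0)
next
  case (Suc l)
  then show ?case using group.is_monoid[OF group_GL2] 
    by (simp add: monoid.nat_pow_Suc rho_eq_rot rot_add add_divide_distrib ring_distribs add.commute)
qed

text \<open>
  Inverses in the group produce negative exponents, while \<open>dihedral_fun\<close> refers to natural ones.
\<close>

lemma rot_int_mod:
  assumes "n > 0" obtains l' :: nat where "rot (2 * pi * of_int l / n) = rot (2 * pi * l' / real n)"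
proof -
  define l' where "l' = nat (l mod int n)"
  have "of_int l = real l' + real n * of_int (l div int n)"
    using assms unfolding l'_def by (metis mod_mult_div_eq of_int_add of_int_mult of_int_of_nat_eq of_nat_0_less_iff of_nat_nat pos_mod_sign)
  then have "2 * pi * of_int l / n = 2 * pi * l' / real n + 2 * pi * of_int (l div int n)"
    using assms by (simp add: field_simps)
  then have "rot (2 * pi * of_int l / n) = rot (2 * pi * l' / real n)"
    by (simp add: rot_eq_iff cis_mult[symmetric] cis_multiple_2pi)
  then show ?thesis using that by blast
qed

text \<open>
  Rotations by multiples of \<open>2 \<pi> / n\<close> and their products with \<open>\<phi>\<close> are closed under multiplication, because
  \<open>\<phi>\<close> inverts rotations, and contain the inverses of both generators.
\<close>

lemma dihedral_elements:
  assumes "n > 0" "g \<in> carrier (dihedral n)"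
  obtains l :: nat where "g = rot (2 * pi * l / n) \<or> g = rot (2 * pi * l / n) ** phi"
proof -
  interpret group GL2 by (rule group_GL2)
  let ?r = "\<lambda>l::int. rot (2 * pi * of_int l / n)"
  let ?D = "{g. \<exists>l::int. g = ?r l \<or> g = ?r l ** phi}"
  have rr: "?r l ** ?r l' = ?r (l + l')" for l l'
    by (simp add: rot_add add_divide_distrib ring_distribs)
  have pr: "phi ** ?r l = ?r (- l) ** phi" for l
    by (simp add: phi_rot)
  have r1: "rho n = ?r 1" by (simp add: rho_eq_rot)
  have "generate GL2 {rho n, phi} \<subseteq> ?D"
  proof
    fix g assume "g \<in> generate GL2 {rho n, phi}"
    then show "g \<in> ?D"
    proof induction
      case one
      have "\<one>\<^bsub>GL2\<^esub> = ?r 0" by (simp add: rot_0)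
      then show ?case by blast
    next
      case (incl h)
      have "phi = ?r 0 ** phi" by (simp add: rot_0)
      then show ?case using incl r1 by blast
    next
      case (inv h)
      have "inv\<^bsub>GL2\<^esub> rho n = ?r (- 1)"
        by (rule inv_equality) (simp_all add: rho_eq_rot rot_add rot_0 invertible_rot)
      moreover have "inv\<^bsub>GL2\<^esub> phi = ?r 0 ** phi"
        by (rule inv_equality) (auto simp: phi_phi rot_0 invertible_phi)
      ultimately show ?case using inv by blast
    next
      case (eng h1 h2)
      have a: "(?r l ** phi) ** ?r l' = ?r (l + - l') ** phi" for l l'
        by (simp only: matrix_mul_assoc[symmetric] pr) (simp only: matrix_mul_assoc rr)
      have b: "(?r l ** phi) ** (?r l' ** phi) = ?r (l + - l')" for l l'
        using arg_cong[OF a, of "\<lambda>x. x ** phi"]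
        by (simp only: matrix_mul_assoc[symmetric] phi_phi matrix_mul_rid)
      have c: "?r l ** (?r l' ** phi) = ?r (l + l') ** phi" for l l'
        by (simp only: rr matrix_mul_assoc)
      from eng obtain l l' where "h1 = ?r l \<or> h1 = ?r l ** phi" "h2 = ?r l' \<or> h2 = ?r l' ** phi" by blast
      then consider "h1 ** h2 = ?r (l + l')" | "h1 ** h2 = ?r (l + l') ** phi" 
        | "h1 ** h2 = ?r (l + - l')" | "h1 ** h2 = ?r (l + - l') ** phi"
        by (elim disjE) (simp_all only: rr a b c)
      then have "h1 ** h2 \<in> ?D" by cases blast+
      then show ?case by simp
    qed
  qed
  moreover have "carrier GL2 \<inter> {rho n, phi} = {rho n, phi}"
    by (auto simp: invertible_phi rho_eq_rot invertible_rot)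
  ultimately obtain l where "g = ?r l \<or> g = ?r l ** phi"
    using assms(2) unfolding dihedral_def carrier_subgroup_generated by auto
  then show ?thesis using rot_int_mod[OF assms(1), of l] that by metis
qed

lemma rho_phi_in_dihedral: "rho n \<in> carrier (dihedral n)" "phi \<in> carrier (dihedral n)"
  unfolding dihedral_def carrier_subgroup_generated
  by (auto intro!: generate.incl simp: invertible_phi rho_eq_rot invertible_rot)

text \<open>
  Rotations and reflections are distinct elements, and \<open>\<rho>\<^sup>l\<close> determines \<open>cis (2 \<pi> l / n)\<close>; hence the class
  function is well defined as soon as its values depend on this root of unity only.
\<close>

lemma dihedral_fun_eq:
  assumes "\<And>l l'::nat. cis (2 * pi * l / n) = cis (2 * pi * l' / n) \<Longrightarrow> u l = u l' \<and> w l = w l'"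
  shows "dihedral_fun n u w (rot (2 * pi * l / n)) = u l"
    and "dihedral_fun n u w (rot (2 * pi * l / n) ** phi) = w l"
proof -
  have "rot s ** phi = rot t ** phi \<longleftrightarrow> rot s = rot t" for s t
    by (metis matrix_mul_assoc phi_phi matrix_mul_rid)
  then have eq: "rot s ** phi = rot t ** phi \<longleftrightarrow> cis s = cis t" for s t by (simp add: rot_eq_iff)
  show "dihedral_fun n u w (rot (2 * pi * l / n)) = u l"
  proof -
    have "(THE z. \<exists>l'. cis (2 * pi * l / n) = cis (2 * pi * real l' / n) \<and> z = u l') = u l"
      by (rule the_equality) (use assms in metis)+
    then show ?thesis
      by (simp only: dihedral_fun_def rho_pow GL2_simps rot_neq_rot_phi rot_eq_iff simp_thms)
  qed
  show "dihedral_fun n u w (rot (2 * pi * l / n) ** phi) = w l"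
  proof -
    have "(THE z. \<exists>l'. cis (2 * pi * l / n) = cis (2 * pi * real l' / n) \<and> z = w l') = w l"
      by (rule the_equality) (use assms in metis)+
    then show ?thesis
      by (simp only: dihedral_fun_def rho_pow GL2_simps rot_neq_rot_phi[symmetric] eq simp_thms)
  qed
qed

lemma chi1_values: "chi1 n (rot (2 * pi * real l / n)) = 1" "chi1 n (rot (2 * pi * real l / n) ** phi) = 1"
  unfolding chi1_def by (simp_all add: dihedral_fun_eq)

lemma chi2_values: "chi2 n (rot (2 * pi * real l / n)) = 1" "chi2 n (rot (2 * pi * real l / n) ** phi) = -1"
  unfolding chi2_def by (simp_all add: dihedral_fun_eq)

text \<open>
  For even \<open>n\<close> the values \<open>(-1)\<^sup>l\<close> are powers of the root of unity, and the sum of \<open>\<chi>\<^sub>3\<close> and \<open>\<chi>\<^sub>4\<close> fits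
  the pattern of the two-dimensional characters with \<open>h = n / 2\<close>.
\<close>

lemma chi34_values:
  assumes "even n" "n > 0"
  shows "chi3 n (rot (2 * pi * real l / n)) + chi4 n (rot (2 * pi * real l / n)) = 2 * of_real (cos (2 * pi * real l * real (n div 2) / n))" 
    "chi3 n (rot (2 * pi * real l / n) ** phi) + chi4 n (rot (2 * pi * real l / n) ** phi) = 0"
proof -
  have pow: "(- 1) ^ l = (cis (2 * pi * real l / n)) ^ (n div 2)" for l
  proof -
    have "(cis (2 * pi * real l / n)) ^ (n div 2) = cis (pi * l)"
      using assms by (simp add: Complex.DeMoivre real_of_nat_div field_simps)
    also have "\<dots> = cis pi ^ l" by (simp only: Complex.DeMoivre mult.commute)
    finally show ?thesis by (simp add: cis_pi)
  qed
  have cong: "(- 1 :: complex) ^ l = (- 1) ^ l'"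
    if "cis (2 * pi * real l / n) = cis (2 * pi * real l' / n)" for l l'
    unfolding pow that ..
  have 3: "dihedral_fun n (\<lambda>l. (-1)^l) (\<lambda>l. (-1)^l) (rot (2 * pi * real l / n)) = (-1)^l"
    "dihedral_fun n (\<lambda>l. (-1)^l) (\<lambda>l. (-1)^l) (rot (2 * pi * real l / n) ** phi) = (-1)^l" 
    using dihedral_fun_eq[of n "\<lambda>l. (-1)^l :: complex" "\<lambda>l. (-1)^l", OF conjI[OF cong cong]] by blast+
  have 4: "dihedral_fun n (\<lambda>l. (-1)^l) (\<lambda>l. - ((-1)^l)) (rot (2 * pi * real l / n)) = (-1)^l"
    "dihedral_fun n (\<lambda>l. (-1)^l) (\<lambda>l. - ((-1)^l)) (rot (2 * pi * real l / n) ** phi) = - ((-1)^l)" 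
    using dihedral_fun_eq[of n "\<lambda>l. (-1)^l :: complex" "\<lambda>l. - ((-1)^l)", OF conjI[OF cong arg_cong[OF cong, of _ _ uminus]]]
    by blast+
  have "(- 1 :: complex) ^ l = of_real (cos (2 * pi * real l * real (n div 2) / n))"
  proof -
    have "2 * pi * real l * real (n div 2) / n = pi * l"
      using assms by (simp add: real_of_nat_div field_simps)
    then show ?thesis by (simp add: cos_npi2)
  qed
  with 3 4 show "chi3 n (rot (2 * pi * real l / n)) + chi4 n (rot (2 * pi * real l / n)) = 2 * of_real (cos (2 * pi * real l * real (n div 2) / n))" 
    "chi3 n (rot (2 * pi * real l / n) ** phi) + chi4 n (rot (2 * pi * real l / n) ** phi) = 0"
    unfolding chi3_def chi4_def by simp_all
qed

lemma chi_dim2_values: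
  "chi_dim2 n h (rot (2 * pi * real l / n)) = 2 * of_real (cos (2 * pi * real l * real h / n))"
  "chi_dim2 n h (rot (2 * pi * real l / n) ** phi) = 0"
proof -
  have eq: "2 * real h * real l * pi / n = 2 * pi * real l * real h / n" for l
    by (simp add: mult_ac)
  have "cos (2 * real h * real l * pi / n) = Re (cis (2 * pi * real l / n) ^ h)" for l
    by (simp add: Complex.DeMoivre mult_ac)
  then have 1: "complex_of_real (2 * cos (2 * real h * real l * pi / n)) = of_real (2 * cos (2 * real h * real l' * pi / n)) \<and> (0 :: complex) = 0"
    if "cis (2 * pi * real l / n) = cis (2 * pi * real l' / n)" for l l'
    using that by simp
  note * = dihedral_fun_eq[of n "\<lambda>l. of_real (2 * cos (2 * real h * real l * pi / n))" "\<lambda>l. 0", OF 1]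
  show "chi_dim2 n h (rot (2 * pi * real l / n)) = 2 * of_real (cos (2 * pi * real l * real h / n))"
    "chi_dim2 n h (rot (2 * pi * real l / n) ** phi) = 0"
    unfolding chi_dim2_def using * by (simp_all add: eq)
qed

section \<open>The coinvariant ideal in eigen-coordinates\<close>

lemma superpoly_ring_simps [simp]:
  "x \<otimes>\<^bsub>superpoly_ring k j\<^esub> y = x * y" "x \<oplus>\<^bsub>superpoly_ring k j\<^esub> y = x + y"
  "\<zero>\<^bsub>superpoly_ring k j\<^esub> = 0" "\<one>\<^bsub>superpoly_ring k j\<^esub> = 1"
  by (simp_all add: superpoly_ring_def ring_of_type_algebra_def)

abbreviation SP :: "nat \<Rightarrow> nat \<Rightarrow> superpoly set" where
  "SP k j \<equiv> carrier (superpoly_ring k j)"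

lemma SP_closed [intro]:
  "f \<in> SP k j \<Longrightarrow> g \<in> SP k j \<Longrightarrow> f + g \<in> SP k j"
  "f \<in> SP k j \<Longrightarrow> g \<in> SP k j \<Longrightarrow> f - g \<in> SP k j"
  "f \<in> SP k j \<Longrightarrow> g \<in> SP k j \<Longrightarrow> f * g \<in> SP k j"
  "Const c \<in> SP k j" "0 \<in> SP k j"
  "valid k j a \<Longrightarrow> letter a s \<in> SP k j"
  using homog_mult[of "outw k j" 0 f 0 g] homog_letter[of "outw k j" a s]
  by (auto simp: carrier_iff homog_add homog_diff homog_Const outw_def)

lemma SP_sum: "(\<And>x. x \<in> A \<Longrightarrow> f x \<in> SP k j) \<Longrightarrow> sum f A \<in> SP k j"
  by (induction A rule: infinite_finite_induct) auto

lemma smonom_in_SP_iff: "smonom m c \<in> SP k j \<longleftrightarrow> c = 0 \<or> wdeg (outw k j) m = 0"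
  by (auto simp: carrier_iff homog_def monoms_smonom)

lemma monomial_split:
  assumes "cdeg s m > 0"
  obtains a m' e where "compat (var a s) m'" "m = smon_times (var a s) m'" 
    "\<And>c. smonom m c = Const e * (letter a s * smonom m' c)"
proof -
  obtain a t m' where *: "(if t = s then 1 else 0 :: nat) > 0" "compat (var a t) m'" "m = smon_times (var a t) m'"
    using assms unfolding cdeg_def by (rule wdeg_split)
  then have "t = s" by (simp split: if_splits)
  with * smonom_split[OF *(2)] that show ?thesis unfolding letter_def by metis
qed

text \<open>
  The sign in the commutation rule depends on the pairs only and not on the components. This is what makes
  exchanging \<open>z\<close> and \<open>w\<close> compatible with reordering factors.
\<close>

lemma letter_commute: "\<exists>e. \<forall>s t. letter a s * letter b t = Const e * (letter b t * letter a s)"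
proof (cases "\<exists>a' b'. a = Inr a' \<and> b = Inr b'")
  case True
  then obtain a' b' where "a = Inr a'" "b = Inr b'" by blast
  then have "letter a s * letter b t = Const (-1) * (letter b t * letter a s)" for s t
    using Thetavar_anticommute[of "Gen a' s" "Gen b' t"] by (simp add: letter_simps Const_simps(4,5))
  then show ?thesis by blast
next
  case False
  then have "letter a s * letter b t = letter b t * letter a s" for s t
    by (cases a; cases b) (auto simp: letter_simps Xvar_commute Xvar_Thetavar_commute)
  then show ?thesis by (intro exI[of _ 1]) (simp add: Const_simps)
qed

lemma coeff_of_act_dmat:
  "coeff_of (act (dmat t) f) m = coeff_of f m * cis (t * (real (cdeg 2 m) - real (cdeg 1 m)))"
proof -
  have "coeff_of (act (dmat t) f) m = (\<Sum>m'\<in>monoms f. if m' = m then coeff_of f m * cis (t * (real (cdeg 2 m) - real (cdeg 1 m))) else 0)"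
    unfolding act_expand[of _ f] act_dmat_smonom coeff_of_sum coeff_of_smonom
    by (rule sum.cong) auto
  also have "\<dots> = coeff_of f m * cis (t * (real (cdeg 2 m) - real (cdeg 1 m)))"
    by (simp add: in_monoms_iff)
  finally show ?thesis .
qed

lemma dmat_simps: "dmat s ** dmat t = dmat (s + t)" "dmat 0 = mat 1"
  "swapmat ** swapmat = mat 1" "dmat t ** swapmat = swapmat ** dmat (- t)"
  by (simp_all add: mat2_simps dmat_def swapmat_def cis_mult)

lemma Pinv_rot: "Pinv ** rot t = dmat t ** Pinv"
  by (metis rot_Pmat Pmat_Pinv matrix_mul_assoc matrix_mul_lid matrix_mul_rid)

lemma Pinv_phi: "Pinv ** phi = swapmat ** Pinv"
  by (metis phi_Pmat Pmat_Pinv matrix_mul_assoc matrix_mul_lid matrix_mul_rid)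

lemma act_Pmat_Pinv [simp]: "act Pmat (act Pinv f) = f" "act Pinv (act Pmat f) = f"
  by (simp_all add: Pmat_Pinv act_id flip: act_compose)

lemma act_swapmat_swapmat [simp]: "act swapmat (act swapmat f) = f"
  by (simp add: dmat_simps act_id flip: act_compose)

text \<open>
  The monomials that will turn out to lie in the ideal.
\<close>

definition high :: "nat \<Rightarrow> smon \<Rightarrow> bool" where
  "high n m \<longleftrightarrow> cdeg 1 m > 0 \<and> cdeg 2 m > 0 \<and> cdeg 1 m + cdeg 2 m > 2 \<or> cdeg 1 m + cdeg 2 m > n"

text \<open>
  The bidegrees, apart from \<open>(0, 0)\<close> and those of high monomials, that can occur in an invariant.
\<close>

definition balanced :: "nat \<Rightarrow> smon \<Rightarrow> bool" where
  "balanced n m \<longleftrightarrow> (cdeg 1 m, cdeg 2 m) \<in> {(1, 1), (n, 0), (0, n)}"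

definition eigen_invariants :: "nat \<Rightarrow> superpoly set" where
  "eigen_invariants n = {h. act (dmat (2 * pi / n)) h = h \<and> act swapmat h = h \<and> coeff_of h (0, {||}) = 0}"

text \<open>
  The candidate for the coinvariant ideal in the eigen-coordinates: invariants without constant term, up to
  high monomials.
\<close>

definition eigen_ideal :: "nat \<Rightarrow> nat \<Rightarrow> nat \<Rightarrow> superpoly set" where
  "eigen_ideal n k j = {f \<in> SP k j. \<exists>h\<in>eigen_invariants n. h \<in> SP k j \<and> (\<forall>m\<in>monoms (f - h). high n m)}"

lemma high_mult: "high n m \<Longrightarrow> compat m m' \<Longrightarrow> high n (smon_times m m')"
  by (auto simp: high_def cdeg_times)

lemma compat_commute: "compat m m' \<longleftrightarrow> compat m' m"
  by (auto simp: compat_def)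

lemma cdeg_total_0: "cdeg 1 m + cdeg 2 m = 0 \<longleftrightarrow> m = (0, {||})"
proof -
  have "(\<lambda>(b :: nat + nat) (t :: 2). (if t = 1 then 1 else 0) + (if t = 2 then 1 else 0 :: nat)) = (\<lambda>b t. 1)"
  proof (intro ext)
    show "(if t = 1 then 1 else 0) + (if t = 2 then 1 else 0 :: nat) = 1" for t :: 2
      using exhaust_2[of t] by auto
  qed
  then show ?thesis
    using wdeg_total_0_iff[of m] by (simp only: cdeg_def wdeg_add[symmetric])
qed

text \<open>
  From \<open>(1, 1)\<close> any further factor leads to mixed degree at least \<open>3\<close>. From \<open>(n, 0)\<close> a factor \<open>z\<close> leads to
  degree \<open>n + 1\<close>, and a factor \<open>w\<close> to a mixed degree, which is at least \<open>3\<close> because \<open>n \<ge> 2\<close>.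
\<close>

lemma balanced_mult:
  assumes "n \<ge> 2" "balanced n m" "compat m m'" "m' \<noteq> (0, {||})"
  shows "high n (smon_times m m')"
  using assms cdeg_total_0[of m'] by (auto simp: high_def balanced_def cdeg_times)

text \<open>
  Invariance under the rotation forces \<open>n\<close> to divide \<open>p - q\<close>. If the monomial is not high and not of bidegree
  \<open>(1, 1)\<close>, it is pure of degree at most \<open>n\<close>, hence of degree exactly \<open>n\<close>.
\<close>

lemma eigen_invariants_monoms:
  assumes "n \<ge> 2" "h \<in> eigen_invariants n" "m \<in> monoms h"
  shows "high n m \<or> balanced n m"
proof (rule ccontr)
  assume "\<not> ?thesis"
  moreover have "m \<noteq> (0, {||})" using assms by (auto simp: eigen_invariants_def in_monoms_iff)
  ultimately obtain p where p: "0 < p" "p < n" "cdeg 1 m = 0 \<and> cdeg 2 m = p \<or> cdeg 1 m = p \<and> cdeg 2 m = 0"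
    using cdeg_total_0[of m] assms(1)
    by (cases "cdeg 1 m = 0"; cases "cdeg 2 m = 0") (auto simp: high_def balanced_def)
  have "coeff_of h m * cis (2 * pi / n * (real (cdeg 2 m) - real (cdeg 1 m))) = coeff_of h m"
    using assms(2) coeff_of_act_dmat[of "2 * pi / n" h m] by (simp add: eigen_invariants_def)
  then have "cis (2 * pi / n * (real (cdeg 2 m) - real (cdeg 1 m))) = 1"
    using assms(3) by (simp add: in_monoms_iff)
  then have "cos (2 * pi / n * (real (cdeg 2 m) - real (cdeg 1 m))) = 1"
    by (metis cis.sel(1) one_complex.sel(1))
  then have "cos (2 * pi / n * p) = 1" using p(3) by auto
  then obtain x :: int where "2 * pi / n * p = of_int x * 2 * pi" unfolding cos_one_2pi_int by auto
  then have "real p = of_int x * real n" using assms(1) by (simp add: field_simps)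
  then have "int p = x * int n" by (metis of_int_eq_iff of_int_mult of_int_of_nat_eq)
  then show False using p by (metis dvd_triv_right int_dvd_int_iff nat_dvd_not_less)
qed

lemma eigen_invariants_Const_mult: "h \<in> eigen_invariants n \<Longrightarrow> Const c * h \<in> eigen_invariants n"
  by (simp add: eigen_invariants_def act_mult)

lemma eigen_invariants_add: "h \<in> eigen_invariants n \<Longrightarrow> h' \<in> eigen_invariants n \<Longrightarrow> h + h' \<in> eigen_invariants n"
  by (simp add: eigen_invariants_def act_add)

lemma eigen_invariants_0: "0 \<in> eigen_invariants n"
  by (simp add: eigen_invariants_def)

lemma eigen_ideal_add: "f \<in> eigen_ideal n k j \<Longrightarrow> g \<in> eigen_ideal n k j \<Longrightarrow> f + g \<in> eigen_ideal n k j"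
proof -
  assume "f \<in> eigen_ideal n k j" "g \<in> eigen_ideal n k j"
  then obtain h h' where *: "h \<in> eigen_invariants n" "h' \<in> eigen_invariants n" "h \<in> SP k j" "h' \<in> SP k j" "f \<in> SP k j" "g \<in> SP k j"
     "\<forall>m\<in>monoms (f - h). high n m" "\<forall>m\<in>monoms (g - h'). high n m"
    unfolding eigen_ideal_def by blast
  have "monoms (f + g - (h + h')) \<subseteq> monoms (f - h) \<union> monoms (g - h')"
    using monoms_add[of "f - h" "g - h'"] by (simp add: algebra_simps)
  with * show ?thesis unfolding eigen_ideal_def using eigen_invariants_add[OF *(1,2)] by blast
qed

lemma eigen_ideal_0: "0 \<in> eigen_ideal n k j"
  using eigen_invariants_0 by (auto simp: eigen_ideal_def)

lemma eigen_invariants_subset_eigen_ideal: "h \<in> eigen_invariants n \<Longrightarrow> h \<in> SP k j \<Longrightarrow> h \<in> eigen_ideal n k j"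
  by (auto simp: eigen_ideal_def intro!: bexI[of _ h])

text \<open>
  Write the factor as a constant plus terms without constant term. The constant preserves invariants, and the
  rest turns the non-high terms of an invariant into high ones.
\<close>

lemma eigen_ideal_mult:
  assumes n: "n \<ge> 2" and f: "f \<in> eigen_ideal n k j" and x: "x \<in> SP k j"
  shows "x * f \<in> eigen_ideal n k j" "f * x \<in> eigen_ideal n k j"
proof -
  obtain h where h: "h \<in> eigen_invariants n" "h \<in> SP k j" "f \<in> SP k j" "\<forall>m\<in>monoms (f - h). high n m"
    using f unfolding eigen_ideal_def by blast
  define c where "c = coeff_of x (0, {||})"
  have ch: "Const c * h \<in> eigen_invariants n" "Const c * h \<in> SP k j"
    using h eigen_invariants_Const_mult by blast+
  have nz: "m \<noteq> (0, {||})" if "m \<in> monoms (x - Const c)" for m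
    using that by (auto simp: in_monoms_iff c_def Const_def coeff_of_smonom split: if_splits)
  have eq: "x * f - Const c * h = x * (f - h) + (x - Const c) * h" 
    "f * x - Const c * h = (f - h) * x + h * (x - Const c)"
    by (simp_all add: algebra_simps Const_commute)
  have "high n m" if "m \<in> monoms (x * f - Const c * h)" for m
  proof -
    from that monoms_add[of "x * (f - h)" "(x - Const c) * h"]
    consider "m \<in> monoms (x * (f - h))" | "m \<in> monoms ((x - Const c) * h)" unfolding eq(1) by blast
    then show ?thesis
    proof cases
      case 1
      then obtain a b where "b \<in> monoms (f - h)" "compat b a" "m = smon_times b a"
        by (elim monoms_mult) (metis compat_commute smon_times_commute)
      then show ?thesis using h(4) high_mult by blast
    next
      case 2
      then obtain a b where "b \<in> monoms h" "a \<noteq> (0, {||})" "compat b a" "m = smon_times b a"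
        by (elim monoms_mult) (metis compat_commute smon_times_commute nz)
      then show ?thesis using eigen_invariants_monoms[OF n h(1)] balanced_mult[OF n] high_mult by blast
    qed
  qed
  then show "x * f \<in> eigen_ideal n k j"
    using h x ch unfolding eigen_ideal_def by blast
  have "high n m" if "m \<in> monoms (f * x - Const c * h)" for m
  proof -
    from that monoms_add[of "(f - h) * x" "h * (x - Const c)"]
    consider "m \<in> monoms ((f - h) * x)" | "m \<in> monoms (h * (x - Const c))" unfolding eq(2) by blast
    then show ?thesis
    proof cases
      case 1
      then obtain a b where "b \<in> monoms (f - h)" "compat b a" "m = smon_times b a"
        by (elim monoms_mult)
      then show ?thesis using h(4) high_mult by blast
    next
      case 2
      then obtain a b where "b \<in> monoms h" "a \<noteq> (0, {||})" "compat b a" "m = smon_times b a"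
        by (elim monoms_mult) (metis nz)
      then show ?thesis using eigen_invariants_monoms[OF n h(1)] balanced_mult[OF n] high_mult by blast
    qed
  qed
  then show "f * x \<in> eigen_ideal n k j"
    using h x ch unfolding eigen_ideal_def by blast
qed

lemma ideal_coinvariant_ideal: "ideal (coinvariant_ideal n k j) (superpoly_ring k j)"
  unfolding coinvariant_ideal_def by (rule ring.genideal_ideal[OF ring_superpoly_ring]) auto

lemma coinvariant_ideal_closed:
  "f \<in> coinvariant_ideal n k j \<Longrightarrow> f \<in> SP k j"
  "f \<in> coinvariant_ideal n k j \<Longrightarrow> g \<in> coinvariant_ideal n k j \<Longrightarrow> f + g \<in> coinvariant_ideal n k j"
  "f \<in> coinvariant_ideal n k j \<Longrightarrow> x \<in> SP k j \<Longrightarrow> x * f \<in> coinvariant_ideal n k j"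
  "f \<in> coinvariant_ideal n k j \<Longrightarrow> x \<in> SP k j \<Longrightarrow> f * x \<in> coinvariant_ideal n k j"
  "0 \<in> coinvariant_ideal n k j"
  using ideal.Icarr[OF ideal_coinvariant_ideal] ideal.I_l_closed[OF ideal_coinvariant_ideal, of f n k j x]
    ideal.I_r_closed[OF ideal_coinvariant_ideal, of f n k j x]
    additive_subgroup.a_closed[OF ideal.axioms(1)[OF ideal_coinvariant_ideal], of f n k j g]
    additive_subgroup.zero_closed[OF ideal.axioms(1)[OF ideal_coinvariant_ideal[of n k j]]]
  by auto

lemma hat_invariant_in_ideal:
  assumes n: "n \<ge> 2" and h: "h \<in> eigen_invariants n" "h \<in> SP k j"
  shows "act Pmat h \<in> coinvariant_ideal n k j"
proof -
  have d: "act (dmat (2 * pi * real l / n)) h = h" for l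
  proof (induction l)
    case 0
    show ?case by (simp add: dmat_simps act_id)
  next
    case (Suc l)
    have "2 * pi * real (Suc l) / n = 2 * pi / n + 2 * pi * real l / n"
      by (simp add: add_divide_distrib ring_distribs)
    then have "act (dmat (2 * pi * real (Suc l) / n)) h = act (dmat (2 * pi / n)) (act (dmat (2 * pi * real l / n)) h)"
      by (simp add: dmat_simps flip: act_compose)
    then show ?case using Suc h(1) by (simp add: eigen_invariants_def)
  qed
  have "act g (act Pmat h) = act Pmat h" if g: "g \<in> carrier (dihedral n)" for g
  proof -
    have r: "act (rot (2 * pi * real l / n)) (act Pmat h) = act Pmat h" for l
      using d[of l] by (simp add: rot_Pmat act_compose flip: act_compose[of _ Pmat]) 
    have p: "act phi (act Pmat h) = act Pmat h"
      using h(1) by (simp add: phi_Pmat eigen_invariants_def act_compose[of Pmat swapmat] flip: act_compose[of phi Pmat]) 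
    obtain l :: nat where "g = rot (2 * pi * l / n) \<or> g = rot (2 * pi * l / n) ** phi"
      using g n by (elim dihedral_elements[rotated]) auto
    then show ?thesis using r p by (auto simp: act_compose)
  qed
  then show ?thesis
    unfolding coinvariant_ideal_def using h
    by (intro subsetD[OF ring.genideal_self[OF ring_superpoly_ring]])
       (auto simp: act_carrier coeff_of_act_const eigen_invariants_def)
qed

text \<open>
  The coinvariant ideal in the eigen-coordinates.
\<close>

definition pullback_ideal :: "nat \<Rightarrow> nat \<Rightarrow> nat \<Rightarrow> superpoly set" where
  "pullback_ideal n k j = {h \<in> SP k j. act Pmat h \<in> coinvariant_ideal n k j}"

lemma pullback_ideal_closed:
  "f \<in> pullback_ideal n k j \<Longrightarrow> g \<in> pullback_ideal n k j \<Longrightarrow> f + g \<in> pullback_ideal n k j"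
  "f \<in> pullback_ideal n k j \<Longrightarrow> x \<in> SP k j \<Longrightarrow> x * f \<in> pullback_ideal n k j"
  "f \<in> pullback_ideal n k j \<Longrightarrow> x \<in> SP k j \<Longrightarrow> f * x \<in> pullback_ideal n k j"
  "0 \<in> pullback_ideal n k j"
  "f \<in> pullback_ideal n k j \<Longrightarrow> Const c * f \<in> pullback_ideal n k j"
  by (auto simp: pullback_ideal_def act_add act_mult coinvariant_ideal_closed act_carrier)
     (metis SP_closed(4) coinvariant_ideal_closed(3))

lemma pullback_ideal_diff: "f \<in> pullback_ideal n k j \<Longrightarrow> g \<in> pullback_ideal n k j \<Longrightarrow> f - g \<in> pullback_ideal n k j"
  using pullback_ideal_closed(1)[OF _ pullback_ideal_closed(5)[of g n k j "-1"], of f] by (simp add: Const_simps)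

lemma pullback_ideal_add_iff: "f + g \<in> pullback_ideal n k j \<Longrightarrow> f \<in> pullback_ideal n k j \<longleftrightarrow> g \<in> pullback_ideal n k j"
  using pullback_ideal_diff[of "f + g" n k j f] pullback_ideal_diff[of "f + g" n k j g] by auto

lemma eigen_invariants_subset_pullback_ideal: "n \<ge> 2 \<Longrightarrow> h \<in> eigen_invariants n \<Longrightarrow> h \<in> SP k j \<Longrightarrow> h \<in> pullback_ideal n k j"
  by (simp add: pullback_ideal_def hat_invariant_in_ideal)

text \<open>
  The product of a \<open>z\<close> and a \<open>w\<close> is fixed by rotations, and symmetrizing makes it fixed by \<open>\<phi>\<close>.
\<close>

lemma quadratic_in_pullback_ideal:
  assumes n: "n \<ge> 2" and v: "valid k j a" "valid k j b"
  shows "letter a s * letter b (other s) + letter a (other s) * letter b s \<in> pullback_ideal n k j"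
proof (rule eigen_invariants_subset_pullback_ideal[OF n])
  have d: "act (dmat t) (letter a s * letter b (other s)) = letter a s * letter b (other s)" for t s
  proof -
    have "(Const x * f) * (Const y * g) = f * g" if "x * y = 1" for x y f g
      using that Const_mult_cancel by (simp add: mult.assoc Const_left_commute[of f])
    then show ?thesis
      using exhaust_2[of s] by (auto simp: act_mult act_dmat_letter other_def cis_mult)
  qed
  from d[of _ s] d[of _ "other s"] 
  have "act (dmat t) (letter a s * letter b (other s) + letter a (other s) * letter b s) = letter a s * letter b (other s) + letter a (other s) * letter b s" for t
    by (simp add: act_add)
  moreover have "homog (\<lambda>_ _. 1) (1 + 1) (letter a s * letter b (other s) + letter a (other s) * letter b s)"
    by (intro homog_add homog_mult) (use homog_letter[of "\<lambda>_ _. 1"] in auto)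
  then have "coeff_of (letter a s * letter b (other s) + letter a (other s) * letter b s) (0, {||}) = 0"
    using homog_unique by fastforce
  ultimately show "letter a s * letter b (other s) + letter a (other s) * letter b s \<in> eigen_invariants n"
    by (simp add: eigen_invariants_def act_add act_mult act_swapmat_letter add.commute)
  show "letter a s * letter b (other s) + letter a (other s) * letter b s \<in> SP k j"
    using v by blast
qed

text \<open>
  With \<open>A\<close>, \<open>B\<close>, \<open>C\<close> the products where the odd component is in the last, middle and first position,
  \<open>A + B\<close> and \<open>B + C\<close> are multiples of quadratic invariants. So is \<open>A + C\<close>, after moving the middle factor
  to the front at the cost of the same scalar in both terms. Therefore \<open>2 A\<close> lies in the ideal.
\<close>

lemma cubic_in_pullback_ideal:
  assumes n: "n \<ge> 2" and v: "valid k j a" "valid k j b" "valid k j c"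
  shows "letter a s * letter b s * letter c (other s) \<in> pullback_ideal n k j" "letter a (other s) * letter b s * letter c s \<in> pullback_ideal n k j"
proof -
  let ?A = "letter a s * letter b s * letter c (other s)"
  let ?B = "letter a s * letter b (other s) * letter c s"
  let ?C = "letter a (other s) * letter b s * letter c s"
  have AB: "?A + ?B \<in> pullback_ideal n k j"
    using pullback_ideal_closed(2)[OF quadratic_in_pullback_ideal[OF n v(2,3)] SP_closed(6)[OF v(1)], of s s]
    by (simp add: distrib_left mult.assoc)
  have BC: "?B + ?C \<in> pullback_ideal n k j"
    using pullback_ideal_closed(3)[OF quadratic_in_pullback_ideal[OF n v(1,2)] SP_closed(6)[OF v(3)], of s s]
    by (simp add: distrib_right mult.assoc)
  obtain e where e: "\<And>s t. letter a s * letter b t = Const e * (letter b t * letter a s)" using letter_commute[of a b] by blast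
  have "?A + ?C = Const e * (letter b s * (letter a s * letter c (other s) + letter a (other s) * letter c s))"
    by (simp add: e distrib_left mult.assoc)
  then have AC: "?A + ?C \<in> pullback_ideal n k j"
    using pullback_ideal_closed(2,5) quadratic_in_pullback_ideal[OF n v(1,3)] SP_closed(6)[OF v(2)] by metis
  \<comment> \<open>this combination equals \<open>2 A\<close>\<close>
  have "(?A + ?B) - (?B + ?C) + (?A + ?C) \<in> pullback_ideal n k j"
    using pullback_ideal_closed(1) pullback_ideal_diff AB BC AC by blast
  then have "Const (1/2) * (?A + ?A) \<in> pullback_ideal n k j"
    by (intro pullback_ideal_closed(5)) (simp add: algebra_simps)
  also have "Const (1/2) * (?A + ?A) = Const (1/2 + 1/2) * ?A"
    by (simp only: Const_simps(1) distrib_left distrib_right)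
  finally show "?A \<in> pullback_ideal n k j" by (simp add: Const_simps)
  then show "?C \<in> pullback_ideal n k j" using pullback_ideal_add_iff[OF AC] by simp
qed

lemma mixed_in_pullback_ideal:
  assumes n: "n \<ge> 2" and m: "cdeg s m \<ge> 2" "cdeg (other s) m \<ge> 1" and v: "wdeg (outw k j) m = 0"
  shows "smonom m x \<in> pullback_ideal n k j"
proof -
  have os: "other s \<noteq> s" using exhaust_2[of s] by (auto simp: other_def)
  obtain a m1 e1 where 1: "compat (var a s) m1" "m = smon_times (var a s) m1" "\<And>c. smonom m c = Const e1 * (letter a s * smonom m1 c)"
  proof -
    have "cdeg s m > 0" using m by simp
    from monomial_split[OF this] that show thesis by blast
  qed
  from m 1 os have "cdeg s m1 \<ge> 1" "cdeg (other s) m1 \<ge> 1" by (auto simp: cdeg_times)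
  then obtain b m2 e2 where 2: "compat (var b s) m2" "m1 = smon_times (var b s) m2" "\<And>c. smonom m1 c = Const e2 * (letter b s * smonom m2 c)"
  proof -
    have "cdeg s m1 > 0" using \<open>cdeg s m1 \<ge> 1\<close> by simp
    from monomial_split[OF this] that show thesis by blast
  qed
  with \<open>cdeg (other s) m1 \<ge> 1\<close> os have "cdeg (other s) m2 \<ge> 1" by (auto simp: cdeg_times)
  then obtain c m3 e3 where 3: "compat (var c (other s)) m3" "m2 = smon_times (var c (other s)) m3" 
      "\<And>x. smonom m2 x = Const e3 * (letter c (other s) * smonom m3 x)"
  proof -
    have "cdeg (other s) m2 > 0" using \<open>cdeg (other s) m2 \<ge> 1\<close> by simp
    from monomial_split[OF this] that show thesis by blast
  qed
  have "outw k j a s + (outw k j b s + (outw k j c (other s) + wdeg (outw k j) m3)) = 0"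
    using v 1(1,2) 2(1,2) 3(1,2) by (simp add: wdeg_times)
  then have val: "valid k j a" "valid k j b" "valid k j c" "smonom m3 x \<in> SP k j"
    by (auto simp: outw_def smonom_in_SP_iff split: if_splits)
  have "smonom m x = Const e1 * (Const e2 * (Const e3 * (letter a s * letter b s * letter c (other s) * smonom m3 x)))"
    by (simp only: 1(3) 2(3) 3(3) Const_left_commute[of "letter _ _"] mult.assoc)
  also have "\<dots> \<in> pullback_ideal n k j"
    by (intro pullback_ideal_closed(5) pullback_ideal_closed(3) cubic_in_pullback_ideal n val)
  finally show ?thesis .
qed

text \<open>
  For degree \<open>n + 1\<close>, write the monomial as \<open>z m\<close>. Then \<open>m + \<phi> m\<close> is invariant and \<open>z \<sqdot> \<phi> m\<close> contains \<open>z w w\<close>, as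
  \<open>n \<ge> 2\<close>. Larger degrees follow by splitting off one variable at a time, and if the other component occurs as well,
  the monomial is mixed.
\<close>

lemma pure_in_pullback_ideal:
  assumes n: "n \<ge> 2" and m: "cdeg s m > n" and v: "wdeg (outw k j) m = 0"
  shows "smonom m x \<in> pullback_ideal n k j"
  using m v
proof (induction "cdeg s m" arbitrary: m rule: less_induct)
  case less
  have os: "other s \<noteq> s" using exhaust_2[of s] by (auto simp: other_def)
  show ?case
  proof (cases "cdeg (other s) m = 0")
    case False
    then show ?thesis using less n by (intro mixed_in_pullback_ideal[OF n, of s]) simp_all
  next
    case pure: True
    obtain a m1 e1 where 1: "compat (var a s) m1" "m = smon_times (var a s) m1" "\<And>c. smonom m c = Const e1 * (letter a s * smonom m1 c)"
    proof -
      have "cdeg s m > 0" using less by simp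
      from monomial_split[OF this] that show thesis by blast
    qed
    have cd: "cdeg s m = Suc (cdeg s m1)" "cdeg (other s) m1 = 0"
      using pure 1(1,2) by (auto simp: cdeg_times)
    have "outw k j a s + wdeg (outw k j) m1 = 0" using less(3) 1(1,2) by (simp add: wdeg_times)
    then have va: "valid k j a" and v1: "wdeg (outw k j) m1 = 0" 
      by (auto simp: outw_def split: if_splits)
    show ?thesis
    proof (cases "cdeg s m1 > n")
      case True
      then have "smonom m1 x \<in> pullback_ideal n k j" using less(1) v1 cd by simp
      then show ?thesis unfolding 1(3) using va by (intro pullback_ideal_closed(5) pullback_ideal_closed(2)) auto
    next
      case False
      then have n1: "cdeg s m1 = n" using less(2) cd by simp
      \<comment> \<open>\<open>\<rho>\<close> multiplies a pure monomial of degree \<open>n\<close> by the \<open>n\<close>-th power of an \<open>n\<close>-th root of unity\<close>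
      let ?h = "smonom m1 1 + act swapmat (smonom m1 1)"
      have d: "act (dmat (2 * pi / n)) (smonom m1 1) = smonom m1 1" 
         "act (dmat (- (2 * pi / n))) (smonom m1 1) = smonom m1 1"
        unfolding act_dmat_smonom
        using n1 cd(2) exhaust_2[of s] n by (auto simp: other_def simp flip: cis_cnj)
      have swap_mon: "act (dmat (2 * pi / n)) (act swapmat (smonom m1 1)) = act swapmat (act (dmat (- (2 * pi / n))) (smonom m1 1))"
        by (simp add: dmat_simps flip: act_compose)
      have "m1 \<noteq> (0, {||})" using n1 n by auto
      then have inv: "?h \<in> eigen_invariants n"
        by (simp add: eigen_invariants_def act_add d swap_mon coeff_of_act_const coeff_of_smonom add.commute)
      have S1: "smonom m1 1 \<in> SP k j" using v1 by (simp add: smonom_in_SP_iff)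
      then have "?h \<in> pullback_ideal n k j" using act_carrier by (intro eigen_invariants_subset_pullback_ideal[OF n inv]) blast
      then have "letter a s * ?h \<in> pullback_ideal n k j" using va by (intro pullback_ideal_closed(2)) auto
      then have sum: "letter a s * smonom m1 1 + letter a s * act swapmat (smonom m1 1) \<in> pullback_ideal n k j" 
        by (simp add: distrib_left)
      obtain b m2 e2 where 2: "compat (var b s) m2" "m1 = smon_times (var b s) m2" "\<And>c. smonom m1 c = Const e2 * (letter b s * smonom m2 c)"
      proof -
        have "cdeg s m1 > 0" using n1 n by simp
        from monomial_split[OF this] that show thesis by blast
      qed
      with n1 n have "cdeg s m2 > 0" by (auto simp: cdeg_times)
      then obtain c m3 e3 where 3: "compat (var c s) m3" "m2 = smon_times (var c s) m3" 
          "\<And>x. smonom m2 x = Const e3 * (letter c s * smonom m3 x)"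
      proof -
        from monomial_split[OF \<open>cdeg s m2 > 0\<close>] that show thesis by blast
      qed
      have "outw k j b s + (outw k j c s + wdeg (outw k j) m3) = 0"
        using v1 2(1,2) 3(1,2) by (simp add: wdeg_times)
      then have val: "valid k j b" "valid k j c" "act swapmat (smonom m3 1) \<in> SP k j"
        by (auto simp: outw_def smonom_in_SP_iff act_carrier split: if_splits)
      have "letter a s * act swapmat (smonom m1 1) = Const e2 * (Const e3 * (letter a s * letter b (other s) * letter c (other s) * act swapmat (smonom m3 1)))"
        by (simp only: 2(3) 3(3) Const_left_commute[of "letter _ _"] mult.assoc act_mult act_Const act_swapmat_letter)
      also have "\<dots> \<in> pullback_ideal n k j"
        using cubic_in_pullback_ideal(2)[OF n va val(1,2), of "other s"]
        by (intro pullback_ideal_closed(5) pullback_ideal_closed(3)[OF _ val(3)]) simp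
      finally have "letter a s * smonom m1 1 \<in> pullback_ideal n k j" using pullback_ideal_add_iff[OF sum] by simp
      then have "Const (x * e1) * (letter a s * smonom m1 1) \<in> pullback_ideal n k j" by (rule pullback_ideal_closed(5))
      also have "Const (x * e1) * (letter a s * smonom m1 1) = smonom m x"
        by (simp add: 1(3)[symmetric] Const_Const[symmetric] Const_mult_smonom)
      finally show ?thesis .
    qed
  qed
qed

lemma high_in_pullback_ideal:
  assumes n: "n \<ge> 2" and m: "high n m" and v: "wdeg (outw k j) m = 0"
  shows "smonom m x \<in> pullback_ideal n k j"
proof -
  consider "cdeg 1 m \<ge> 2" "cdeg (other 1) m \<ge> 1" | "cdeg 2 m \<ge> 2" "cdeg (other 2) m \<ge> 1"
    | "cdeg 1 m > n" | "cdeg 2 m > n"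
    using m n by (fastforce simp: high_def other_def)
  then show ?thesis using mixed_in_pullback_ideal[OF n _ _ v] pure_in_pullback_ideal[OF n _ v] by cases blast+
qed

lemma eigen_ideal_subset_pullback_ideal: "n \<ge> 2 \<Longrightarrow> eigen_ideal n k j \<subseteq> pullback_ideal n k j"
proof
  fix f assume n: "n \<ge> 2" and "f \<in> eigen_ideal n k j"
  then obtain h where h: "h \<in> eigen_invariants n" "h \<in> SP k j" "f \<in> SP k j" "\<forall>m\<in>monoms (f - h). high n m"
    unfolding eigen_ideal_def by blast
  have "f - h \<in> SP k j" using h by blast
  then have *: "smonom m (coeff_of (f - h) m) \<in> pullback_ideal n k j" if "m \<in> monoms (f - h)" for m
    using high_in_pullback_ideal[OF n] h(4) that by (simp add: carrier_iff homog_def)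
  have sum: "sum g A \<in> pullback_ideal n k j" if "\<And>x. x \<in> A \<Longrightarrow> g x \<in> pullback_ideal n k j" for g and A :: "smon set"
    using that by (induction A rule: infinite_finite_induct) (auto simp: pullback_ideal_closed)
  have "(\<Sum>m\<in>monoms (f - h). smonom m (coeff_of (f - h) m)) \<in> pullback_ideal n k j"
    by (rule sum) (rule *)
  then have "f - h \<in> pullback_ideal n k j" by (simp only: superpoly_expand[symmetric])
  with eigen_invariants_subset_pullback_ideal[OF n h(1,2)] have "h + (f - h) \<in> pullback_ideal n k j" by (rule pullback_ideal_closed)
  then show "f \<in> pullback_ideal n k j" by simp
qed

text \<open>
  One inclusion expresses the candidate by elements of the ideal; the other holds because the candidate is an
  ideal containing all the generators.
\<close>

theorem coinvariant_ideal_iff: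
  assumes n: "n \<ge> 2"
  shows "f \<in> coinvariant_ideal n k j \<longleftrightarrow> act Pinv f \<in> eigen_ideal n k j"
proof
  assume "act Pinv f \<in> eigen_ideal n k j"
  then have "act Pinv f \<in> pullback_ideal n k j" using eigen_ideal_subset_pullback_ideal[OF n] by blast
  then show "f \<in> coinvariant_ideal n k j" by (simp add: pullback_ideal_def)
next
  let ?J = "{f. act Pinv f \<in> eigen_ideal n k j}"
  interpret R: ring "superpoly_ring k j" by (rule ring_superpoly_ring)
  have SPJ: "f \<in> SP k j" if "f \<in> ?J" for f
    using that act_carrier[of "act Pinv f" k j Pmat] by (auto simp: eigen_ideal_def)
  have "ideal ?J (superpoly_ring k j)"
  proof (rule idealI)
    show "subgroup ?J (add_monoid (superpoly_ring k j))"
    proof (rule R.add.subgroupI)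
      fix a assume a: "a \<in> ?J"
      then have "\<ominus>\<^bsub>superpoly_ring k j\<^esub> a = Const (-1) * a"
        using SPJ SP_closed(3)[OF SP_closed(4)[of "-1"] SPJ[OF a]]
        by (intro R.minus_equality) (simp_all add: Const_simps(4,5))
      then have "act Pinv (\<ominus>\<^bsub>superpoly_ring k j\<^esub> a) = Const (-1) * act Pinv a" by (simp add: act_mult)
      then show "\<ominus>\<^bsub>superpoly_ring k j\<^esub> a \<in> ?J" using a eigen_ideal_mult(1)[OF n] SP_closed(4) by simp
    next
      show "?J \<noteq> {}" using eigen_ideal_0[of n k j] by (auto intro!: exI[of _ 0])
    qed (auto simp: act_add eigen_ideal_add SPJ)
  qed (use eigen_ideal_mult[OF n] in \<open>auto simp: act_mult act_carrier ring_superpoly_ring\<close>)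
  moreover have "{f \<in> SP k j. (\<forall>g\<in>carrier (dihedral n). act g f = f) \<and> coeff_of f (0, {||}) = 0} \<subseteq> ?J"
  proof clarify
    fix f assume f: "f \<in> SP k j" "\<forall>g\<in>carrier (dihedral n). act g f = f" "coeff_of f (0, {||}) = 0"
    have "act (dmat (2 * pi / n)) (act Pinv f) = act Pinv f"
      using f(2) rho_phi_in_dihedral(1)[of n] by (simp add: rho_eq_rot Pinv_rot[symmetric] act_compose flip: act_compose[of "dmat _"])
    moreover have "act swapmat (act Pinv f) = act Pinv f"
      using f(2) rho_phi_in_dihedral(2)[of n] by (simp add: Pinv_phi[symmetric] act_compose flip: act_compose[of "swapmat"])
    ultimately have "act Pinv f \<in> eigen_invariants n" using f(3) by (simp add: eigen_invariants_def coeff_of_act_const)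
    then show "act Pinv f \<in> eigen_ideal n k j" using f(1) act_carrier by (simp add: eigen_invariants_subset_eigen_ideal)
  qed
  ultimately have "coinvariant_ideal n k j \<subseteq> ?J"
    unfolding coinvariant_ideal_def by (rule R.genideal_minimal)
  then show "f \<in> coinvariant_ideal n k j \<Longrightarrow> act Pinv f \<in> eigen_ideal n k j" by blast
qed

section \<open>Traces from a dual basis\<close>

lemma complex_field_simps [simp]:
  "carrier complex_field = UNIV" "x \<oplus>\<^bsub>complex_field\<^esub> y = x + y" "x \<otimes>\<^bsub>complex_field\<^esub> y = x * y"
  "\<zero>\<^bsub>complex_field\<^esub> = 0" "\<one>\<^bsub>complex_field\<^esub> = 1"
  by (simp_all add: ring_of_type_algebra_def)

text \<open>
  A finite set of vectors with dual functionals that separate points. It is a basis, and the functionals are its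
  coordinates; but separation is easier to verify than spanning, since a class in a quotient vanishes once its
  representative lies in the ideal.
\<close>

locale dual_basis = vectorspace complex_field V for V :: "(complex, 'v, 'm) module_scheme" (structure) +
  fixes B0 :: "'v set" and L :: "'v \<Rightarrow> 'v \<Rightarrow> complex"
  assumes finite_B0: "finite B0" and B0_carrier: "B0 \<subseteq> carrier V"
    and L_add: "\<And>b v w. b \<in> B0 \<Longrightarrow> v \<in> carrier V \<Longrightarrow> w \<in> carrier V \<Longrightarrow> L b (v \<oplus>\<^bsub>V\<^esub> w) = L b v + L b w"
    and L_smult: "\<And>b c v. b \<in> B0 \<Longrightarrow> v \<in> carrier V \<Longrightarrow> L b (c \<odot>\<^bsub>V\<^esub> v) = c * L b v"
    and L_dual: "\<And>b b'. b \<in> B0 \<Longrightarrow> b' \<in> B0 \<Longrightarrow> L b b' = (if b = b' then 1 else 0)"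
    and L_separating: "\<And>v. v \<in> carrier V \<Longrightarrow> (\<And>b. b \<in> B0 \<Longrightarrow> L b v = 0) \<Longrightarrow> v = \<zero>\<^bsub>V\<^esub>"
begin

text \<open>
  Stated for an arbitrary linear form, since it is applied both to the dual functionals and to coordinates with
  respect to another basis.
\<close>

lemma linear_lincomb:
  fixes F :: "'v \<Rightarrow> complex"
  assumes add: "\<And>v w. v \<in> carrier V \<Longrightarrow> w \<in> carrier V \<Longrightarrow> F (v \<oplus>\<^bsub>V\<^esub> w) = F v + F w"
    and smult: "\<And>c v. v \<in> carrier V \<Longrightarrow> F (c \<odot>\<^bsub>V\<^esub> v) = c * F v"
    and A: "finite A" "A \<subseteq> carrier V"
  shows "F (lincomb a A) = (\<Sum>b\<in>A. a b * F b)"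
  unfolding lincomb_def using A
proof (induction A)
  case empty
  have "F \<zero>\<^bsub>V\<^esub> = F \<zero>\<^bsub>V\<^esub> + F \<zero>\<^bsub>V\<^esub>" using add[of "\<zero>\<^bsub>V\<^esub>" "\<zero>\<^bsub>V\<^esub>"] by simp
  then show ?case by simp
next
  case (insert x A)
  then have "(\<lambda>v. a v \<odot>\<^bsub>V\<^esub> v) \<in> A \<rightarrow> carrier V" "a x \<odot>\<^bsub>V\<^esub> x \<in> carrier V" by auto
  then show ?case using insert by (simp add: M.finsum_insert add smult)
qed

lemma lincomb_closed_B0: "lincomb a B0 \<in> carrier V"
  using B0_carrier finite_B0 by (intro lincomb_closed) auto

lemma expansion:
  assumes "v \<in> carrier V" shows "lincomb (\<lambda>b. L b v) B0 = v"
proof -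
  let ?w = "lincomb (\<lambda>b. L b v) B0"
  have w: "?w \<in> carrier V" by (rule lincomb_closed_B0)
  have "L b (v \<ominus>\<^bsub>V\<^esub> ?w) = 0" if b: "b \<in> B0" for b
  proof -
    have "L b ?w = (\<Sum>b'\<in>B0. L b' v * L b b')"
      by (rule linear_lincomb) (use L_add L_smult b finite_B0 B0_carrier in auto)
    also have "\<dots> = (\<Sum>b'\<in>B0. if b = b' then L b v else 0)"
      by (rule sum.cong) (use L_dual b in auto)
    finally have "L b ?w = L b v" using b finite_B0 by simp
    moreover have "L b (v \<ominus>\<^bsub>V\<^esub> ?w \<oplus>\<^bsub>V\<^esub> ?w) = L b (v \<ominus>\<^bsub>V\<^esub> ?w) + L b ?w"
      using b w assms by (intro L_add) auto
    moreover have "v \<ominus>\<^bsub>V\<^esub> ?w \<oplus>\<^bsub>V\<^esub> ?w = v"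
      using w assms by (simp add: M.minus_eq M.a_assoc M.l_neg)
    ultimately show ?thesis by simp
  qed
  then have "v \<ominus>\<^bsub>V\<^esub> ?w = \<zero>\<^bsub>V\<^esub>" using w assms by (intro L_separating) auto
  moreover have "v = v \<ominus>\<^bsub>V\<^esub> ?w \<oplus>\<^bsub>V\<^esub> ?w"
    using w assms by (simp add: M.minus_eq M.a_assoc M.l_neg)
  ultimately show ?thesis using w by simp
qed

lemma basis_B0: "basis B0"
  unfolding basis_criterion[OF finite_B0 B0_carrier]
proof (intro allI impI ex1I conjI)
  fix v assume v: "v \<in> carrier V"
  show "restrict (\<lambda>b. L b v) B0 \<in> B0 \<rightarrow>\<^sub>E carrier complex_field" by auto
  have "lincomb (restrict (\<lambda>b. L b v) B0) B0 = lincomb (\<lambda>b. L b v) B0"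
    unfolding lincomb_def using B0_carrier by (intro M.finsum_cong') auto
  then show "lincomb (restrict (\<lambda>b. L b v) B0) B0 = v" using expansion[OF v] by simp
next
  fix v a assume v: "v \<in> carrier V" and a: "a \<in> B0 \<rightarrow>\<^sub>E carrier complex_field \<and> lincomb a B0 = v"
  show "a = restrict (\<lambda>b. L b v) B0"
  proof
    fix b show "a b = restrict (\<lambda>b. L b v) B0 b"
    proof (cases "b \<in> B0")
      case True
      have "L b v = (\<Sum>b'\<in>B0. a b' * L b b')"
        using a linear_lincomb[of "L b" B0 a, OF L_add[OF True] L_smult[OF True] finite_B0 B0_carrier] by auto
      also have "\<dots> = (\<Sum>b'\<in>B0. if b = b' then a b else 0)"
        by (rule sum.cong) (use L_dual True in auto)
      finally show ?thesis using True finite_B0 by simp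
    next
      case False
      then show ?thesis using a by (auto simp: PiE_def extensional_def)
    qed
  qed
qed

text \<open>
  The trace refers to an arbitrarily chosen finite basis. Expanding its vectors in the given one and exchanging
  the two sums is the usual proof that the trace does not depend on the basis.
\<close>

theorem endo_trace_eq:
  assumes T: "\<And>v. v \<in> carrier V \<Longrightarrow> T v \<in> carrier V"
    and T_add: "\<And>v w. v \<in> carrier V \<Longrightarrow> w \<in> carrier V \<Longrightarrow> T (v \<oplus>\<^bsub>V\<^esub> w) = T v \<oplus>\<^bsub>V\<^esub> T w"
    and T_smult: "\<And>c v. v \<in> carrier V \<Longrightarrow> T (c \<odot>\<^bsub>V\<^esub> v) = c \<odot>\<^bsub>V\<^esub> T v"
  shows "endo_trace complex_field V T = (\<Sum>b\<in>B0. L b (T b))"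
proof -
  define B where "B = (SOME B. finite B \<and> basis B)"
  have "finite B \<and> basis B" unfolding B_def by (rule someI) (use finite_B0 basis_B0 in blast)
  then have B: "finite B" "basis B" "B \<subseteq> carrier V" by (auto simp: basis_def)
  define c where "c = coord complex_field V B"
  have ex1: "\<exists>!a. a \<in> B \<rightarrow>\<^sub>E carrier complex_field \<and> lincomb a B = v" if "v \<in> carrier V" for v
    using B(2)[unfolded basis_criterion[OF B(1,3)], THEN spec, THEN mp, OF that] .
  have c: "lincomb (c v) B = v" if "v \<in> carrier V" for v
    using theI'[OF ex1[OF that]] unfolding c_def coord_def by blast
  have c_eq: "c v b = a b" if "v \<in> carrier V" "lincomb a B = v" "b \<in> B" for v a b
  proof -
    have "lincomb (restrict a B) B = lincomb a B"
      unfolding lincomb_def using B by (intro M.finsum_cong') auto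
    then have "c v = restrict a B"
      unfolding c_def coord_def using that by (intro the1_equality[OF ex1]) auto
    then show ?thesis using that by simp
  qed
  have c_add: "c (v \<oplus>\<^bsub>V\<^esub> w) b = c v b + c w b" if "v \<in> carrier V" "w \<in> carrier V" "b \<in> B" for v w b
  proof (rule c_eq)
    have "lincomb (\<lambda>b. c v b + c w b) B = (\<Oplus>\<^bsub>V\<^esub>b\<in>B. c v b \<odot>\<^bsub>V\<^esub> b \<oplus>\<^bsub>V\<^esub> c w b \<odot>\<^bsub>V\<^esub> b)"
      unfolding lincomb_def
    proof (rule M.finsum_cong')
      fix b assume "b \<in> B"
      then have "b \<in> carrier V" using B by blast
      then show "(c v b + c w b) \<odot>\<^bsub>V\<^esub> b = c v b \<odot>\<^bsub>V\<^esub> b \<oplus>\<^bsub>V\<^esub> c w b \<odot>\<^bsub>V\<^esub> b"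
        using smult_l_distr[of "c v b" "c w b" b] by simp
    qed (use B in auto)
    also have "\<dots> = lincomb (c v) B \<oplus>\<^bsub>V\<^esub> lincomb (c w) B"
      unfolding lincomb_def by (rule M.finsum_addf) (use B in auto)
    finally show "lincomb (\<lambda>b. c v b + c w b) B = v \<oplus>\<^bsub>V\<^esub> w" using c that by simp
  qed (use that in auto)
  have c_smult: "c (x \<odot>\<^bsub>V\<^esub> v) b = x * c v b" if "v \<in> carrier V" "b \<in> B" for x v b
  proof (rule c_eq)
    have "lincomb (\<lambda>b. x * c v b) B = (\<Oplus>\<^bsub>V\<^esub>b\<in>B. x \<odot>\<^bsub>V\<^esub> (c v b \<odot>\<^bsub>V\<^esub> b))"
      unfolding lincomb_def
    proof (rule M.finsum_cong')
      fix b assume "b \<in> B"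
      then have "b \<in> carrier V" using B by blast
      then show "(x * c v b) \<odot>\<^bsub>V\<^esub> b = x \<odot>\<^bsub>V\<^esub> (c v b \<odot>\<^bsub>V\<^esub> b)"
        using smult_assoc1[of x "c v b" b] by simp
    qed (use B in auto)
    also have "\<dots> = x \<odot>\<^bsub>V\<^esub> lincomb (c v) B"
      unfolding lincomb_def by (rule finsum_smult[symmetric]) (use B in auto)
    finally show "lincomb (\<lambda>b. x * c v b) B = x \<odot>\<^bsub>V\<^esub> v" using c that by simp
  qed (use that in auto)
  have fs: "(\<Oplus>\<^bsub>complex_field\<^esub>b\<in>A. f b) = (\<Sum>b\<in>A. f b)" if "finite A" for A and f :: "'v \<Rightarrow> complex"
    using that by (induction A) (simp_all add: R.finsum_insert Pi_def)
  have "endo_trace complex_field V T = (\<Sum>b\<in>B. c (T b) b)"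
    unfolding endo_trace_def Let_def B_def[symmetric] c_def[symmetric] by (rule fs) (rule B)
  also have "\<dots> = (\<Sum>b\<in>B. \<Sum>x\<in>B0. L x b * c (T x) b)"
  proof (rule sum.cong)
    fix b assume b: "b \<in> B"
    then have bV: "b \<in> carrier V" using B by blast
    have "c (T (lincomb (\<lambda>x. L x b) B0)) b = (\<Sum>x\<in>B0. L x b * c (T x) b)"
      by (rule linear_lincomb) (use T T_add T_smult c_add c_smult b finite_B0 B0_carrier in auto)
    then show "c (T b) b = (\<Sum>x\<in>B0. L x b * c (T x) b)" using expansion[OF bV] by simp
  qed simp
  also have "\<dots> = (\<Sum>x\<in>B0. \<Sum>b\<in>B. c (T x) b * L x b)"
    by (subst sum.swap) (simp add: mult.commute)
  also have "\<dots> = (\<Sum>x\<in>B0. L x (T x))"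
  proof (rule sum.cong)
    fix x assume x: "x \<in> B0"
    then have Tx: "T x \<in> carrier V" using T B0_carrier by blast
    have "L x (lincomb (c (T x)) B) = (\<Sum>b\<in>B. c (T x) b * L x b)"
      by (rule linear_lincomb) (use L_add L_smult x B in auto)
    then show "(\<Sum>b\<in>B. c (T x) b * L x b) = L x (T x)" using c[OF Tx] by simp
  qed simp
  finally show ?thesis .
qed

end

section \<open>Coefficients of super Schur functions\<close>

text \<open>
  Fillings of a strip of cells \<open>p a, \<dots>, p (b - 1)\<close> by letters below \<open>m\<close> in which any earlier letter is related to any
  later one by \<open>R\<close>. Rows (with \<open>\<le>\<close>) and columns (with \<open><\<close>) are both of this form.
\<close>

definition tableaux :: "(nat \<Rightarrow> nat \<Rightarrow> bool) \<Rightarrow> (nat \<Rightarrow> nat \<times> nat) \<Rightarrow> nat \<Rightarrow> nat \<Rightarrow> nat \<Rightarrow> (nat \<times> nat \<Rightarrow> nat) set" where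
  "tableaux R p a b m = {T \<in> p ` {a..<b} \<rightarrow>\<^sub>E {..<m}. \<forall>c\<in>{a..<b}. \<forall>c'\<in>{a..<b}. c < c' \<longrightarrow> R (T (p c)) (T (p c'))}"

lemma ssyt_row: "ssyt ({r} \<times> {a..<b}) m = tableaux (\<le>) (Pair r) a b m"
proof -
  have "Pair r ` {a..<b} = {r} \<times> {a..<b}" by auto
  then show ?thesis unfolding ssyt_def tableaux_def by auto
qed

lemma ssyt_column: "ssyt ({a..<b} \<times> {c}) m = tableaux (<) (\<lambda>r. (r, c)) a b m"
proof -
  have "(\<lambda>r. (r, c)) ` {a..<b} = {a..<b} \<times> {c}" by auto
  then show ?thesis unfolding ssyt_def tableaux_def by auto
qed

text \<open>
  The exponent vector of the monomial of a tableau, where \<open>\<iota>\<close> is \<open>Inl\<close> for \<open>\<^bold>q\<close> and \<open>Inr\<close> for \<open>\<^bold>u\<close>.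
\<close>

definition content :: "(nat \<Rightarrow> nat + nat) \<Rightarrow> (nat \<times> nat) set \<Rightarrow> (nat \<times> nat \<Rightarrow> nat) \<Rightarrow> multidegree" where
  "content \<iota> D T = (\<Sum>x\<in>D. Poly_Mapping.single (\<iota> (T x)) 1)"

lemma schur_eq_sum_content:
  assumes "finite D" "\<And>r. v r = Poly_Mapping.single (Poly_Mapping.single (\<iota> r) 1) 1"
  shows "schur D m v = (\<Sum>T\<in>ssyt D m. Poly_Mapping.single (content \<iota> D T) 1)"
proof -
  have "(\<Prod>x\<in>D. v (T x)) = Poly_Mapping.single (content \<iota> D T) 1" for T
    using assms(1) by (induction D) (simp_all add: content_def assms(2) mult_single)
  then show ?thesis by (simp add: schur_def)
qed

lemma finite_ssyt: "finite D \<Longrightarrow> finite (ssyt D m)"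
  unfolding ssyt_def by (rule finite_subset[OF _ finite_PiE[of D "\<lambda>_. {..<m}"]]) auto

text \<open>
  The letters read along the strip form the sorted list of a multiset, and the content is that multiset.
\<close>

lemma content_determines_tableau:
  assumes p: "inj p" and \<iota>: "inj \<iota>" and T: "T \<in> tableaux (\<le>) p a b m" "T' \<in> tableaux (\<le>) p a b m"
    and eq: "content \<iota> (p ` {a..<b}) T = content \<iota> (p ` {a..<b}) T'"
  shows "T = T'"
proof -
  have word: "map (\<lambda>c. T (p c)) [a..<b] = sorted_list_of_multiset (image_mset (\<lambda>c. T (p c)) (mset_set {a..<b}))"
    if "T \<in> tableaux (\<le>) p a b m" for T
  proof -
    have "sorted (map (\<lambda>c. T (p c)) [a..<b])"
      using that by (auto simp: sorted_iff_nth_mono_less tableaux_def)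
    moreover have "mset (map (\<lambda>c. T (p c)) [a..<b]) = image_mset (\<lambda>c. T (p c)) (mset_set {a..<b})"
      by (simp flip: mset_upt)
    ultimately show ?thesis by (metis sorted_list_of_multiset_mset sorted_sort_id)
  qed
  have cnt: "count (image_mset (\<lambda>c. T (p c)) (mset_set {a..<b})) r = Poly_Mapping.lookup (content \<iota> (p ` {a..<b}) T) (\<iota> r)" for T r
  proof -
    have "Poly_Mapping.lookup (content \<iota> (p ` {a..<b}) T) (\<iota> r) = (\<Sum>c\<in>{a..<b}. if T (p c) = r then 1 else 0)"
      using p \<iota> by (auto simp: content_def lookup_sum lookup_single when_def sum.reindex inj_on_def dest: injD intro!: sum.cong)
    then show ?thesis by (simp add: count_image_mset sum.If_cases Int_def vimage_def conj_commute)
  qed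
  have "image_mset (\<lambda>c. T (p c)) (mset_set {a..<b}) = image_mset (\<lambda>c. T' (p c)) (mset_set {a..<b})"
    by (rule multiset_eqI) (simp only: cnt eq)
  then have "map (\<lambda>c. T (p c)) [a..<b] = map (\<lambda>c. T' (p c)) [a..<b]"
    using word T by metis
  then have "\<forall>x\<in>p ` {a..<b}. T x = T' x" by auto
  then show ?thesis using T by (auto simp: tableaux_def intro!: PiE_ext[of T "p ` {a..<b}" "\<lambda>_. {..<m}" T'])
qed

definition letter_count :: "(nat \<Rightarrow> nat + nat) \<Rightarrow> nat \<Rightarrow> multidegree \<Rightarrow> nat" where
  "letter_count \<iota> m e = (\<Sum>r<m. Poly_Mapping.lookup e (\<iota> r))"

lemma content_of_tableau:
  assumes p: "inj p" and \<iota>: "inj \<iota>" and T: "T \<in> tableaux R p a b m"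
    and e: "content \<iota> (p ` {a..<b}) T = e"
  shows "Poly_Mapping.keys e \<subseteq> \<iota> ` {..<m}" "letter_count \<iota> m e = b - a"
    "R = (<) \<Longrightarrow> Poly_Mapping.lookup e x \<le> 1"
proof -
  have l: "Poly_Mapping.lookup e x = (\<Sum>c\<in>{a..<b}. if \<iota> (T (p c)) = x then 1 else 0)" for x
    using p by (auto simp: e[symmetric] content_def lookup_sum lookup_single when_def sum.reindex inj_on_def dest: injD intro!: sum.cong)
  have Tm: "T (p c) < m" if "c \<in> {a..<b}" for c
    using T that by (auto simp: tableaux_def)
  show "Poly_Mapping.keys e \<subseteq> \<iota> ` {..<m}"
  proof
    fix x assume "x \<in> Poly_Mapping.keys e"
    then have "(\<Sum>c\<in>{a..<b}. if \<iota> (T (p c)) = x then 1 else 0 :: nat) \<noteq> 0" using l by (simp add: in_keys_iff)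
    then obtain c where "c \<in> {a..<b}" "(if \<iota> (T (p c)) = x then 1 else 0 :: nat) \<noteq> 0"
      by (rule sum.not_neutral_contains_not_neutral)
    then show "x \<in> \<iota> ` {..<m}" using Tm[of c] by (auto split: if_splits)
  qed
  have "letter_count \<iota> m e = (\<Sum>c\<in>{a..<b}. \<Sum>r<m. if \<iota> (T (p c)) = \<iota> r then 1 else 0)"
    unfolding letter_count_def l by (rule sum.swap)
  also have "\<dots> = (\<Sum>c\<in>{a..<b}. 1)"
    by (rule sum.cong) (use Tm in \<open>auto simp: inj_eq[OF \<iota>]\<close>)
  finally show "letter_count \<iota> m e = b - a" by simp
  show "Poly_Mapping.lookup e x \<le> 1" if "R = (<)"
  proof -
    have "Poly_Mapping.lookup e x = card {c\<in>{a..<b}. \<iota> (T (p c)) = x}"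
      by (simp add: l sum.If_cases Int_def)
    moreover have "c = c'" if "c \<in> {a..<b}" "c' \<in> {a..<b}" "\<iota> (T (p c)) = x" "\<iota> (T (p c')) = x" for c c'
    proof -
      have "T (p c) = T (p c')" using that injD[OF \<iota>] by metis
      then show ?thesis using T that \<open>R = (<)\<close> unfolding tableaux_def
        by (metis (mono_tags, lifting) mem_Collect_eq less_irrefl linorder_neqE_nat)
    qed
    then have "card {c\<in>{a..<b}. \<iota> (T (p c)) = x} \<le> 1"
      by (subst card_le_Suc0_iff_eq[unfolded One_nat_def[symmetric]]) auto
    ultimately show ?thesis by simp
  qed
qed

text \<open>
  Fill the strip with the sorted list of the letters; it is strictly increasing if no letter repeats.
\<close>

lemma tableau_of_content:
  assumes p: "inj p" and \<iota>: "inj \<iota>" 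
    and e: "Poly_Mapping.keys e \<subseteq> \<iota> ` {..<m}" "letter_count \<iota> m e = b - a"
    and R: "R = (\<le>) \<or> (R = (<) \<and> (\<forall>x. Poly_Mapping.lookup e x \<le> 1))"
  obtains T where "T \<in> tableaux R p a b m" "content \<iota> (p ` {a..<b}) T = e"
proof -
  \<comment> \<open>the multiset of letters prescribed by \<open>e\<close>\<close>
  define M where "M = (\<Sum>r<m. replicate_mset (Poly_Mapping.lookup e (\<iota> r)) r)"
  have count_M: "count M r = (if r < m then Poly_Mapping.lookup e (\<iota> r) else 0)" for r
    by (simp add: M_def count_sum)
  define xs where "xs = sorted_list_of_multiset M"
  have len: "length xs = b - a"
  proof -
    have "length xs = size M" unfolding xs_def by (metis mset_sorted_list_of_multiset size_mset)
    also have "size (\<Sum>r<k. replicate_mset (Poly_Mapping.lookup e (\<iota> r)) r) = (\<Sum>r<k. Poly_Mapping.lookup e (\<iota> r))" for k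
      by (induction k) simp_all
    then have "size M = b - a" using e(2) by (simp add: M_def letter_count_def)
    finally show ?thesis .
  qed
  have mset_xs: "mset xs = M" by (simp add: xs_def)
  have sorted_xs: "sorted xs" by (simp add: xs_def)
  have set_xs: "set xs \<subseteq> {..<m}"
  proof
    fix r assume "r \<in> set xs"
    then have "count M r > 0" using mset_xs by (metis count_greater_zero_iff set_mset_mset)
    then show "r \<in> {..<m}" by (simp add: count_M split: if_splits)
  qed
  have strict: "distinct xs" if "R = (<)" "R \<noteq> (\<le>)"
  proof -
    have "count (mset xs) r \<le> 1" for r using R that by (auto simp: mset_xs count_M)
    then show ?thesis unfolding distinct_count_atmost_1
      by (metis (no_types, opaque_lifting) One_nat_def count_eq_zero_iff le_Suc_eq le_zero_eq set_mset_mset)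
  qed
  define T where "T = restrict (\<lambda>x. xs ! (the_inv p x - a)) (p ` {a..<b})"
  have T: "T (p c) = xs ! (c - a)" if "c \<in> {a..<b}" for c
    using that p by (auto simp: T_def the_inv_f_f)
  have "T \<in> tableaux R p a b m"
    unfolding tableaux_def
  proof (intro CollectI conjI ballI impI)
    show "T \<in> p ` {a..<b} \<rightarrow>\<^sub>E {..<m}"
    proof (rule PiE_I)
      fix x assume "x \<in> p ` {a..<b}"
      then obtain c where "x = p c" "c \<in> {a..<b}" by blast
      then have "T x = xs ! (c - a)" "c - a < length xs" using T len by auto
      then show "T x \<in> {..<m}" using set_xs nth_mem[of "c - a" xs] by fastforce
    qed (auto simp: T_def)
    fix c c' assume c: "c \<in> {a..<b}" "c' \<in> {a..<b}" "c < c'"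
    then have "xs ! (c - a) \<le> xs ! (c' - a)" using sorted_xs len by (intro sorted_nth_mono) auto
    moreover have "xs ! (c - a) \<noteq> xs ! (c' - a)" if "distinct xs"
      using c len nth_eq_iff_index_eq[OF that, of "c - a" "c' - a"] by auto
    ultimately have "R (xs ! (c - a)) (xs ! (c' - a))"
      using R strict by (metis le_neq_implies_less)
    then show "R (T (p c)) (T (p c'))" using T c by simp
  qed
  moreover have "content \<iota> (p ` {a..<b}) T = e"
  proof (rule poly_mapping_eqI)
    fix x
    have "Poly_Mapping.lookup (content \<iota> (p ` {a..<b}) T) x = (\<Sum>c\<in>{a..<b}. if \<iota> (xs ! (c - a)) = x then 1 else 0)"
      using p by (auto simp: content_def lookup_sum lookup_single when_def sum.reindex inj_on_def T dest: injD intro!: sum.cong)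
    also have "\<dots> = (\<Sum>i<length xs. if \<iota> (xs ! i) = x then 1 else 0)"
      by (rule sum.reindex_bij_witness[of _ "\<lambda>i. i + a" "\<lambda>c. c - a"]) (auto simp: len)
    also have "\<dots> = (\<Sum>y\<leftarrow>xs. if \<iota> y = x then 1 else 0)"
      by (simp add: sum_list_sum_nth atLeast0LessThan)
    also have "\<dots> = (\<Sum>y\<in>#M. if \<iota> y = x then 1 else 0)"
      by (simp flip: mset_xs sum_mset_sum_list)
    also have "\<dots> = (\<Sum>r<m. Poly_Mapping.lookup e (\<iota> r) * (if \<iota> r = x then 1 else 0))"
    proof -
      have "(\<Sum>y\<in>#(\<Sum>r<l. replicate_mset (f r) r). h y) = (\<Sum>r<l. f r * h r)" for l and f h :: "nat \<Rightarrow> nat"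
        by (induction l) simp_all
      then show ?thesis by (simp only: M_def)
    qed
    also have "\<dots> = Poly_Mapping.lookup e x"
    proof (cases "x \<in> \<iota> ` {..<m}")
      case True
      then obtain r where "r < m" "x = \<iota> r" by auto
      then have "(\<Sum>r'<m. Poly_Mapping.lookup e (\<iota> r') * (if \<iota> r' = x then 1 else 0)) = (\<Sum>r'<m. if r' = r then Poly_Mapping.lookup e x else 0)"
        by (intro sum.cong) (auto simp: inj_eq[OF \<iota>])
      then show ?thesis using \<open>r < m\<close> by simp
    next
      case False
      then have "Poly_Mapping.lookup e x = 0" using e(1) by (auto simp: in_keys_iff)
      moreover have "(\<Sum>r<m. Poly_Mapping.lookup e (\<iota> r) * (if \<iota> r = x then 1 else 0)) = 0"
        using False by (intro sum.neutral) auto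
      ultimately show ?thesis by simp
    qed
    finally show "Poly_Mapping.lookup (content \<iota> (p ` {a..<b}) T) x = Poly_Mapping.lookup e x" .
  qed
  ultimately show ?thesis using that by blast
qed

lemma card_tableaux_content:
  assumes p: "inj p" and \<iota>: "inj \<iota>" and R: "R = (\<le>) \<or> R = (<)"
  shows "card {T \<in> tableaux R p a b m. content \<iota> (p ` {a..<b}) T = e} =
    (if Poly_Mapping.keys e \<subseteq> \<iota> ` {..<m} \<and> letter_count \<iota> m e = b - a \<and> (R = (<) \<longrightarrow> (\<forall>x. Poly_Mapping.lookup e x \<le> 1)) then 1 else 0)"
    (is "card ?X = (if ?P then 1 else 0)")
proof -
  have weak: "T \<in> tableaux (\<le>) p a b m" if "T \<in> tableaux R p a b m" for T
    using that R by (auto simp: tableaux_def less_imp_le)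
  have uniq: "T = T'" if "T \<in> ?X" "T' \<in> ?X" for T T'
    using that content_determines_tableau[OF p \<iota> weak weak] by simp
  show ?thesis
  proof (cases ?P)
    case True
    then obtain T where "T \<in> ?X" using tableau_of_content[OF p \<iota>, of e m b a R] R by blast
    then have "?X = {T}" using uniq by blast
    then have "card ?X = 1" by (simp only: card.insert finite.emptyI card.empty empty_iff not_False_eq_True if_False One_nat_def finite_insert insert_absorb)
    then show ?thesis by (rule trans) (rule if_P[OF True, symmetric])
  next
    case False
    then have "?X = {}" using content_of_tableau[OF p \<iota>, of _ R a b m e] by blast
    then have "card ?X = 0" by (simp only: card.empty)
    then show ?thesis by (rule trans) (rule if_not_P[OF False, symmetric])
  qed
qed

definition part :: "(nat + nat \<Rightarrow> bool) \<Rightarrow> multidegree \<Rightarrow> multidegree" where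
  "part P d = (\<Sum>x | x \<in> Poly_Mapping.keys d \<and> P x. Poly_Mapping.single x (Poly_Mapping.lookup d x))"

lemma lookup_part: "Poly_Mapping.lookup (part P d) x = (if P x then Poly_Mapping.lookup d x else 0)"
proof -
  have "Poly_Mapping.lookup (part P d) x = (\<Sum>y | y \<in> Poly_Mapping.keys d \<and> P y. if y = x then Poly_Mapping.lookup d x else 0)"
    by (auto simp: part_def lookup_sum lookup_single when_def intro!: sum.cong)
  then show ?thesis by (auto simp: in_keys_iff)
qed

lemma keys_part: "Poly_Mapping.keys (part P d) = {x \<in> Poly_Mapping.keys d. P x}"
  by (auto simp: in_keys_iff lookup_part split: if_splits)

text \<open>
  Since the two factors involve disjoint sets of variables, an exponent vector splits in exactly one way.
\<close>

lemma lookup_product_separated: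
  fixes f :: "'x \<Rightarrow> multidegree" and g :: "'y \<Rightarrow> multidegree"
  assumes fin: "finite M" "finite N"
    and M: "\<And>x. x \<in> M \<Longrightarrow> Poly_Mapping.keys (f x) \<subseteq> range Inl"
    and N: "\<And>y. y \<in> N \<Longrightarrow> Poly_Mapping.keys (g y) \<subseteq> range Inr"
  shows "Poly_Mapping.lookup ((\<Sum>x\<in>M. Poly_Mapping.single (f x) 1) * (\<Sum>y\<in>N. Poly_Mapping.single (g y) 1) :: qu_poly) d
    = of_nat (card {x \<in> M. f x = part isl d} * card {y \<in> N. g y = part (\<lambda>a. \<not> isl a) d})"
proof -
  have split: "f x + g y = d \<longleftrightarrow> f x = part isl d \<and> g y = part (\<lambda>a. \<not> isl a) d" if xy: "x \<in> M" "y \<in> N" for x y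
  proof -
    have "Poly_Mapping.lookup (f x) (Inr r) = 0" "Poly_Mapping.lookup (g y) (Inl r) = 0" for r
      using M[OF xy(1)] N[OF xy(2)] by (auto simp: in_keys_iff image_iff subset_iff)
    then show ?thesis
      by (auto simp: poly_mapping_eq_iff fun_eq_iff lookup_add lookup_part split: sum.splits)
         (metis add.left_neutral add.right_neutral isl_def sum.collapse(2))+
  qed
  have "Poly_Mapping.lookup ((\<Sum>x\<in>M. Poly_Mapping.single (f x) 1) * (\<Sum>y\<in>N. Poly_Mapping.single (g y) 1) :: qu_poly) d
    = (\<Sum>x\<in>M. \<Sum>y\<in>N. if f x + g y = d then 1 else 0)"
    by (simp add: sum_product mult_single lookup_sum lookup_single when_def)
  also have "\<dots> = (\<Sum>x\<in>M. \<Sum>y\<in>N. (if f x = part isl d then 1 else 0) * (if g y = part (\<lambda>a. \<not> isl a) d then 1 else 0))"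
    by (intro sum.cong refl) (simp add: split)
  also have "\<dots> = (\<Sum>x\<in>M. if f x = part isl d then 1 else 0) * (\<Sum>y\<in>N. if g y = part (\<lambda>a. \<not> isl a) d then 1 else 0)"
    by (simp only: sum_product)
  finally show ?thesis using fin by (simp add: sum.If_cases Int_def)
qed

lemma lookup_schur_product:
  assumes p: "inj p" "inj p'" and R: "R = (\<le>) \<or> R = (<)" "R' = (\<le>) \<or> R' = (<)"
    and D: "D = p ` {a..<b}" "ssyt D k = tableaux R p a b k"
    and D': "D' = p' ` {a'..<b'}" "ssyt D' j = tableaux R' p' a' b' j"
  shows "Poly_Mapping.lookup (schur D k q_var * schur D' j u_var) d =
    (if Poly_Mapping.keys d \<subseteq> Inl ` {..<k} \<union> Inr ` {..<j} 
      \<and> letter_count Inl k d = b - a \<and> (R = (<) \<longrightarrow> (\<forall>r. Poly_Mapping.lookup d (Inl r) \<le> 1))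
      \<and> letter_count Inr j d = b' - a' \<and> (R' = (<) \<longrightarrow> (\<forall>r. Poly_Mapping.lookup d (Inr r) \<le> 1)) then 1 else 0)"
proof -
  have fin: "finite D" "finite D'" using D D' by auto
  let ?q = "part isl d" and ?u = "part (\<lambda>a. \<not> isl a) d"
  let ?X = "{T \<in> ssyt D k. content Inl D T = ?q}" and ?Y = "{T \<in> ssyt D' j. content Inr D' T = ?u}"
  have keys: "Poly_Mapping.keys (content \<iota> D T) \<subseteq> range \<iota>" for \<iota> D T
    unfolding content_def by (intro order.trans[OF keys_sum]) auto
  have "Poly_Mapping.lookup (schur D k q_var * schur D' j u_var) d = of_nat (card ?X * card ?Y)"
    unfolding schur_eq_sum_content[OF fin(1), of q_var Inl, OF q_var_def] schur_eq_sum_content[OF fin(2), of u_var Inr, OF u_var_def]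
    by (rule lookup_product_separated) (use fin finite_ssyt keys in auto)
  moreover have "card ?X = (if Poly_Mapping.keys ?q \<subseteq> Inl ` {..<k} \<and> letter_count Inl k ?q = b - a \<and> (R = (<) \<longrightarrow> (\<forall>x. Poly_Mapping.lookup ?q x \<le> 1)) then 1 else 0)"
    unfolding D(2) unfolding D(1) by (rule card_tableaux_content) (use p R in auto)
  moreover have "card ?Y = (if Poly_Mapping.keys ?u \<subseteq> Inr ` {..<j} \<and> letter_count Inr j ?u = b' - a' \<and> (R' = (<) \<longrightarrow> (\<forall>x. Poly_Mapping.lookup ?u x \<le> 1)) then 1 else 0)"
    unfolding D'(2) unfolding D'(1) by (rule card_tableaux_content) (use p R in auto)
  moreover have "Poly_Mapping.keys ?q \<subseteq> Inl ` {..<k} \<and> Poly_Mapping.keys ?u \<subseteq> Inr ` {..<j} \<longleftrightarrow> Poly_Mapping.keys d \<subseteq> Inl ` {..<k} \<union> Inr ` {..<j}"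
    by (auto simp: keys_part subset_iff isl_def)
  moreover have "letter_count Inl k ?q = letter_count Inl k d" "letter_count Inr j ?u = letter_count Inr j d"
    by (simp_all add: letter_count_def lookup_part)
  moreover have "(\<forall>x. Poly_Mapping.lookup ?q x \<le> 1) \<longleftrightarrow> (\<forall>r. Poly_Mapping.lookup d (Inl r) \<le> 1)"
    "(\<forall>x. Poly_Mapping.lookup ?u x \<le> 1) \<longleftrightarrow> (\<forall>r. Poly_Mapping.lookup d (Inr r) \<le> 1)"
    by (auto simp: lookup_part split: sum.splits) (metis isl_def sum.collapse(2))+
  ultimately show ?thesis by auto
qed

lemma partitions_in_row:
  "{\<nu>. is_partition \<nu> \<and> diagram \<nu> \<subseteq> diagram [m]} = (\<lambda>i. if i = 0 then [] else [i]) ` {..m}"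
proof -
  have d: "diagram [i] = {0} \<times> {0..<i}" for i by (auto simp: diagram_def)
  have "\<nu> \<in> (\<lambda>i. if i = 0 then [] else [i]) ` {..m}" if \<nu>: "is_partition \<nu>" "diagram \<nu> \<subseteq> diagram [m]" for \<nu>
  proof (cases \<nu>)
    case (Cons x xs)
    have "xs = []"
    proof (rule ccontr)
      assume "xs \<noteq> []"
      then have "\<nu> ! 1 \<noteq> 0" "1 < length \<nu>" using \<nu>(1) Cons unfolding is_partition_def by (metis nth_mem length_Cons One_nat_def Suc_less_eq length_greater_0_conv)+
      then have "(1, 0) \<in> diagram \<nu>" by (simp add: diagram_def)
      then show False using \<nu>(2) d by auto
    qed
    moreover have "0 < x" using \<nu>(1) Cons by (auto simp: is_partition_def)
    moreover have "(0, x - 1) \<in> diagram [m]"    proof (rule subsetD[OF \<nu>(2)])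
      show "(0, x - 1) \<in> diagram \<nu>" using Cons \<open>0 < x\<close> by (simp add: diagram_def)
    qed
    then have "x \<le> m" by (auto simp: diagram_def)
    ultimately show ?thesis using Cons by (auto simp: image_iff)
  qed (simp add: image_iff)
  then show ?thesis by (auto simp: is_partition_def d) (auto simp: diagram_def)
qed

text \<open>
  A subshape of a column is a column, hence given by its length.
\<close>

lemma partitions_in_column:
  "{\<nu>. is_partition \<nu> \<and> diagram \<nu> \<subseteq> diagram (replicate m 1)} = (\<lambda>i. replicate i 1) ` {..m}"
proof -
  have d: "diagram (replicate i 1) = {0..<i} \<times> {0}" for i by (auto simp: diagram_def)
  have "\<nu> \<in> (\<lambda>i. replicate i 1) ` {..m}" if \<nu>: "is_partition \<nu>" "diagram \<nu> \<subseteq> diagram (replicate m 1)" for \<nu>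
  proof -
    have *: "r < m \<and> \<nu> ! r = 1" if r: "r < length \<nu>" for r
    proof -
      have "0 < \<nu> ! r" using \<nu>(1) r by (metis is_partition_def gr0I nth_mem)
      then have "(r, \<nu> ! r - 1) \<in> diagram \<nu>" using r by (simp add: diagram_def)
      then have "r < m" "\<nu> ! r - 1 = 0" using \<nu>(2) d by auto
      then show ?thesis using \<open>0 < \<nu> ! r\<close> by simp
    qed
    then have "\<nu> = replicate (length \<nu>) 1" by (intro nth_equalityI) auto
    moreover have "length \<nu> \<le> m" using * by (metis less_irrefl not_le)
    ultimately show ?thesis by blast
  qed
  moreover have "is_partition (replicate i 1)" for i
    by (auto simp: is_partition_def sorted_wrt_iff_nth_less)
  moreover have "diagram (replicate i 1) \<subseteq> diagram (replicate m 1)" if "i \<le> m" for i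
    unfolding d using that by auto
  ultimately show ?thesis by blast
qed

text \<open>
  In the sum over subshapes only the one whose size is the bosonic degree of \<open>d\<close> contributes. The bosonic part is a
  row and carries no restriction; the transposed complement is a column, so fermionic exponents are at most \<open>1\<close>.
\<close>

lemma lookup_super_schur_row:
  "Poly_Mapping.lookup (super_schur k j [m]) d =
    (if Poly_Mapping.keys d \<subseteq> Inl ` {..<k} \<union> Inr ` {..<j} \<and> letter_count Inl k d + letter_count Inr j d = m
      \<and> (\<forall>r. Poly_Mapping.lookup d (Inr r) \<le> 1) then 1 else 0)"
proof -
  let ?sh = "\<lambda>i. if i = 0 then [] else [i :: nat]"
  have d: "diagram (?sh i) = {0} \<times> {0..<i}" for i by (auto simp: diagram_def)
  have dm: "diagram [m] = {0} \<times> {0..<m}" by (auto simp: diagram_def)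
  have d': "prod.swap ` diagram [m] - prod.swap ` diagram (?sh i) = {i..<m} \<times> {0}" for i
    unfolding d dm product_swap by auto
  have inj: "inj_on ?sh {..m}" by (auto simp: inj_on_def split: if_splits)
  have eq: "super_schur k j [m] = (\<Sum>i\<le>m. schur ({0} \<times> {0..<i}) k q_var * schur ({i..<m} \<times> {0}) j u_var)"
    unfolding super_schur_def partitions_in_row sum.reindex[OF inj] o_def d' by (simp only: d)
  have "Poly_Mapping.lookup (super_schur k j [m]) d = (\<Sum>i\<le>m. if letter_count Inl k d = i then
      (if Poly_Mapping.keys d \<subseteq> Inl ` {..<k} \<union> Inr ` {..<j} \<and> letter_count Inr j d = m - i
       \<and> (\<forall>r. Poly_Mapping.lookup d (Inr r) \<le> 1) then 1 else 0) else 0)"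
    unfolding eq lookup_sum
  proof (rule sum.cong)
    fix i
    have "Poly_Mapping.lookup (schur ({0} \<times> {0..<i}) k q_var * schur ({i..<m} \<times> {0}) j u_var) d = 
     (if Poly_Mapping.keys d \<subseteq> Inl ` {..<k} \<union> Inr ` {..<j} 
      \<and> letter_count Inl k d = i - 0 \<and> ((\<le>) = ((<) :: nat \<Rightarrow> nat \<Rightarrow> bool) \<longrightarrow> (\<forall>r. Poly_Mapping.lookup d (Inl r) \<le> 1))
      \<and> letter_count Inr j d = m - i \<and> ((<) = ((<) :: nat \<Rightarrow> nat \<Rightarrow> bool) \<longrightarrow> (\<forall>r. Poly_Mapping.lookup d (Inr r) \<le> 1)) then 1 else 0)"
      by (rule lookup_schur_product[where p = "Pair 0" and p' = "\<lambda>r. (r, 0)"])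
         (auto simp: inj_def ssyt_row ssyt_column)
    moreover have "(\<le>) \<noteq> ((<) :: nat \<Rightarrow> nat \<Rightarrow> bool)" by (metis le_refl less_irrefl)
    ultimately show "Poly_Mapping.lookup (schur ({0} \<times> {0..<i}) k q_var * schur ({i..<m} \<times> {0}) j u_var) d =
     (if letter_count Inl k d = i then
      (if Poly_Mapping.keys d \<subseteq> Inl ` {..<k} \<union> Inr ` {..<j} \<and> letter_count Inr j d = m - i
       \<and> (\<forall>r. Poly_Mapping.lookup d (Inr r) \<le> 1) then 1 else 0) else 0)" by auto
  qed simp
  also have "\<dots> = (if letter_count Inl k d \<le> m then
      (if Poly_Mapping.keys d \<subseteq> Inl ` {..<k} \<union> Inr ` {..<j} \<and> letter_count Inr j d = m - letter_count Inl k d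
       \<and> (\<forall>r. Poly_Mapping.lookup d (Inr r) \<le> 1) then 1 else 0) else 0)"
    by (simp only: sum.delta' finite_atMost atMost_iff)
  also have "\<dots> = (if Poly_Mapping.keys d \<subseteq> Inl ` {..<k} \<union> Inr ` {..<j} \<and> letter_count Inl k d + letter_count Inr j d = m
      \<and> (\<forall>r. Poly_Mapping.lookup d (Inr r) \<le> 1) then 1 else 0)"
  proof -
    have "(if L \<le> m then (if P \<and> U = m - L \<and> Q then 1 else 0) else 0) = (if P \<and> L + U = m \<and> Q then 1 else (0 :: complex))"
      for L U :: nat and P Q by auto
    then show ?thesis .
  qed
  finally show ?thesis .
qed

lemma lookup_super_schur_column:
  "Poly_Mapping.lookup (super_schur k j (replicate m 1)) d =
    (if Poly_Mapping.keys d \<subseteq> Inl ` {..<k} \<union> Inr ` {..<j} \<and> letter_count Inl k d + letter_count Inr j d = m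
      \<and> (\<forall>r. Poly_Mapping.lookup d (Inl r) \<le> 1) then 1 else 0)"
proof -
  let ?sh = "\<lambda>i. replicate i (1::nat)"
  have d: "diagram (?sh i) = {0..<i} \<times> {0}" for i by (auto simp: diagram_def)
  have d': "prod.swap ` diagram (?sh m) - prod.swap ` diagram (?sh i) = {0} \<times> {i..<m}" for i
    unfolding d product_swap by auto
  have inj: "inj_on ?sh {..m}" by (auto simp: inj_on_def dest: arg_cong[of _ _ length])
  have eq: "super_schur k j (?sh m) = (\<Sum>i\<le>m. schur ({0..<i} \<times> {0}) k q_var * schur ({0} \<times> {i..<m}) j u_var)"
    unfolding super_schur_def partitions_in_column sum.reindex[OF inj] o_def d' by (simp only: d)
  have "Poly_Mapping.lookup (super_schur k j (?sh m)) d = (\<Sum>i\<le>m. if letter_count Inl k d = i then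
      (if Poly_Mapping.keys d \<subseteq> Inl ` {..<k} \<union> Inr ` {..<j} \<and> letter_count Inr j d = m - i
       \<and> (\<forall>r. Poly_Mapping.lookup d (Inl r) \<le> 1) then 1 else 0) else 0)"
    unfolding eq lookup_sum
  proof (rule sum.cong)
    fix i
    have "Poly_Mapping.lookup (schur ({0..<i} \<times> {0}) k q_var * schur ({0} \<times> {i..<m}) j u_var) d = 
     (if Poly_Mapping.keys d \<subseteq> Inl ` {..<k} \<union> Inr ` {..<j} 
      \<and> letter_count Inl k d = i - 0 \<and> ((<) = ((<) :: nat \<Rightarrow> nat \<Rightarrow> bool) \<longrightarrow> (\<forall>r. Poly_Mapping.lookup d (Inl r) \<le> 1))
      \<and> letter_count Inr j d = m - i \<and> ((\<le>) = ((<) :: nat \<Rightarrow> nat \<Rightarrow> bool) \<longrightarrow> (\<forall>r. Poly_Mapping.lookup d (Inr r) \<le> 1)) then 1 else 0)"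
      by (rule lookup_schur_product[where p' = "Pair 0" and p = "\<lambda>r. (r, 0)"])
         (auto simp: inj_def ssyt_row ssyt_column)
    moreover have "(\<le>) \<noteq> ((<) :: nat \<Rightarrow> nat \<Rightarrow> bool)" by (metis le_refl less_irrefl)
    ultimately show "Poly_Mapping.lookup (schur ({0..<i} \<times> {0}) k q_var * schur ({0} \<times> {i..<m}) j u_var) d =
     (if letter_count Inl k d = i then
      (if Poly_Mapping.keys d \<subseteq> Inl ` {..<k} \<union> Inr ` {..<j} \<and> letter_count Inr j d = m - i
       \<and> (\<forall>r. Poly_Mapping.lookup d (Inl r) \<le> 1) then 1 else 0) else 0)" by auto
  qed simp
  also have "\<dots> = (if letter_count Inl k d \<le> m then
      (if Poly_Mapping.keys d \<subseteq> Inl ` {..<k} \<union> Inr ` {..<j} \<and> letter_count Inr j d = m - letter_count Inl k d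
       \<and> (\<forall>r. Poly_Mapping.lookup d (Inl r) \<le> 1) then 1 else 0) else 0)"
    by (simp only: sum.delta' finite_atMost atMost_iff)
  also have "\<dots> = (if Poly_Mapping.keys d \<subseteq> Inl ` {..<k} \<union> Inr ` {..<j} \<and> letter_count Inl k d + letter_count Inr j d = m
      \<and> (\<forall>r. Poly_Mapping.lookup d (Inl r) \<le> 1) then 1 else 0)"
  proof -
    have "(if L \<le> m then (if P \<and> U = m - L \<and> Q then 1 else 0) else 0) = (if P \<and> L + U = m \<and> Q then 1 else (0 :: complex))"
      for L U :: nat and P Q by auto
    then show ?thesis .
  qed
  finally show ?thesis .
qed

section \<open>Coordinates modulo the ideal\<close>

text \<open>
  Exchanging \<open>z\<close> and \<open>w\<close> permutes monomials up to a sign. The sign matters only through the distinction between \<open>1\<close>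
  and \<open>-1\<close> on fixed monomials.
\<close>

lemma act_swapmat_monomial: "\<exists>m' e. e \<noteq> 0 \<and> act swapmat (smonom m 1) = smonom m' e"
proof (induction m rule: smon_induct)
  case one
  show ?case by (metis act_Const Const_def zero_neq_one)
next
  case (var a s m)
  then obtain m' e where m': "e \<noteq> 0" "act swapmat (smonom m 1) = smonom m' e" by blast
  obtain x where x: "smonom (smon_times (var a s) m) 1 = Const x * (smonom (var a s) 1 * smonom m 1)"
    using smonom_split[OF var(1)] by metis
  let ?c = "x * (koszul_sign (snd (var a (other s))) (snd m') * e)"
  have eq: "act swapmat (smonom (smon_times (var a s) m) 1) = smonom (smon_times (var a (other s)) m') ?c"
    unfolding x act_mult act_Const act_swapmat_letter[unfolded letter_def] m'(2) by (simp add: smonom_mult Const_mult_smonom)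
  have "?c \<noteq> 0"
  proof
    assume "?c = 0"
    then have "act swapmat (smonom (smon_times (var a s) m) 1) = 0" unfolding eq by (simp only: smonom_0)
    then have "smonom (smon_times (var a s) m) 1 = 0" by (metis act_0 act_swapmat_swapmat)
    then show False using coeff_of_smonom[of "smon_times (var a s) m" 1] by (metis coeff_of_simps(1) zero_neq_one)
  qed
  with eq show ?case by blast
qed

definition swap_mon :: "smon \<Rightarrow> smon" where
  "swap_mon m = (SOME m'. \<exists>e. e \<noteq> 0 \<and> act swapmat (smonom m 1) = smonom m' e)"

definition swap_sign :: "smon \<Rightarrow> complex" where
  "swap_sign m = coeff_of (act swapmat (smonom m 1)) (swap_mon m)"

lemma act_swapmat_smonom: "act swapmat (smonom m c) = smonom (swap_mon m) (c * swap_sign m)"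
proof -
  obtain e where e: "act swapmat (smonom m 1) = smonom (swap_mon m) e"
    using someI_ex[OF act_swapmat_monomial[of m]] unfolding swap_mon_def by blast
  then have "e = swap_sign m" by (simp add: swap_sign_def coeff_of_smonom)
  then show ?thesis using e by (metis act_Const act_mult Const_mult_smonom mult.right_neutral)
qed

lemma swap_sign_swap_sign: "swap_sign m * swap_sign (swap_mon m) = 1" and swap_mon_swap_mon [simp]: "swap_mon (swap_mon m) = m"
proof -
  have *: "smonom m 1 = smonom (swap_mon (swap_mon m)) (swap_sign m * swap_sign (swap_mon m))"
    using act_swapmat_swapmat[of "smonom m 1"] by (simp add: act_swapmat_smonom)
  have "coeff_of (smonom m 1) m = coeff_of (smonom (swap_mon (swap_mon m)) (swap_sign m * swap_sign (swap_mon m))) m"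
    using * by metis
  then show "swap_mon (swap_mon m) = m" "swap_sign m * swap_sign (swap_mon m) = 1" 
    by (auto simp: coeff_of_smonom split: if_splits)
qed

lemma swap_sign_nonzero: "swap_sign m \<noteq> 0"
  using swap_sign_swap_sign[of m] by auto

lemma coeff_of_act_swapmat: "coeff_of (act swapmat f) m = swap_sign (swap_mon m) * coeff_of f (swap_mon m)"
proof -
  have "coeff_of (act swapmat f) m = (\<Sum>m'\<in>monoms f. if m' = swap_mon m then swap_sign (swap_mon m) * coeff_of f (swap_mon m) else 0)"
    unfolding act_expand[of _ f] act_swapmat_smonom coeff_of_sum coeff_of_smonom
    by (rule sum.cong) auto
  also have "\<dots> = swap_sign (swap_mon m) * coeff_of f (swap_mon m)"
    by (simp add: in_monoms_iff)
  finally show ?thesis .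
qed

lemma cdeg_swap_mon: "cdeg s (swap_mon m) = cdeg (other s) m"
  by (rule cdeg_act_swapmat[of _ _ 1]) (simp add: act_swapmat_smonom monoms_smonom swap_sign_nonzero)

lemma other_simps [simp]: "other 1 = 2" "other 2 = 1"
  by (simp_all add: other_def)

lemma high_swap_mon: "high n (swap_mon m) \<longleftrightarrow> high n m"
  by (auto simp: high_def cdeg_swap_mon)

lemma balanced_swap_mon: "balanced n (swap_mon m) \<longleftrightarrow> balanced n m"
  by (auto simp: balanced_def cdeg_swap_mon)

lemma multidegree_swap_mon: "has_multidegree d (swap_mon m) \<longleftrightarrow> has_multidegree d m"
proof -
  have "wdeg (pairw a) (swap_mon m) = wdeg (pairw a) m" for a m
  proof -
    have "homog (pairw a) (wdeg (pairw a) m) (act swapmat (smonom m 1))"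
      unfolding pairw_def by (rule homog_act_pairwise) (simp add: homog_smonom)
    then show ?thesis by (simp add: act_swapmat_smonom homog_def monoms_smonom swap_sign_nonzero)
  qed
  then show ?thesis by (simp add: has_multidegree_iff)
qed

text \<open>
  The coordinate of a class with respect to a monomial \<open>m\<close>. For balanced \<open>m\<close>, where \<open>m\<close> is identified with
  \<open>- \<phi> m\<close>, it is the difference of the coefficients of \<open>h\<close> and \<open>\<phi> h\<close>, which kills invariants. The denominator
  normalizes the value at \<open>m\<close>; it is \<open>2\<close> if \<open>\<phi> m = - m\<close> and \<open>1\<close> if \<open>\<phi> m\<close> is not a multiple of \<open>m\<close>.
\<close>

definition coset_coord :: "nat \<Rightarrow> smon \<Rightarrow> superpoly \<Rightarrow> complex" where
  "coset_coord n m h = (if balanced n m 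
     then (coeff_of h m - coeff_of (act swapmat h) m) / (1 - coeff_of (act swapmat (smonom m 1)) m)
     else coeff_of h m)"

lemma coset_coord_add: "coset_coord n m (h + h') = coset_coord n m h + coset_coord n m h'"
  by (simp add: coset_coord_def act_add add_divide_distrib diff_divide_distrib)

lemma coset_coord_Const_mult: "coset_coord n m (Const c * h) = c * coset_coord n m h"
  by (simp add: coset_coord_def act_mult right_diff_distrib)

lemma balanced_not_high: "n \<ge> 2 \<Longrightarrow> balanced n m \<Longrightarrow> \<not> high n m"
  by (auto simp: balanced_def high_def)

lemma coset_coord_eigen_ideal:
  assumes n: "n \<ge> 2" and h: "h \<in> eigen_ideal n k j" and m: "\<not> high n m"
  shows "coset_coord n m h = 0"
proof -
  obtain q where q: "q \<in> eigen_invariants n" "\<forall>m\<in>monoms (h - q). high n m"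
    using h unfolding eigen_ideal_def by blast
  have r: "coeff_of h x = coeff_of q x" if "\<not> high n x" for x
    using q(2) that by (auto simp: in_monoms_iff)
  show ?thesis
  proof (cases "balanced n m")
    case True
    have "coeff_of (act swapmat h) m = coeff_of (act swapmat q) m"
      unfolding coeff_of_act_swapmat using r[of "swap_mon m"] m by (simp add: high_swap_mon)
    also have "\<dots> = coeff_of h m" using q(1) r[OF m] by (simp add: eigen_invariants_def)
    finally show ?thesis using True by (simp add: coset_coord_def)
  next
    case False
    then show ?thesis using r[OF m] eigen_invariants_monoms[OF n q(1), of m] m by (auto simp: coset_coord_def in_monoms_iff)
  qed
qed

text \<open>
  Selects a monomial from each pair exchanged by \<open>\<phi>\<close>; the choice depends only on the set of the two.
\<close>

definition is_rep :: "smon \<Rightarrow> bool" where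
  "is_rep m \<longleftrightarrow> (SOME x. x \<in> {m, swap_mon m}) = m"

lemma is_rep_cases: "is_rep m \<or> is_rep (swap_mon m)"
proof -
  have "(SOME x. x \<in> {m, swap_mon m}) \<in> {m, swap_mon m}" by (rule someI_ex) blast
  moreover have "{swap_mon m, swap_mon (swap_mon m)} = {m, swap_mon m}" by auto
  ultimately show ?thesis unfolding is_rep_def by (metis insertE singletonD)
qed

lemma is_rep_unique: "is_rep m \<Longrightarrow> is_rep (swap_mon m) \<Longrightarrow> swap_mon m = m"
proof -
  have "{swap_mon m, swap_mon (swap_mon m)} = {m, swap_mon m}" by auto
  then show "is_rep m \<Longrightarrow> is_rep (swap_mon m) \<Longrightarrow> swap_mon m = m" unfolding is_rep_def by metis
qed

text \<open>
  Low monomials whose classes are not identified with others.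
\<close>

definition rigid :: "nat \<Rightarrow> multidegree \<Rightarrow> smon set" where
  "rigid n d = {m. has_multidegree d m \<and> \<not> high n m \<and> \<not> balanced n m}"

text \<open>
  Representatives of the balanced monomials. A balanced monomial fixed by \<open>\<phi>\<close> is half of the invariant \<open>m + \<phi> m\<close>
  and is left out, because it vanishes in the quotient.
\<close>

definition paired :: "nat \<Rightarrow> multidegree \<Rightarrow> smon set" where
  "paired n d = {m. has_multidegree d m \<and> balanced n m \<and> is_rep m \<and> \<not> (swap_mon m = m \<and> swap_sign m = 1)}"

lemma coset_coord_denominator_nonzero:
  assumes "m \<in> paired n d" shows "1 - coeff_of (act swapmat (smonom m 1)) m \<noteq> 0"
  using assms by (auto simp: paired_def act_swapmat_smonom coeff_of_smonom split: if_splits)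

lemma coset_coord_dual:
  assumes "n \<ge> 2" "m \<in> rigid n d \<union> paired n d" "m' \<in> rigid n d \<union> paired n d"
  shows "coset_coord n m (smonom m' 1) = (if m = m' then 1 else 0)"
proof (cases "m \<in> rigid n d")
  case True
  then show ?thesis by (auto simp: coset_coord_def rigid_def coeff_of_smonom)
next
  case False
  then have m: "m \<in> paired n d" using assms by blast
  show ?thesis
  proof (cases "m = m'")
    case True
    then show ?thesis using coset_coord_denominator_nonzero[OF m] m by (simp add: coset_coord_def coeff_of_smonom paired_def)
  next
    case False
    have "swap_mon m' \<noteq> m"
    proof
      assume *: "swap_mon m' = m"
      then have "balanced n m'" using m balanced_swap_mon[of n m'] by (simp add: paired_def)
      then have "is_rep m'" using assms(3) by (auto simp: rigid_def paired_def)
      then show False using is_rep_unique[of m'] * m False by (auto simp: paired_def)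
    qed
    then show ?thesis using False m by (simp add: coset_coord_def coeff_of_smonom act_swapmat_smonom paired_def)
  qed
qed

text \<open>
  If all coordinates vanish, then the low part of \<open>h\<close> consists of balanced monomials and is fixed by \<open>\<phi>\<close>. Rotations
  fix balanced monomials anyway, so this part is an invariant and the rest is high.
\<close>

lemma coset_coord_separating:
  assumes n: "n \<ge> 2" and h: "h \<in> homogeneous k j d" and coset_coord: "\<And>m. m \<in> rigid n d \<union> paired n d \<Longrightarrow> coset_coord n m h = 0"
  shows "h \<in> eigen_ideal n k j"
proof -
  have md: "has_multidegree d m" if "coeff_of h m \<noteq> 0" for m
    using h that by (auto simp: homogeneous_def in_monoms_iff)
  have hS: "h \<in> SP k j" using h by (simp add: homogeneous_def)
  have nb: "coeff_of h m = 0" if "\<not> high n m" "\<not> balanced n m" for m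
  proof (rule ccontr)
    assume *: "coeff_of h m \<noteq> 0"
    then have "m \<in> rigid n d" using md that by (simp add: rigid_def)
    then show False using coset_coord[of m] that * by (simp add: coset_coord_def)
  qed
  have rb: "coeff_of (act swapmat h) m = coeff_of h m" if "m \<in> paired n d" for m
    using coset_coord[of m] coset_coord_denominator_nonzero[OF that] that by (simp add: coset_coord_def paired_def)
  have bal: "swap_sign (swap_mon m) * coeff_of h (swap_mon m) = coeff_of h m" if b: "balanced n m" for m
  proof (cases "has_multidegree d m")
    case False
    then have "coeff_of h m = 0" "coeff_of h (swap_mon m) = 0" using md multidegree_swap_mon by blast+
    then show ?thesis by simp
  next
    case d: True
    consider "m \<in> paired n d" | "swap_mon m \<in> paired n d" | "swap_mon m = m" "swap_sign m = 1"
    proof (cases "swap_mon m = m \<and> swap_sign m = 1")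
      case False
      then have "\<not> (m = swap_mon m \<and> swap_sign (swap_mon m) = 1)" by metis
      with False show ?thesis using is_rep_cases[of m] b d that(1,2) by (auto simp: paired_def multidegree_swap_mon balanced_swap_mon)
    qed (use that in blast)
    then show ?thesis
    proof cases
      case 1
      then show ?thesis using rb by (simp add: coeff_of_act_swapmat)
    next
      case 2
      then have "swap_sign m * coeff_of h m = coeff_of h (swap_mon m)" using rb[of "swap_mon m"] by (simp add: coeff_of_act_swapmat)
      then have "swap_sign (swap_mon m) * coeff_of h (swap_mon m) = (swap_sign m * swap_sign (swap_mon m)) * coeff_of h m" by (simp add: mult_ac)
      then show ?thesis by (simp add: swap_sign_swap_sign)
    qed simp
  qed
  \<comment> \<open>the balanced part of \<open>h\<close> is the invariant required by the ideal\<close>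
  define q where "q = (\<Sum>m\<in>{m \<in> monoms h. balanced n m}. smonom m (coeff_of h m))"
  have cq: "coeff_of q m = (if balanced n m then coeff_of h m else 0)" for m
  proof -
    have "coeff_of q m = (\<Sum>m'\<in>{m \<in> monoms h. balanced n m}. if m' = m then coeff_of h m else 0)"
      unfolding q_def coeff_of_sum coeff_of_smonom by (rule sum.cong) auto
    also have "\<dots> = (if m \<in> {m \<in> monoms h. balanced n m} then coeff_of h m else 0)"
      by (rule sum.delta) simp
    finally show ?thesis by (auto simp: in_monoms_iff)
  qed
  have "act swapmat q = q"
    by (rule superpoly_eqI) (simp add: coeff_of_act_swapmat cq balanced_swap_mon bal)
  moreover have "act (dmat (2 * pi / n)) q = q"
  proof (rule superpoly_eqI)
    fix m
    have "cis (2 * pi / n * (real (cdeg 2 m) - real (cdeg 1 m))) = 1" if "balanced n m"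
      using that n by (auto simp: balanced_def simp flip: cis_cnj)
    then show "coeff_of (act (dmat (2 * pi / n)) q) m = coeff_of q m"
      by (simp add: coeff_of_act_dmat cq)
  qed
  moreover have "coeff_of q (0, {||}) = 0" using n by (simp add: cq balanced_def)
  ultimately have "q \<in> eigen_invariants n" by (simp add: eigen_invariants_def)
  moreover have "q \<in> SP k j"
    unfolding q_def
  proof (rule SP_sum)
    fix m assume "m \<in> {m \<in> monoms h. balanced n m}"
    then show "smonom m (coeff_of h m) \<in> SP k j" using hS by (simp add: smonom_in_SP_iff) (simp add: carrier_iff homog_def)
  qed
  moreover have "high n m" if "m \<in> monoms (h - q)" for m
    using that nb[of m] by (auto simp: in_monoms_iff cq split: if_splits)
  ultimately show ?thesis using hS unfolding eigen_ideal_def by blast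
qed

section \<open>Low monomials of a given multidegree\<close>

definition tdeg :: "multidegree \<Rightarrow> nat" where
  "tdeg d = (\<Sum>a\<in>Poly_Mapping.keys d. Poly_Mapping.lookup d a)"

lemma multidegree_letter:
  assumes "has_multidegree d m" "wdeg w m > 0"
  obtains a s where "a \<in> Poly_Mapping.keys d" "w a s > 0"
proof -
  obtain a s m' where *: "w a s > 0" "compat (var a s) m'" "m = smon_times (var a s) m'"
    using assms(2) by (rule wdeg_split)
  then have "wdeg (pairw a) m > 0" by (simp add: wdeg_times pairw_def)
  then have "a \<in> Poly_Mapping.keys d" using assms(1) by (simp add: has_multidegree_iff in_keys_iff)
  then show ?thesis using that * by blast
qed

lemma wdeg_sum: "wdeg (\<lambda>b s. \<Sum>a\<in>A. w a b s) m = (\<Sum>a\<in>A. wdeg (w a) m)"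
proof -
  have "wdeg (\<lambda>b s. 0) m = 0" for m by (simp add: wdeg_def)
  then show ?thesis by (induction A rule: infinite_finite_induct) (simp_all add: wdeg_add)
qed

text \<open>
  Both sides are the total degree, once grouped by components and once by pairs.
\<close>

lemma cdeg_sum_eq_tdeg:
  assumes "has_multidegree d m" shows "cdeg 1 m + cdeg 2 m = tdeg d"
proof -
  let ?K = "Poly_Mapping.keys d"
  let ?out = "\<lambda>b (s :: 2). if b \<in> ?K then 0 else 1 :: nat"
  \<comment> \<open>variables of pairs outside the support of \<open>d\<close> do not occur in \<open>m\<close>\<close>
  have out: "wdeg ?out m = 0"
    by (rule ccontr) (use multidegree_letter[OF assms, of ?out] in auto)
  have "(\<lambda>b s. (if s = 1 then 1 else 0) + (if s = 2 then 1 else 0 :: nat)) = (\<lambda>b s. (\<Sum>a\<in>?K. pairw a b s) + ?out b s)"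
  proof (intro ext)
    fix b and s :: 2
    have "(\<Sum>a\<in>?K. pairw a b s) = (if b \<in> ?K then 1 else 0)" by (simp add: pairw_def)
    then show "(if s = 1 then 1 else 0) + (if s = 2 then 1 else 0 :: nat) = (\<Sum>a\<in>?K. pairw a b s) + ?out b s"
      using exhaust_2[of s] by auto
  qed
  then have "cdeg 1 m + cdeg 2 m = (\<Sum>a\<in>?K. wdeg (pairw a) m) + wdeg ?out m"
    unfolding cdeg_def wdeg_add[symmetric] wdeg_sum[symmetric] by (simp only:)
  then show ?thesis using assms out by (simp add: tdeg_def has_multidegree_iff)
qed

lemma multidegree_outw_iff:
  assumes "has_multidegree d m"
  shows "wdeg (outw k j) m = 0 \<longleftrightarrow> (\<forall>a\<in>Poly_Mapping.keys d. valid k j a)"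
proof
  assume *: "\<forall>a\<in>Poly_Mapping.keys d. valid k j a"
  show "wdeg (outw k j) m = 0"
  proof (rule ccontr)
    assume "wdeg (outw k j) m \<noteq> 0"
    then have "wdeg (outw k j) m > 0" by simp
    then obtain a s where "a \<in> Poly_Mapping.keys d" "outw k j a s > 0" by (rule multidegree_letter[OF assms])
    then show False using * by (simp add: outw_def)
  qed
next
  assume *: "wdeg (outw k j) m = 0"
  show "\<forall>a\<in>Poly_Mapping.keys d. valid k j a"
  proof
    fix a assume "a \<in> Poly_Mapping.keys d"
    then have "wdeg (pairw a) m > 0" using assms by (simp add: has_multidegree_iff in_keys_iff)
    then obtain b s m' where "pairw a b s > 0" "compat (var b s) m'" "m = smon_times (var b s) m'"
      by (rule wdeg_split)
    then show "valid k j a" using * by (auto simp: wdeg_times outw_def pairw_def split: if_splits)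
  qed
qed

lemma cdeg_0_letters:
  assumes "cdeg s m = 0"
  shows "Poly_Mapping.lookup (fst m) (Gen r s) = 0" "Gen r s |\<notin>| snd m"
proof -
  have 1: "(\<Sum>v\<in>Poly_Mapping.keys (fst m). Poly_Mapping.lookup (fst m) v * (if comp_of v = s then 1 else 0)) = 0"
    and 2: "(\<Sum>v\<in>fset (snd m). (if comp_of v = s then 1 else 0 :: nat)) = 0"
    using assms by (simp_all add: cdeg_def wdeg_def)
  show "Poly_Mapping.lookup (fst m) (Gen r s) = 0"
  proof (rule ccontr)
    assume *: "Poly_Mapping.lookup (fst m) (Gen r s) \<noteq> 0"
    then have "Gen r s \<in> Poly_Mapping.keys (fst m)" by (simp add: in_keys_iff)
    with 1 have "Poly_Mapping.lookup (fst m) (Gen r s) * (if comp_of (Gen r s) = s then 1 else 0) = 0"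
      by (subst (asm) sum_eq_0_iff) (simp, blast)
    then show False using * by simp
  qed
  show "Gen r s |\<notin>| snd m"
    using 2 by auto
qed

lemma sum_UNIV_other: "(\<Sum>t\<in>UNIV. f t) = f s + f (other s)" for f :: "2 \<Rightarrow> nat"
  using exhaust_2[of s] by (auto simp: sum_2 other_def)

lemma other_neq: "other s \<noteq> s" "s \<noteq> other s"
  using exhaust_2[of s] by (auto simp: other_def)

lemma UNIV_other: "(UNIV :: 2 set) = {s, other s}"
  using exhaust_2 by (auto simp: other_def)

definition pure_monomial :: "2 \<Rightarrow> multidegree \<Rightarrow> smon" where
  "pure_monomial s d = 
    (\<Sum>a\<in>{a \<in> Poly_Mapping.keys d. isl a}. Poly_Mapping.single (Gen (projl a) s) (Poly_Mapping.lookup d a),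
     (\<lambda>a. Gen (projr a) s) |`| Abs_fset {a \<in> Poly_Mapping.keys d. \<not> isl a})"

lemma pure_monomial_letters:
  "Poly_Mapping.lookup (fst (pure_monomial s d)) (Gen r t) = (if t = s then Poly_Mapping.lookup d (Inl r) else 0)"
  "Gen r t |\<in>| snd (pure_monomial s d) \<longleftrightarrow> t = s \<and> Poly_Mapping.lookup d (Inr r) \<noteq> 0"
proof -
  let ?L = "{a \<in> Poly_Mapping.keys d. isl a}"
  have "Poly_Mapping.lookup (fst (pure_monomial s d)) (Gen r t)
     = (\<Sum>a\<in>?L. if a = Inl r then (if t = s then Poly_Mapping.lookup d (Inl r) else 0) else 0)"
    unfolding pure_monomial_def fst_conv lookup_sum
    by (rule sum.cong) (auto simp: lookup_single when_def)
  also have "\<dots> = (if Inl r \<in> ?L then (if t = s then Poly_Mapping.lookup d (Inl r) else 0) else 0)"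
    by (rule sum.delta) simp
  finally show "Poly_Mapping.lookup (fst (pure_monomial s d)) (Gen r t) = (if t = s then Poly_Mapping.lookup d (Inl r) else 0)"
    by (auto simp: in_keys_iff)
  have "fset (snd (pure_monomial s d)) = (\<lambda>a. Gen (projr a) s) ` {a \<in> Poly_Mapping.keys d. \<not> isl a}"
    by (simp add: pure_monomial_def Abs_fset_inverse)
  then show "Gen r t |\<in>| snd (pure_monomial s d) \<longleftrightarrow> t = s \<and> Poly_Mapping.lookup d (Inr r) \<noteq> 0"
    by (force simp: in_keys_iff image_iff isl_def)
qed

text \<open>
  If only component \<open>s\<close> occurs, the multidegree is the list of exponents, and a fermionic exponent is \<open>0\<close> or
  \<open>1\<close>.
\<close>

lemma pure_monomials:
  "{m. has_multidegree d m \<and> cdeg (other s) m = 0} =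
    (if \<forall>r. Poly_Mapping.lookup d (Inr r) \<le> 1 then {pure_monomial s d} else {})"
proof -
  have card: "card {t. Gen r t |\<in>| snd m} = (if Gen r s |\<in>| snd m then 1 else 0)" if "Gen r (other s) |\<notin>| snd m" for r m
  proof -
    have "{t. Gen r t |\<in>| snd m} = (if Gen r s |\<in>| snd m then {s} else {})"
      using that UNIV_other[of s] by auto
    then show ?thesis by simp
  qed
  have eq: "m = pure_monomial s d" and fermion: "Poly_Mapping.lookup d (Inr r) \<le> 1"
    if m: "has_multidegree d m" "cdeg (other s) m = 0" for m r
  proof -
    note zero = cdeg_0_letters[OF m(2)]
    have l: "Poly_Mapping.lookup d (Inl r) = Poly_Mapping.lookup (fst m) (Gen r s)" for r
      using m(1) zero by (simp add: has_multidegree_def sum_UNIV_other[of _ s])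
    have r: "Poly_Mapping.lookup d (Inr r) = (if Gen r s |\<in>| snd m then 1 else 0)" for r
      using m(1) card[OF zero(2)] unfolding has_multidegree_def by metis
    show "Poly_Mapping.lookup d (Inr r) \<le> 1" using r by simp
    have "fst m = fst (pure_monomial s d)"
    proof (rule poly_mapping_eqI)
      fix v obtain r t where v: "v = Gen r t" by (cases v)
      have "t = s \<or> t = other s" using UNIV_other[of s] by blast
      then show "Poly_Mapping.lookup (fst m) v = Poly_Mapping.lookup (fst (pure_monomial s d)) v"
        using l zero other_neq by (auto simp: v pure_monomial_letters)
    qed
    moreover have "snd m = snd (pure_monomial s d)"
    proof (rule fset_eqI)
      fix v obtain r t where v: "v = Gen r t" by (cases v)
      have "t = s \<or> t = other s" using UNIV_other[of s] by blast
      then show "v |\<in>| snd m \<longleftrightarrow> v |\<in>| snd (pure_monomial s d)"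
        using r zero other_neq by (auto simp: v pure_monomial_letters)
    qed
    ultimately show "m = pure_monomial s d" by (rule prod_eqI)
  qed
  have ex: "has_multidegree d (pure_monomial s d) \<and> cdeg (other s) (pure_monomial s d) = 0"
    if f: "\<forall>r. Poly_Mapping.lookup d (Inr r) \<le> 1"
  proof
    have "card {t. Gen r t |\<in>| snd (pure_monomial s d)} = Poly_Mapping.lookup d (Inr r)" for r
      using f[rule_format, of r] by (subst card) (auto simp: pure_monomial_letters other_neq)
    then show "has_multidegree d (pure_monomial s d)"
      by (simp add: has_multidegree_def pure_monomial_letters)
    have c: "comp_of v = s" if "v \<in> Poly_Mapping.keys (fst (pure_monomial s d)) \<or> v |\<in>| snd (pure_monomial s d)" for v
      using that by (cases v) (auto simp: in_keys_iff pure_monomial_letters split: if_splits)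
    then show "cdeg (other s) (pure_monomial s d) = 0"
      using other_neq by (auto simp: cdeg_def wdeg_def)
  qed
  show ?thesis
  proof (cases "\<forall>r. Poly_Mapping.lookup d (Inr r) \<le> 1")
    case True
    then show ?thesis using eq ex by auto
  next
    case False
    then show ?thesis using fermion by auto
  qed
qed

text \<open>
  The product \<open>z\<^sub>a w\<^sub>b\<close> up to sign.
\<close>

definition mixed_monomial :: "nat + nat \<Rightarrow> nat + nat \<Rightarrow> smon" where
  "mixed_monomial a b = smon_times (var a 1) (var b 2)"

lemma compat_var: "s \<noteq> t \<Longrightarrow> compat (var a s) (var b t)"
  by (cases a; cases b) (auto simp: compat_def)

lemma wdeg_mixed: "wdeg w (mixed_monomial a b) = w a 1 + w b 2"
  by (simp add: mixed_monomial_def wdeg_times[OF compat_var])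

lemma multidegree_mixed_iff:
  "has_multidegree d (mixed_monomial a b) \<longleftrightarrow> d = Poly_Mapping.single a 1 + Poly_Mapping.single b 1"
  by (auto simp: has_multidegree_iff mixed_monomial_def wdeg_times[OF compat_var] pairw_def poly_mapping_eq_iff fun_eq_iff
       lookup_add lookup_single when_def)

lemma cdeg_mixed [simp]: "cdeg s (mixed_monomial a b) = 1"
  using exhaust_2[of s] by (auto simp: mixed_monomial_def cdeg_times[OF compat_var])

lemma mixed_monomialE:
  assumes "cdeg 1 m = 1" "cdeg 2 m = 1"
  obtains a b where "m = mixed_monomial a b"
proof -
  obtain a m1 where 1: "compat (var a 1) m1" "m = smon_times (var a 1) m1"
  proof -
    have "cdeg 1 m > 0" using assms by simp
    from monomial_split[OF this] that show thesis by blast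
  qed
  then have "cdeg 1 m1 = 0" "cdeg 2 m1 = 1" using assms by (simp_all add: cdeg_times)
  then obtain b m2 where 2: "compat (var b 2) m2" "m1 = smon_times (var b 2) m2"
  proof -
    have "cdeg 2 m1 > 0" using \<open>cdeg 2 m1 = 1\<close> by simp
    from monomial_split[OF this] that show thesis by blast
  qed
  then have "cdeg 1 m2 + cdeg 2 m2 = 0" using \<open>cdeg 1 m1 = 0\<close> \<open>cdeg 2 m1 = 1\<close> by (simp add: cdeg_times)
  then have "m2 = (0, {||})" by (simp only: cdeg_total_0)
  with 1 2 that show ?thesis by (simp add: mixed_monomial_def)
qed

lemma mixed_monomial_inj: "mixed_monomial a b = mixed_monomial a' b' \<longleftrightarrow> a = a' \<and> b = b'"
proof
  assume *: "mixed_monomial a b = mixed_monomial a' b'"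
  then have eq: "w a 1 + w b 2 = w a' 1 + w b' 2" for w :: "nat + nat \<Rightarrow> 2 \<Rightarrow> nat"
    using wdeg_mixed[of w a b] wdeg_mixed[of w a' b'] by simp
  have "a' = a"
    by (rule ccontr) (use eq[of "\<lambda>c s. if s = 1 then if c = a then 1 else 0 else 0"] in simp)
  moreover have "b' = b"
    by (rule ccontr) (use eq[of "\<lambda>c s. if s = 2 then if c = b then 1 else 0 else 0"] in simp)
  ultimately show "a = a' \<and> b = b'" by blast
qed simp

lemma tdeg_2E:
  assumes "tdeg d = 2" obtains a b where "d = Poly_Mapping.single a 1 + Poly_Mapping.single b 1"
proof -
  have pick: "\<exists>a. a \<in> Poly_Mapping.keys d" if "tdeg d \<noteq> 0" for d :: multidegree
  proof (rule ccontr)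
    assume "\<nexists>a. a \<in> Poly_Mapping.keys d"
    then have "Poly_Mapping.keys d = {}" by blast
    then show False using that by (simp add: tdeg_def)
  qed
  have sub: "d = Poly_Mapping.single a 1 + (d - Poly_Mapping.single a 1)" if "a \<in> Poly_Mapping.keys d" for a and d :: multidegree
    using that by (intro poly_mapping_eqI) (auto simp: lookup_add lookup_minus lookup_single when_def in_keys_iff)
  have tdeg_add: "tdeg (Poly_Mapping.single a 1 + e) = Suc (tdeg e)" for a e
  proof -
    have t: "tdeg e = (\<Sum>x\<in>M. Poly_Mapping.lookup e x)" if "finite M" "Poly_Mapping.keys e \<subseteq> M" for e M
      unfolding tdeg_def by (rule sum.mono_neutral_left) (use that in \<open>auto simp: in_keys_iff\<close>)
    have "Poly_Mapping.keys (Poly_Mapping.single a 1 + e) \<subseteq> insert a (Poly_Mapping.keys e)"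
      using keys_add[of "Poly_Mapping.single a (1::nat)" e] by auto
    then have "tdeg (Poly_Mapping.single a 1 + e) = (\<Sum>x\<in>insert a (Poly_Mapping.keys e). (if a = x then 1 else 0) + Poly_Mapping.lookup e x)"
      by (subst t[of "insert a (Poly_Mapping.keys e)"]) (simp_all add: lookup_add lookup_single when_def del: One_nat_def)
    also have "\<dots> = 1 + (\<Sum>x\<in>insert a (Poly_Mapping.keys e). Poly_Mapping.lookup e x)"
      by (simp only: sum.distrib) simp
    also have "(\<Sum>x\<in>insert a (Poly_Mapping.keys e). Poly_Mapping.lookup e x) = tdeg e"
      by (rule t[symmetric]) auto
    finally show ?thesis by simp
  qed
  obtain a where a: "a \<in> Poly_Mapping.keys d" using pick[of d] assms by auto
  define e where "e = d - Poly_Mapping.single a 1"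
  have d: "d = Poly_Mapping.single a 1 + e" using sub[OF a] by (simp add: e_def)
  then have "tdeg e = 1" using tdeg_add[of a e] assms by simp
  then obtain b where b: "b \<in> Poly_Mapping.keys e" using pick[of e] by auto
  define f where "f = e - Poly_Mapping.single b 1"
  have e: "e = Poly_Mapping.single b 1 + f" using sub[OF b] by (simp add: f_def)
  then have "tdeg f = 0" using tdeg_add[of b f] \<open>tdeg e = 1\<close> by simp
  then have "f = 0" using pick[of f] by (auto simp: tdeg_def in_keys_iff intro!: poly_mapping_eqI)
  then show ?thesis using that[of a b] d e by simp
qed

abbreviation fermion_free_of_squares :: "multidegree \<Rightarrow> bool" where
  "fermion_free_of_squares d \<equiv> \<forall>r. Poly_Mapping.lookup d (Inr r) \<le> 1"

abbreviation boson_free_of_squares :: "multidegree \<Rightarrow> bool" where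
  "boson_free_of_squares d \<equiv> \<forall>r. Poly_Mapping.lookup d (Inl r) \<le> 1"

lemma pure_monomial_props:
  assumes "fermion_free_of_squares d"
  shows "has_multidegree d (pure_monomial s d)" "cdeg (other s) (pure_monomial s d) = 0" "cdeg s (pure_monomial s d) = tdeg d"
proof -
  show *: "has_multidegree d (pure_monomial s d)" "cdeg (other s) (pure_monomial s d) = 0"
    using pure_monomials[of d s] assms by (auto split: if_splits)
  then show "cdeg s (pure_monomial s d) = tdeg d"
    using cdeg_sum_eq_tdeg[OF *(1)] exhaust_2[of s] by auto
qed

lemma pure_monomial_unique:
  assumes "has_multidegree d m" "cdeg (other s) m = 0"
  shows "fermion_free_of_squares d" "m = pure_monomial s d"
proof -
  have "m \<in> (if fermion_free_of_squares d then {pure_monomial s d} else {})"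
    unfolding pure_monomials[symmetric] using assms by simp
  then show "fermion_free_of_squares d" "m = pure_monomial s d" by (simp_all split: if_splits)
qed

text \<open>
  A low monomial that is not balanced is pure of degree less than \<open>n\<close>. In degree \<open>0\<close> the two pure monomials
  coincide.
\<close>

lemma rigid_eq:
  assumes n: "n \<ge> 2"
  shows "rigid n d = (if fermion_free_of_squares d \<and> tdeg d < n then {pure_monomial 1 d, pure_monomial 2 d} else {})"
proof -
  have 1: "fermion_free_of_squares d \<and> tdeg d < n \<and> m \<in> {pure_monomial 1 d, pure_monomial 2 d}" if m: "m \<in> rigid n d" for m
  proof -
    have md: "has_multidegree d m" "\<not> high n m" "\<not> balanced n m" using m by (simp_all add: rigid_def)
    then have t: "cdeg 1 m + cdeg 2 m = tdeg d" by (simp add: cdeg_sum_eq_tdeg)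
    have "cdeg 1 m = 0 \<or> cdeg 2 m = 0" "tdeg d < n"
      using md(2,3) t by (auto simp: high_def balanced_def)
    then show ?thesis using pure_monomial_unique[OF md(1), of 2] pure_monomial_unique[OF md(1), of 1] by auto
  qed
  have 2: "pure_monomial s d \<in> rigid n d" if f: "fermion_free_of_squares d" "tdeg d < n" for s
    using pure_monomial_props[OF f(1), of s] f(2) n exhaust_2[of s] by (auto simp: rigid_def high_def balanced_def)
  show ?thesis using 1 2 by (cases "fermion_free_of_squares d \<and> tdeg d < n") auto
qed

lemma tdeg_0_iff: "tdeg d = 0 \<longleftrightarrow> d = 0"
  by (auto simp: tdeg_def in_keys_iff intro!: poly_mapping_eqI)

lemma sum_rigid:
  assumes n: "n \<ge> 2"
  shows "(\<Sum>m\<in>rigid n d. cis (t * (real (cdeg 2 m) - real (cdeg 1 m)))) =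
    (if fermion_free_of_squares d \<and> tdeg d < n then if d = 0 then 1 else 2 * of_real (cos (t * tdeg d)) else 0)"
proof (cases "fermion_free_of_squares d \<and> tdeg d < n")
  case True
  let ?z = "pure_monomial 1 d" and ?w = "pure_monomial 2 d"
  have f: "fermion_free_of_squares d" using True by blast
  have cd: "cdeg 1 ?z = tdeg d" "cdeg 2 ?z = 0" "cdeg 2 ?w = tdeg d" "cdeg 1 ?w = 0"
    using pure_monomial_props(2,3)[OF f, of 1] pure_monomial_props(2,3)[OF f, of 2] by simp_all
  show ?thesis
  proof (cases "d = 0")
    case d: True
    then have "cdeg 1 ?z + cdeg 2 ?z = 0" "cdeg 1 ?w + cdeg 2 ?w = 0" using cd tdeg_0_iff[of d] by simp_all
    then have "?z = (0, {||})" "?w = (0, {||})" by (simp_all only: cdeg_total_0)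
    then show ?thesis using True d by (simp add: rigid_eq[OF n])
  next
    case False
    then have "tdeg d \<noteq> 0" using tdeg_0_iff by blast
    then have "?z \<noteq> ?w" using cd by metis
    then have "(\<Sum>m\<in>rigid n d. cis (t * (real (cdeg 2 m) - real (cdeg 1 m)))) = cis (- (t * tdeg d)) + cis (t * tdeg d)"
      using True by (simp add: rigid_eq[OF n] cd)
    also have "\<dots> = 2 * of_real (cos (t * tdeg d))"
      by (simp add: complex_eq_iff)
    finally show ?thesis using True False by simp
  qed
next
  case False
  then show ?thesis by (auto simp: rigid_eq[OF n])
qed

text \<open>
  A pair of distinct monomials exchanged by \<open>\<phi>\<close> contributes one dimension.
\<close>

lemma card_rep_pair:
  assumes "swap_mon x \<noteq> x"
  shows "card {m \<in> {x, swap_mon x}. is_rep m \<and> \<not> (swap_mon m = m \<and> swap_sign m = 1)} = 1"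
proof -
  have "{m \<in> {x, swap_mon x}. is_rep m \<and> \<not> (swap_mon m = m \<and> swap_sign m = 1)} = (if is_rep x then {x} else {swap_mon x})"
    using is_rep_cases[of x] is_rep_unique[of x] assms by auto
  then show ?thesis by simp
qed

lemma swap_mon_pure:
  assumes "fermion_free_of_squares d" shows "swap_mon (pure_monomial 1 d) = pure_monomial 2 d"
  using pure_monomial_unique(2)[of d "swap_mon (pure_monomial 1 d)" 2] pure_monomial_props[OF assms, of 1]
  by (simp add: multidegree_swap_mon cdeg_swap_mon)

lemma swap_mon_mixed: "swap_mon (mixed_monomial a b) = mixed_monomial b a"
proof -
  obtain e where e: "e * e = 1" "smonom (mixed_monomial a b) 1 = Const e * (letter a 1 * letter b 2)"
    using smonom_split[OF compat_var[of 1 2 a b]] unfolding letter_def mixed_monomial_def by auto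
  have "smonom (swap_mon (mixed_monomial a b)) (swap_sign (mixed_monomial a b)) = Const e * (letter a 2 * letter b 1)"
    using act_swapmat_smonom[of "mixed_monomial a b" 1] by (simp add: e(2) act_mult act_swapmat_letter)
  also have "\<dots> = smonom (mixed_monomial b a) (e * koszul_sign (snd (var a 2)) (snd (var b 1)))"
    by (simp add: letter_def smonom_mult Const_mult_smonom mixed_monomial_def smon_times_commute)
  finally have "monoms (smonom (swap_mon (mixed_monomial a b)) (swap_sign (mixed_monomial a b))) \<subseteq> {mixed_monomial b a}"
    by (simp add: monoms_smonom)
  then show ?thesis by (simp add: monoms_smonom swap_sign_nonzero)
qed

text \<open>
  The two variables of a bosonic pair commute, those of a fermionic pair anticommute.
\<close>

lemma swap_sign_mixed: "swap_sign (mixed_monomial a a) = (if isl a then 1 else -1)"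
proof -
  obtain e where e: "smonom (mixed_monomial a a) 1 = Const e * (letter a 1 * letter a 2)"
    using smonom_split[OF compat_var[of 1 2 a a]] unfolding letter_def mixed_monomial_def by auto
  have "smonom (mixed_monomial a a) (swap_sign (mixed_monomial a a)) = Const e * (letter a 2 * letter a 1)"
    using act_swapmat_smonom[of "mixed_monomial a a" 1] by (simp add: e act_mult act_swapmat_letter swap_mon_mixed)
  also have "letter a 2 * letter a 1 = Const (if isl a then 1 else -1) * (letter a 1 * letter a 2)"
    using Thetavar_anticommute[of "Gen (projr a) 2" "Gen (projr a) 1"]
    by (cases a) (simp_all add: letter_simps Xvar_commute Const_simps(4,5))
  also have "Const e * (Const (if isl a then 1 else -1) * (letter a 1 * letter a 2)) = Const (if isl a then 1 else -1) * smonom (mixed_monomial a a) 1"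
    by (simp only: Const_Const mult.commute e)
  finally have "coeff_of (smonom (mixed_monomial a a) (swap_sign (mixed_monomial a a))) (mixed_monomial a a) = 
      coeff_of (Const (if isl a then 1 else -1) * smonom (mixed_monomial a a) 1) (mixed_monomial a a)" by (simp only:)
  then show ?thesis by (simp only: coeff_of_Const_mult coeff_of_smonom simp_thms if_True mult.right_neutral)
qed

text \<open>
  The pure balanced monomials form one exchanged pair in degree \<open>n\<close>. The mixed ones form the pair
  \<open>z\<^sub>a w\<^sub>b\<close>, \<open>z\<^sub>b w\<^sub>a\<close> if \<open>a \<noteq> b\<close>. If \<open>a = b\<close> there is a single one, which survives exactly if it changes sign,
  that is, if \<open>a\<close> is fermionic. The two contributions are separate also for \<open>n = 2\<close>.
\<close>

lemma card_paired:
  assumes n: "n \<ge> 2"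
  shows "card (paired n d) = (if fermion_free_of_squares d \<and> tdeg d = n then 1 else 0) + (if boson_free_of_squares d \<and> tdeg d = 2 then 1 else 0)"
    and "finite (paired n d)"
proof -
  let ?good = "\<lambda>m. is_rep m \<and> \<not> (swap_mon m = m \<and> swap_sign m = 1)"
  let ?P = "{m. has_multidegree d m \<and> (cdeg 1 m, cdeg 2 m) \<in> {(n, 0), (0, n)} \<and> ?good m}"
  let ?M = "{m. has_multidegree d m \<and> cdeg 1 m = 1 \<and> cdeg 2 m = 1 \<and> ?good m}"
  have paired: "paired n d = ?P \<union> ?M" "?P \<inter> ?M = {}" using n by (auto simp: paired_def balanced_def)
  have P: "finite ?P \<and> card ?P = (if fermion_free_of_squares d \<and> tdeg d = n then 1 else 0)"
  proof (cases "fermion_free_of_squares d \<and> tdeg d = n")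
    case True
    then have f: "fermion_free_of_squares d" by blast
    have cd: "cdeg 1 (pure_monomial 1 d) = n" "cdeg 2 (pure_monomial 1 d) = 0" "cdeg 2 (pure_monomial 2 d) = n" "cdeg 1 (pure_monomial 2 d) = 0"
      using pure_monomial_props(2,3)[OF f, of 1] pure_monomial_props(2,3)[OF f, of 2] True by simp_all
    have ne: "swap_mon (pure_monomial 1 d) \<noteq> pure_monomial 1 d"
    proof
      assume "swap_mon (pure_monomial 1 d) = pure_monomial 1 d"
      then have "pure_monomial 1 d = pure_monomial 2 d" using swap_mon_pure[OF f] by simp
      then show False using cd n by simp
    qed
    have "?P = {m \<in> {pure_monomial 1 d, swap_mon (pure_monomial 1 d)}. ?good m}"
      unfolding swap_mon_pure[OF f] using pure_monomial_props(1)[OF f] cd 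
        pure_monomial_unique(2)[of d _ 1] pure_monomial_unique(2)[of d _ 2] by auto
    then show ?thesis using card_rep_pair[OF ne] True by simp
  next
    case False
    have "?P = {}"
    proof (rule ccontr)
      assume "?P \<noteq> {}"
      then obtain m where m: "has_multidegree d m" "(cdeg 1 m, cdeg 2 m) \<in> {(n, 0), (0, n)}" by blast
      then have "tdeg d = n" using cdeg_sum_eq_tdeg[OF m(1)] by auto
      moreover have "fermion_free_of_squares d"
        using m pure_monomial_unique(1)[OF m(1), of 1] pure_monomial_unique(1)[OF m(1), of 2] by auto
      ultimately show False using False by blast
    qed
    then show ?thesis using False by (simp only: finite.emptyI card.empty if_False simp_thms)
  qed
  have M: "finite ?M \<and> card ?M = (if boson_free_of_squares d \<and> tdeg d = 2 then 1 else 0)"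
  proof (cases "tdeg d = 2")
    case True
    then obtain a b where d: "d = Poly_Mapping.single a 1 + Poly_Mapping.single b 1" by (rule tdeg_2E)
    have M: "?M = {m \<in> {mixed_monomial a b, mixed_monomial b a}. ?good m}"
    proof (intro equalityI subsetI)
      fix m assume m: "m \<in> ?M"
      then obtain a' b' where m': "m = mixed_monomial a' b'" by (elim CollectE conjE mixed_monomialE) 
      then have "d = Poly_Mapping.single a' 1 + Poly_Mapping.single b' 1" using m multidegree_mixed_iff by blast
      then have eq: "Poly_Mapping.single a' (1::nat) + Poly_Mapping.single b' 1 = Poly_Mapping.single a 1 + Poly_Mapping.single b 1"
        using d by simp
      have l: "(if a' = x then 1 else 0) + (if b' = x then 1 else 0) = (if a = x then 1 else 0) + (if b = x then 1 else (0::nat))" for x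
        using arg_cong[OF eq, of "\<lambda>e. Poly_Mapping.lookup e x"] by (simp only: lookup_add lookup_single when_def)
      have "a' = a \<and> b' = b \<or> a' = b \<and> b' = a"
      proof -
        have "a = a' \<or> b = a'" by (rule ccontr) (use l[of a'] in simp)
        then show ?thesis
        proof
          assume aa: "a = a'"
          have "b = b'" by (rule ccontr) (use l[of b'] aa in simp)
          then show ?thesis using aa by simp
        next
          assume ba: "b = a'"
          have "a = b'" by (rule ccontr) (use l[of b'] ba in simp)
          then show ?thesis using ba by simp
        qed
      qed
      then show "m \<in> {m \<in> {mixed_monomial a b, mixed_monomial b a}. ?good m}" using m m' by auto
    qed (auto simp: multidegree_mixed_iff d add.commute)
    show ?thesis
    proof (cases "a = b")
      case False
      have "boson_free_of_squares d" using False by (auto simp: d lookup_add lookup_single when_def)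
      moreover have "swap_mon (mixed_monomial a b) \<noteq> mixed_monomial a b" using False by (simp add: swap_mon_mixed mixed_monomial_inj)
      from card_rep_pair[OF this] have "card ?M = 1" unfolding M swap_mon_mixed .
      moreover have "finite ?M" unfolding M by simp
      ultimately show ?thesis using True by simp
    next
      case ab: True
      have "is_rep (mixed_monomial a a)" using is_rep_cases[of "mixed_monomial a a"] by (simp add: swap_mon_mixed)
      then have M': "?M = (if isl a then {} else {mixed_monomial a a})"
        unfolding M ab[symmetric] by (auto simp: swap_mon_mixed swap_sign_mixed)
      have "boson_free_of_squares d \<longleftrightarrow> \<not> isl a"
        by (cases a) (auto simp: d ab[symmetric] lookup_add lookup_single when_def)
      then show ?thesis unfolding M' using True by simp
    qed
  next
    case False
    have "?M = {}"
      using cdeg_sum_eq_tdeg[of d] False by fastforce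
    then show ?thesis using False by (simp only: finite.emptyI card.empty if_False simp_thms)
  qed
  show "finite (paired n d)" unfolding paired(1) using P M by blast
  show "card (paired n d) = (if fermion_free_of_squares d \<and> tdeg d = n then 1 else 0) + (if boson_free_of_squares d \<and> tdeg d = 2 then 1 else 0)"
    unfolding paired(1) using P M paired(2) by (simp only: card_Un_disjoint)
qed

lemma trace_terms_rot:
  assumes n: "n \<ge> 2" and m: "m \<in> rigid n d \<union> paired n d"
  shows "coset_coord n m (act (dmat (2 * pi * real l / n)) (smonom m 1)) =
    (if m \<in> rigid n d then cis (2 * pi * real l / n * (real (cdeg 2 m) - real (cdeg 1 m))) else 1)"
proof -
  have "coset_coord n m (act (dmat t) (smonom m 1)) = cis (t * (real (cdeg 2 m) - real (cdeg 1 m)))" for t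
  proof -
    have "act (dmat t) (smonom m 1) = Const (cis (t * (real (cdeg 2 m) - real (cdeg 1 m)))) * smonom m 1"
      by (simp add: act_dmat_smonom Const_mult_smonom)
    then show ?thesis using coset_coord_dual[OF n m m] by (simp add: coset_coord_Const_mult)
  qed
  moreover have "cis (2 * pi * real l / n * (real (cdeg 2 m) - real (cdeg 1 m))) = 1" if "m \<notin> rigid n d"
  proof -
    have "cis (2 * pi * real l) = 1" by (metis cis_multiple_2pi Ints_of_nat)
    then show ?thesis using that m n by (auto simp: paired_def balanced_def simp flip: cis_cnj)
  qed
  ultimately show ?thesis by simp
qed

text \<open>
  A reflection exchanges the pure monomials of degree less than \<open>n\<close>, so only the constant \<open>1\<close> contributes to the
  trace; on balanced monomials, identified with minus their partners, it acts by \<open>-1\<close>.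
\<close>

lemma trace_terms_reflection:
  assumes n: "n \<ge> 2" and m: "m \<in> rigid n d \<union> paired n d"
  shows "coset_coord n m (act (dmat (2 * pi * real l / n)) (act swapmat (smonom m 1))) = (if m \<in> rigid n d then if d = 0 then 1 else 0 else -1)"
proof -
  have sum: "cdeg 1 m + cdeg 2 m = tdeg d" using m by (auto simp: rigid_def paired_def cdeg_sum_eq_tdeg)
  let ?c = "cis (2 * pi * real l / n * (real (cdeg 2 (swap_mon m)) - real (cdeg 1 (swap_mon m))))"
  have eq: "act (dmat (2 * pi * real l / n)) (act swapmat (smonom m 1)) = Const ?c * act swapmat (smonom m 1)"
    by (simp add: act_swapmat_smonom act_dmat_smonom Const_mult_smonom mult.commute)
  show ?thesis
  proof (cases "m \<in> rigid n d")
    case True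
    show ?thesis
    proof (cases "d = 0")
      case d: True
      then have "m = (0, {||})" using sum tdeg_0_iff[of d] cdeg_total_0[of m] by simp
      moreover have "smonom (0, {||}) 1 = 1" using Const_simps(4) by (simp add: Const_def)
      ultimately have "act (dmat (2 * pi * real l / n)) (act swapmat (smonom m 1)) = smonom m 1"
        using act_Const[of _ 1] by (simp add: Const_simps(4))
      then show ?thesis using coset_coord_dual[OF n m m] True d by simp
    next
      case False
      then have "tdeg d \<noteq> 0" using tdeg_0_iff by blast
      moreover have "cdeg 1 m = 0 \<or> cdeg 2 m = 0" using True n sum by (auto simp: rigid_def high_def balanced_def)
      ultimately have "cdeg 1 (swap_mon m) \<noteq> cdeg 1 m" using sum by (auto simp: cdeg_swap_mon)
      then have "swap_mon m \<noteq> m" by metis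
      then show ?thesis using True False unfolding eq coset_coord_Const_mult
        by (simp add: coset_coord_def rigid_def act_swapmat_smonom coeff_of_smonom)
    qed
  next
    case False
    then have rb: "m \<in> paired n d" using m by blast
    then have bal: "balanced n m" by (simp add: paired_def)
    have "cis (2 * pi * real l) = 1" by (metis cis_multiple_2pi Ints_of_nat)
    then have c: "?c = 1" using bal n by (auto simp: balanced_def cdeg_swap_mon simp flip: cis_cnj)
    have "coset_coord n m (act swapmat (smonom m 1)) = - coset_coord n m (smonom m 1)"
      using bal unfolding coset_coord_def act_swapmat_swapmat by (simp only: if_True) (metis minus_diff_eq minus_divide_left)
    then show ?thesis unfolding eq coset_coord_Const_mult c using coset_coord_dual[OF n m m] False by simp
  qed
qed

section \<open>The graded pieces of the coinvariant ring\<close>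

definition ideal_coset :: "nat \<Rightarrow> nat \<Rightarrow> nat \<Rightarrow> superpoly \<Rightarrow> superpoly set" where
  "ideal_coset n k j f = coinvariant_ideal n k j +>\<^bsub>superpoly_ring k j\<^esub> f"

lemma ideal_coset_image: "ideal_coset n k j f = (\<lambda>h. h + f) ` coinvariant_ideal n k j"
  by (auto simp: ideal_coset_def a_r_coset_def')

lemma coinvariant_ideal_diff:
  "f \<in> coinvariant_ideal n k j \<Longrightarrow> g \<in> coinvariant_ideal n k j \<Longrightarrow> f - g \<in> coinvariant_ideal n k j"
proof -
  assume f: "f \<in> coinvariant_ideal n k j" and g: "g \<in> coinvariant_ideal n k j"
  have "f + Const (-1) * g \<in> coinvariant_ideal n k j"
    by (intro coinvariant_ideal_closed(2) coinvariant_ideal_closed(3) f g SP_closed)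
  then show ?thesis by (simp add: Const_simps(4,5))
qed

lemma ideal_coset_eq_iff: "ideal_coset n k j f = ideal_coset n k j g \<longleftrightarrow> f - g \<in> coinvariant_ideal n k j"
proof
  assume "ideal_coset n k j f = ideal_coset n k j g"
  then have "0 + f \<in> ideal_coset n k j g" using coinvariant_ideal_closed(5) unfolding ideal_coset_image by blast
  then obtain h where "h \<in> coinvariant_ideal n k j" "f = h + g" by (auto simp: ideal_coset_image)
  then show "f - g \<in> coinvariant_ideal n k j" by simp
next
  assume *: "f - g \<in> coinvariant_ideal n k j"
  show "ideal_coset n k j f = ideal_coset n k j g"
  proof (intro equalityI subsetI)
    fix x assume "x \<in> ideal_coset n k j f"
    then obtain h where h: "h \<in> coinvariant_ideal n k j" "x = h + f" by (auto simp: ideal_coset_image)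
    then have "x = (h + (f - g)) + g" by simp
    then show "x \<in> ideal_coset n k j g" using coinvariant_ideal_closed(2)[OF h(1) *] unfolding ideal_coset_image by blast
  next
    fix x assume "x \<in> ideal_coset n k j g"
    then obtain h where h: "h \<in> coinvariant_ideal n k j" "x = h + g" by (auto simp: ideal_coset_image)
    then have "x = (h - (f - g)) + f" by simp
    then show "x \<in> ideal_coset n k j f" using coinvariant_ideal_diff[OF h(1) *] unfolding ideal_coset_image by blast
  qed
qed

lemma homogeneous_closed:
  "f \<in> homogeneous k j d \<Longrightarrow> g \<in> homogeneous k j d \<Longrightarrow> f + g \<in> homogeneous k j d"
  "f \<in> homogeneous k j d \<Longrightarrow> Const c * f \<in> homogeneous k j d"
  "0 \<in> homogeneous k j d"
  "f \<in> homogeneous k j d \<Longrightarrow> f \<in> SP k j"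
  by (auto simp: homogeneous_iff homog_add homog_Const_mult carrier_iff)

text \<open>
  The operations on cosets, expressed by representatives.
\<close>

lemma graded_piece_simps:
  "carrier (graded_piece n k j d) = ideal_coset n k j ` homogeneous k j d"
  "\<zero>\<^bsub>graded_piece n k j d\<^esub> = ideal_coset n k j 0"
  "f \<in> SP k j \<Longrightarrow> g \<in> SP k j \<Longrightarrow> ideal_coset n k j f \<oplus>\<^bsub>graded_piece n k j d\<^esub> ideal_coset n k j g = ideal_coset n k j (f + g)"
  "f \<in> SP k j \<Longrightarrow> c \<odot>\<^bsub>graded_piece n k j d\<^esub> ideal_coset n k j f = ideal_coset n k j (Const c * f)"
proof -
  interpret I: ideal "coinvariant_ideal n k j" "superpoly_ring k j" by (rule ideal_coinvariant_ideal)
  show "carrier (graded_piece n k j d) = ideal_coset n k j ` homogeneous k j d"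
    by (simp add: graded_piece_def Let_def ideal_coset_def)
  show "\<zero>\<^bsub>graded_piece n k j d\<^esub> = ideal_coset n k j 0"
    by (simp add: graded_piece_def Let_def coinvariant_ring_def FactRing_def ideal_coset_image)
  show "ideal_coset n k j f \<oplus>\<^bsub>graded_piece n k j d\<^esub> ideal_coset n k j g = ideal_coset n k j (f + g)" if "f \<in> SP k j" "g \<in> SP k j"
    using I.a_rcos_sum[OF that] by (simp add: graded_piece_def Let_def coinvariant_ring_def FactRing_def ideal_coset_def)
  show "c \<odot>\<^bsub>graded_piece n k j d\<^esub> ideal_coset n k j f = ideal_coset n k j (Const c * f)" if "f \<in> SP k j"
    using I.rcoset_mult_add[OF SP_closed(4)[of c] that] 
    by (simp add: graded_piece_def Let_def coinvariant_ring_def FactRing_def ideal_coset_def)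
qed

lemma vectorspace_graded_piece: "vectorspace complex_field (graded_piece n k j d)"
proof -
  let ?V = "graded_piece n k j d"
  have H: "f \<in> SP k j" if "f \<in> homogeneous k j d" for f using that by (rule homogeneous_closed)

  have "abelian_group ?V"
  proof (rule abelian_groupI)
    fix x y z assume "x \<in> carrier ?V" "y \<in> carrier ?V" "z \<in> carrier ?V"
    then obtain f g h where f: "x = ideal_coset n k j f" "f \<in> homogeneous k j d" and g: "y = ideal_coset n k j g" "g \<in> homogeneous k j d"
      and h: "z = ideal_coset n k j h" "h \<in> homogeneous k j d" by (auto simp: graded_piece_simps(1))
    note fgh = f g h H[OF f(2)] H[OF g(2)] H[OF h(2)]
    show "x \<oplus>\<^bsub>?V\<^esub> y \<in> carrier ?V"
      using fgh by (simp add: graded_piece_simps homogeneous_closed)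
    show "x \<oplus>\<^bsub>?V\<^esub> y \<oplus>\<^bsub>?V\<^esub> z = x \<oplus>\<^bsub>?V\<^esub> (y \<oplus>\<^bsub>?V\<^esub> z)"
      using fgh SP_closed(1) by (simp add: graded_piece_simps add.assoc)
    show "x \<oplus>\<^bsub>?V\<^esub> y = y \<oplus>\<^bsub>?V\<^esub> x"
      using fgh by (simp add: graded_piece_simps add.commute)
    show "\<zero>\<^bsub>?V\<^esub> \<oplus>\<^bsub>?V\<^esub> x = x"
      using fgh SP_closed(5) by (simp add: graded_piece_simps)
    have "Const (-1) * f + f = 0" by (simp add: Const_simps(4,5))
    then have "ideal_coset n k j (Const (-1) * f) \<oplus>\<^bsub>?V\<^esub> x = \<zero>\<^bsub>?V\<^esub>"
      using fgh SP_closed(3,4) by (simp add: graded_piece_simps)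
    moreover have "ideal_coset n k j (Const (-1) * f) \<in> carrier ?V"
      using homogeneous_closed(2)[OF f(2)] by (simp add: graded_piece_simps)
    ultimately show "\<exists>y\<in>carrier ?V. y \<oplus>\<^bsub>?V\<^esub> x = \<zero>\<^bsub>?V\<^esub>" by blast
  qed (simp add: graded_piece_simps homogeneous_closed)
  moreover have f: "field complex_field" by (rule field_from_type_algebra)
  ultimately have "module complex_field ?V"
  proof (intro moduleI)
    show "cring complex_field" using f by (simp add: field_def domain_def)
    fix a b x y assume "x \<in> carrier ?V" "y \<in> carrier ?V"
    then obtain f g where f: "x = ideal_coset n k j f" "f \<in> homogeneous k j d" and g: "y = ideal_coset n k j g" "g \<in> homogeneous k j d"
      by (auto simp: graded_piece_simps(1))
    note fg = f g H[OF f(2)] H[OF g(2)]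
    have C: "Const c * f \<in> SP k j" "Const c * g \<in> SP k j" for c using fg by blast+
    show "a \<odot>\<^bsub>?V\<^esub> (x \<oplus>\<^bsub>?V\<^esub> y) = a \<odot>\<^bsub>?V\<^esub> x \<oplus>\<^bsub>?V\<^esub> a \<odot>\<^bsub>?V\<^esub> y"
      using fg C SP_closed(1) by (simp add: graded_piece_simps distrib_left)
  next
    fix a b x assume "x \<in> carrier ?V"
    then obtain f where f: "x = ideal_coset n k j f" "f \<in> homogeneous k j d"
      by (auto simp: graded_piece_simps(1))
    note f = f H[OF f(2)]
    have C: "Const c * f \<in> SP k j" for c using f by blast
    show "a \<odot>\<^bsub>?V\<^esub> x \<in> carrier ?V"
      using f by (simp add: graded_piece_simps homogeneous_closed)
    show "(a \<oplus>\<^bsub>complex_field\<^esub> b) \<odot>\<^bsub>?V\<^esub> x = a \<odot>\<^bsub>?V\<^esub> x \<oplus>\<^bsub>?V\<^esub> b \<odot>\<^bsub>?V\<^esub> x"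
      using f C by (simp add: graded_piece_simps distrib_right Const_simps(1))
    show "(a \<otimes>\<^bsub>complex_field\<^esub> b) \<odot>\<^bsub>?V\<^esub> x = a \<odot>\<^bsub>?V\<^esub> (b \<odot>\<^bsub>?V\<^esub> x)"
      using f C by (simp add: graded_piece_simps Const_Const)
    show "\<one>\<^bsub>complex_field\<^esub> \<odot>\<^bsub>?V\<^esub> x = x"
      using f by (simp add: graded_piece_simps Const_simps(4))
  qed auto
  then show ?thesis using f by (simp add: vectorspace_def)
qed

lemma eigen_ideal_act_dmat:
  assumes n: "n \<ge> 2" and h: "h \<in> eigen_ideal n k j"
  shows "act (dmat (2 * pi / n)) h \<in> eigen_ideal n k j" "act (dmat (- (2 * pi / n))) h \<in> eigen_ideal n k j" "act swapmat h \<in> eigen_ideal n k j"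
proof -
  obtain q where q: "q \<in> eigen_invariants n" "q \<in> SP k j" "h \<in> SP k j" "\<forall>m\<in>monoms (h - q). high n m"
    using h unfolding eigen_ideal_def by blast
  have *: "act g h \<in> eigen_ideal n k j" if "act g q = q" "\<And>m. m \<in> monoms (act g (h - q)) \<Longrightarrow> high n m" for g
    using that q act_carrier[OF q(3), of g] unfolding eigen_ideal_def by (auto simp: act_minus)
  have d: "act (dmat (2 * pi / n)) q = q" "act swapmat q = q" using q(1) by (simp_all add: eigen_invariants_def)
  have "act (dmat (- (2 * pi / n))) (act (dmat (2 * pi / n)) q) = q"
    by (simp add: dmat_simps act_id flip: act_compose)
  then have d': "act (dmat (- (2 * pi / n))) q = q" using d by simp
  have "high n m" if "m \<in> monoms (act (dmat t) (h - q))" for t m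
    using that q(4) by (simp add: in_monoms_iff coeff_of_act_dmat)
  then show "act (dmat (2 * pi / n)) h \<in> eigen_ideal n k j" "act (dmat (- (2 * pi / n))) h \<in> eigen_ideal n k j"
    using * d d' by blast+
  have "high n m" if "m \<in> monoms (act swapmat (h - q))" for m
    using that q(4) high_swap_mon[of n m] by (auto simp: in_monoms_iff coeff_of_act_swapmat simp del: coeff_of_simps)
  then show "act swapmat h \<in> eigen_ideal n k j" using * d by blast
qed

text \<open>
  The group elements and their inverses preserve the candidate ideal, as they preserve high monomials and fix
  invariants. Both directions are needed because the action on cosets is by images of sets.
\<close>

lemma act_image_ideal:
  assumes n: "n \<ge> 2" and g: "g \<in> carrier (dihedral n)"
  shows "act g ` coinvariant_ideal n k j = coinvariant_ideal n k j"
proof -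
  let ?I = "coinvariant_ideal n k j"
  have conv: "act A f \<in> ?I" if "f \<in> ?I" "Pinv ** A = B ** Pinv" "\<And>h. h \<in> eigen_ideal n k j \<Longrightarrow> act B h \<in> eigen_ideal n k j" for A B f
  proof -
    have "act Pinv (act A f) = act B (act Pinv f)" using that(2) by (simp flip: act_compose)
    then show ?thesis using that by (simp add: coinvariant_ideal_iff[OF n])
  qed
  have step: "act (rot (2 * pi / n)) f \<in> ?I" "act (rot (- (2 * pi / n))) f \<in> ?I" "act phi f \<in> ?I" if "f \<in> ?I" for f
    using conv[OF that Pinv_rot] conv[OF that Pinv_phi] eigen_ideal_act_dmat[OF n] by blast+
  have pow: "act (rot (2 * pi * real l / n)) f \<in> ?I \<and> act (rot (- (2 * pi * real l / n))) f \<in> ?I" if f: "f \<in> ?I" for f l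
  proof (induction l)
    case 0
    show ?case using f by (simp add: rot_0 act_id)
  next
    case (Suc l)
    have "rot (2 * pi * real (Suc l) / n) = rot (2 * pi / n) ** rot (2 * pi * real l / n)"
      "rot (- (2 * pi * real (Suc l) / n)) = rot (- (2 * pi / n)) ** rot (- (2 * pi * real l / n))"
      by (simp_all add: rot_add add_divide_distrib ring_distribs)
    then show ?case using Suc step by (simp add: act_compose)
  qed
  have bij: "act A ` ?I = ?I" if "\<And>f. f \<in> ?I \<Longrightarrow> act A f \<in> ?I" "\<And>f. f \<in> ?I \<Longrightarrow> act B f \<in> ?I" "A ** B = mat 1" for A B
  proof
    show "?I \<subseteq> act A ` ?I"
    proof
      fix f assume "f \<in> ?I"
      then have "act B f \<in> ?I" "f = act A (act B f)" using that by (simp_all add: act_id flip: act_compose)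
      then show "f \<in> act A ` ?I" by blast
    qed
  qed (use that in blast)
  obtain l :: nat where "g = rot (2 * pi * l / n) \<or> g = rot (2 * pi * l / n) ** phi"
    using g n by (elim dihedral_elements[rotated]) auto
  moreover have "act (rot (2 * pi * l / n)) ` ?I = ?I"
    by (rule bij[of _ "rot (- (2 * pi * l / n))"]) (use pow in \<open>auto simp: rot_add rot_0\<close>)
  moreover have "act phi ` ?I = ?I"
    by (rule bij[of _ phi]) (use step in \<open>auto simp: phi_phi\<close>)
  moreover have "act (rot (2 * pi * l / n) ** phi) ` ?I = act (rot (2 * pi * l / n)) ` (act phi ` ?I)"
    by (simp add: act_compose image_image)
  ultimately show ?thesis by metis
qed

lemma act_image_ideal_coset:
  assumes "n \<ge> 2" "g \<in> carrier (dihedral n)"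
  shows "act g ` ideal_coset n k j f = ideal_coset n k j (act g f)"
proof -
  have "act g ` ideal_coset n k j f = (\<lambda>h. h + act g f) ` (act g ` coinvariant_ideal n k j)"
    by (simp add: ideal_coset_image image_image act_add)
  then show ?thesis using act_image_ideal[OF assms] by (simp add: ideal_coset_image)
qed

text \<open>
  If \<open>d\<close> involves variables outside \<open>S\<close>, the graded piece is zero.
\<close>

definition basis_index :: "nat \<Rightarrow> nat \<Rightarrow> nat \<Rightarrow> multidegree \<Rightarrow> smon set" where
  "basis_index n k j d = (if \<forall>a\<in>Poly_Mapping.keys d. valid k j a then rigid n d \<union> paired n d else {})"

text \<open>
  The classes of the monomials in \<open>basis_index\<close>, with the coordinates \<open>coset_coord\<close>, form a dual basis. The
  coordinates are well defined on cosets because they vanish on the ideal.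
\<close>

theorem char_series_eq_sum:
  assumes n: "n \<ge> 2" and g: "g \<in> carrier (dihedral n)" and fin: "finite (rigid n d \<union> paired n d)"
  shows "char_series n k j g d = (\<Sum>m\<in>basis_index n k j d. coset_coord n m (act Pinv (act g (act Pmat (smonom m 1)))))"
proof -
  let ?V = "graded_piece n k j d" and ?J = "basis_index n k j d"
  define F where "F = (\<lambda>m Y. coset_coord n m (act Pinv (SOME f. f \<in> SP k j \<and> Y = ideal_coset n k j f)))"
  define E where "E = (\<lambda>m. ideal_coset n k j (act Pmat (smonom m 1)))"
  have J: "m \<in> rigid n d \<union> paired n d" "\<not> high n m" "has_multidegree d m" if "m \<in> ?J" for m
    using that balanced_not_high[OF n, of m] by (auto simp: basis_index_def rigid_def paired_def split: if_splits)
  have F: "F m (ideal_coset n k j f) = coset_coord n m (act Pinv f)" if f: "f \<in> SP k j" and m: "m \<in> ?J" for f m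
  proof -
    let ?f = "SOME x. x \<in> SP k j \<and> ideal_coset n k j f = ideal_coset n k j x"
    have "?f \<in> SP k j \<and> ideal_coset n k j f = ideal_coset n k j ?f" by (rule someI[of _ f]) (simp add: f)
    then have "act Pinv (f - ?f) \<in> eigen_ideal n k j" by (simp add: ideal_coset_eq_iff coinvariant_ideal_iff[OF n])
    then have "coset_coord n m (act Pinv (f - ?f)) = 0" by (rule coset_coord_eigen_ideal[OF n _ J(2)[OF m]])
    moreover have "coset_coord n m (act Pinv f) = coset_coord n m (act Pinv (f - ?f)) + coset_coord n m (act Pinv ?f)"
      by (simp flip: coset_coord_add act_add)
    ultimately show ?thesis by (simp add: F_def)
  qed
  have E_hom: "act Pmat (smonom m 1) \<in> homogeneous k j d" if m: "m \<in> ?J" for m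
  proof (rule act_homogeneous)
    have "\<forall>a\<in>Poly_Mapping.keys d. valid k j a" using m by (auto simp: basis_index_def split: if_splits)
    then have "wdeg (outw k j) m = 0" using multidegree_outw_iff[OF J(3)[OF m]] by blast
    then show "smonom m 1 \<in> homogeneous k j d"
      using J(3)[OF m] by (simp add: homogeneous_iff homog_smonom has_multidegree_iff)
  qed
  have FE: "F m (E m') = (if m = m' then 1 else 0)" if "m \<in> ?J" "m' \<in> ?J" for m m'
    using F[OF homogeneous_closed(4)[OF E_hom[OF that(2)]] that(1)] coset_coord_dual[OF n J(1)[OF that(1)] J(1)[OF that(2)]]
    by (simp add: E_def)
  have inj: "inj_on E ?J"
  proof (rule inj_onI)
    fix m m' assume "m \<in> ?J" "m' \<in> ?J" "E m = E m'"
    then show "m = m'" using FE[of m m] FE[of m m'] by (simp split: if_splits)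
  qed
  have finJ: "finite ?J" using fin by (simp add: basis_index_def)
  define L where "L = (\<lambda>b. F (the_inv_into ?J E b))"
  have LE: "L (E m) = F m" if "m \<in> ?J" for m using the_inv_into_f_f[OF inj that] by (simp add: L_def)
  interpret dual_basis ?V "E ` ?J" L
  proof (intro dual_basis.intro dual_basis_axioms.intro vectorspace_graded_piece)
    show "finite (E ` ?J)" using finJ by simp
    show "E ` ?J \<subseteq> carrier ?V" using E_hom by (auto simp: graded_piece_simps E_def)
    fix b assume "b \<in> E ` ?J"
    then obtain m where m: "m \<in> ?J" "b = E m" by blast
    show "L b (v \<oplus>\<^bsub>?V\<^esub> w) = L b v + L b w" if vw: "v \<in> carrier ?V" "w \<in> carrier ?V" for v w
    proof -
      obtain f h where "v = ideal_coset n k j f" "f \<in> SP k j" "w = ideal_coset n k j h" "h \<in> SP k j"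
        using vw homogeneous_closed(4) by (auto simp: graded_piece_simps(1))
      then show ?thesis using m SP_closed(1) by (simp add: LE graded_piece_simps F act_add coset_coord_add)
    qed
    show "L b (c \<odot>\<^bsub>?V\<^esub> v) = c * L b v" if v: "v \<in> carrier ?V" for c v
    proof -
      obtain f where "v = ideal_coset n k j f" "f \<in> SP k j"
        using v homogeneous_closed(4) by (auto simp: graded_piece_simps(1))
      then show ?thesis using m SP_closed(3,4) by (simp add: LE graded_piece_simps F act_mult coset_coord_Const_mult)
    qed
    show "L b b' = (if b = b' then 1 else 0)" if b': "b' \<in> E ` ?J" for b'
    proof -
      obtain m' where m': "m' \<in> ?J" "b' = E m'" using b' by blast
      then show ?thesis using m FE inj by (auto simp: LE inj_on_eq_iff)
    qed
  next
    fix v assume v: "v \<in> carrier ?V" and L0: "\<And>b. b \<in> E ` ?J \<Longrightarrow> L b v = 0"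
    obtain f where f: "v = ideal_coset n k j f" "f \<in> homogeneous k j d" using v by (auto simp: graded_piece_simps(1))
    have "f \<in> coinvariant_ideal n k j"
    proof (cases "\<forall>a\<in>Poly_Mapping.keys d. valid k j a")
      case True
      have "coset_coord n m (act Pinv f) = 0" if "m \<in> rigid n d \<union> paired n d" for m
      proof -
        have m: "m \<in> ?J" using that True by (simp add: basis_index_def)
        then show ?thesis using L0[of "E m"] F[OF homogeneous_closed(4)[OF f(2)] m] by (simp add: LE f(1))
      qed
      then have "act Pinv f \<in> eigen_ideal n k j" by (intro coset_coord_separating[OF n act_homogeneous[OF f(2)]])
      then show ?thesis by (simp add: coinvariant_ideal_iff[OF n])
    next
      case False
      have "monoms f = {}"
      proof (rule ccontr)
        assume "monoms f \<noteq> {}"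
        then obtain m where m: "m \<in> monoms f" by blast
        then have "has_multidegree d m" "wdeg (outw k j) m = 0"
          using f(2) by (auto simp: homogeneous_def carrier_iff homog_def)
        then show False using multidegree_outw_iff False by blast
      qed
      then have "f = 0" using superpoly_expand[of f] by simp
      then show ?thesis by (simp add: coinvariant_ideal_closed)
    qed
    then show "v = \<zero>\<^bsub>?V\<^esub>" by (simp add: graded_piece_simps f(1) ideal_coset_eq_iff)
  qed
  note T = act_image_ideal_coset[OF n g]
  have "char_series n k j g d = (\<Sum>b\<in>E ` ?J. L b (act g ` b))"
    unfolding char_series_def
  proof (rule endo_trace_eq)
    fix v w c assume "v \<in> carrier ?V" "w \<in> carrier ?V"
    then obtain f h where fh: "v = ideal_coset n k j f" "f \<in> homogeneous k j d" "w = ideal_coset n k j h" "h \<in> homogeneous k j d"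
      by (auto simp: graded_piece_simps(1))
    then have S: "f \<in> SP k j" "h \<in> SP k j" using homogeneous_closed(4) by blast+
    show "act g ` (v \<oplus>\<^bsub>?V\<^esub> w) = act g ` v \<oplus>\<^bsub>?V\<^esub> act g ` w"
      using S act_carrier by (simp add: fh graded_piece_simps T act_add)
  next
    fix v c assume "v \<in> carrier ?V"
    then obtain f where f: "v = ideal_coset n k j f" "f \<in> homogeneous k j d" by (auto simp: graded_piece_simps(1))
    then have S: "f \<in> SP k j" using homogeneous_closed(4) by blast
    show "act g ` v \<in> carrier ?V" using act_homogeneous f by (auto simp: graded_piece_simps T)
    show "act g ` (c \<odot>\<^bsub>?V\<^esub> v) = c \<odot>\<^bsub>?V\<^esub> act g ` v"
      using S act_carrier by (simp add: f graded_piece_simps T act_mult)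
  qed
  also have "\<dots> = (\<Sum>m\<in>?J. F m (act g ` E m))"
    by (subst sum.reindex[OF inj]) (auto simp: LE intro!: sum.cong)
  also have "\<dots> = (\<Sum>m\<in>?J. coset_coord n m (act Pinv (act g (act Pmat (smonom m 1)))))"
  proof (rule sum.cong)
    fix m assume m: "m \<in> ?J"
    then have "act g (act Pmat (smonom m 1)) \<in> SP k j"
      using act_homogeneous[OF E_hom[OF m]] homogeneous_closed(4) by blast
    then show "F m (act g ` E m) = coset_coord n m (act Pinv (act g (act Pmat (smonom m 1))))"
      using m by (simp add: E_def T F)
  qed simp
  finally show ?thesis .
qed

section \<open>The character series\<close>

lemma lookup_mult_qu_const: "Poly_Mapping.lookup (f * qu_const c) d = Poly_Mapping.lookup f d * c"
proof (induction f rule: poly_mapping_add_induct)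
  case (single m x)
  show ?case by (simp add: qu_const_def mult_single lookup_single when_def)
qed (simp add: distrib_right lookup_add)

lemma lookup_qu_const: "Poly_Mapping.lookup (qu_const c) d = (if d = 0 then c else 0)"
  by (auto simp: qu_const_def lookup_single when_def)

lemma valid_keys_iff:
  "(\<forall>a\<in>Poly_Mapping.keys d. valid k j a) \<longleftrightarrow> Poly_Mapping.keys d \<subseteq> Inl ` {..<k} \<union> Inr ` {..<j}"
proof -
  have "valid k j a \<longleftrightarrow> a \<in> Inl ` {..<k} \<union> Inr ` {..<j}" for a
    by (cases a) (auto simp: valid_def)
  then show ?thesis by blast
qed

lemma letter_counts_eq_tdeg:
  assumes "Poly_Mapping.keys d \<subseteq> Inl ` {..<k} \<union> Inr ` {..<j}"
  shows "letter_count Inl k d + letter_count Inr j d = tdeg d"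
proof -
  have "tdeg d = (\<Sum>a\<in>Inl ` {..<k} \<union> Inr ` {..<j}. Poly_Mapping.lookup d a)"
    unfolding tdeg_def by (rule sum.mono_neutral_left) (use assms in \<open>auto simp: in_keys_iff\<close>)
  also have "\<dots> = (\<Sum>a\<in>Inl ` {..<k}. Poly_Mapping.lookup d a) + (\<Sum>a\<in>Inr ` {..<j}. Poly_Mapping.lookup d a)"
    by (rule sum.union_disjoint) auto
  finally show ?thesis by (simp add: letter_count_def sum.reindex)
qed

definition row_coeff :: "nat \<Rightarrow> nat \<Rightarrow> nat \<Rightarrow> multidegree \<Rightarrow> complex" where
  "row_coeff k j m d = (if (\<forall>a\<in>Poly_Mapping.keys d. valid k j a) \<and> fermion_free_of_squares d \<and> tdeg d = m then 1 else 0)"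

lemma lookup_super_schur_row': "Poly_Mapping.lookup (super_schur k j [m]) d = row_coeff k j m d"
  unfolding lookup_super_schur_row row_coeff_def valid_keys_iff
  by (rule if_cong) (use letter_counts_eq_tdeg in auto)

lemma lookup_super_schur_11:
  "Poly_Mapping.lookup (super_schur k j [1, 1]) d =
    (if (\<forall>a\<in>Poly_Mapping.keys d. valid k j a) \<and> boson_free_of_squares d \<and> tdeg d = 2 then 1 else 0)"
proof -
  have "[1, 1] = replicate 2 (1::nat)" by (simp add: numeral_2_eq_2)
  then show ?thesis unfolding valid_keys_iff
    by (simp only: lookup_super_schur_column) (rule if_cong, use letter_counts_eq_tdeg in auto)
qed

text \<open>
  For \<open>0 < N < n\<close> exactly one of \<open>2 N < n\<close>, \<open>2 N > n\<close>, \<open>2 N = n\<close> holds, and the corresponding one of the three groups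
  of terms contributes \<open>F N\<close>.
\<close>

lemma sum_two_dimensional_characters:
  fixes F :: "nat \<Rightarrow> complex" and N n :: nat
  assumes n: "n \<ge> 2" and F: "\<And>i. i \<le> n \<Longrightarrow> F (n - i) = F i"
  shows "(\<Sum>i = 1..(n - 1) div 2. ((if N = i then 1 else 0) + (if N = n - i then 1 else 0)) * F i)
     + (if even n then (if N = n div 2 then 1 else 0) * F (n div 2) else 0)
     = (if 0 < N \<and> N < n then F N else 0)"
proof -
  let ?h = "(n - 1) div 2"
  have 1: "(\<Sum>i = 1..?h. if N = i then F i else 0) = (if N \<in> {1..?h} then F N else 0)"
    by (rule sum.delta') simp
  have "(\<Sum>i = 1..?h. if N = n - i then F i else 0) = (\<Sum>i = 1..?h. if n - N = i then F i else 0)"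
  proof (rule sum.cong)
    fix i assume "i \<in> {1..?h}"
    then have "i < n" "0 < i" by auto
    then have "N = n - i \<longleftrightarrow> n - N = i" by auto
    then show "(if N = n - i then F i else 0) = (if n - N = i then F i else 0)" by simp
  qed simp
  also have "\<dots> = (if n - N \<in> {1..?h} then F (n - N) else 0)" by (rule sum.delta') simp
  finally have 2: "(\<Sum>i = 1..?h. if N = n - i then F i else 0) = (if n - N \<in> {1..?h} then F N else 0)"
    using F[of N] by auto
  have "(\<Sum>i = 1..?h. ((if N = i then 1 else 0) + (if N = n - i then 1 else 0)) * F i)
     = (\<Sum>i = 1..?h. if N = i then F i else 0) + (\<Sum>i = 1..?h. if N = n - i then F i else 0)"
    unfolding sum.distrib[symmetric] by (rule sum.cong) auto
  also have "\<dots> = (if N \<in> {1..?h} then F N else 0) + (if n - N \<in> {1..?h} then F N else 0)"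
    unfolding 1 2 ..
  finally have sum: "(\<Sum>i = 1..?h. ((if N = i then 1 else 0) + (if N = n - i then 1 else 0)) * F i)
     = (if N \<in> {1..?h} then F N else 0) + (if n - N \<in> {1..?h} then F N else 0)" .
  have "N \<in> {1..?h} \<longleftrightarrow> 0 < N \<and> 2 * N < n" "n - N \<in> {1..?h} \<longleftrightarrow> N < n \<and> n < 2 * N"
    using n by auto
  moreover have "(if even n then (if N = n div 2 then 1 else 0) * F (n div 2) else 0) = (if 2 * N = n then F N else 0)"
    by (cases "2 * N = n") (use n in auto)
  ultimately have "(\<Sum>i = 1..?h. ((if N = i then 1 else 0) + (if N = n - i then 1 else 0)) * F i)
     + (if even n then (if N = n div 2 then 1 else 0) * F (n div 2) else 0)
     = (if 0 < N \<and> 2 * N < n then F N else 0) + (if N < n \<and> n < 2 * N then F N else 0) + (if 2 * N = n then F N else 0)"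
    unfolding sum by (simp only:)
  also have "\<dots> = (if 0 < N \<and> N < n then F N else 0)"
    using n by (cases "2 * N < n"; cases "2 * N = n") auto
  finally show ?thesis .
qed

theorem theorem1p1:
  fixes n k j :: nat and g :: "complex^2^2"
  assumes "n \<ge> 2" and "g \<in> carrier (dihedral n)"
  shows "char_series n k j g = Poly_Mapping.lookup
    (qu_const (chi1 n g)
      + super_schur k j [1, 1] * qu_const (chi2 n g)
      + super_schur k j [n] * qu_const (chi2 n g)
      + (\<Sum>i = 1..(n - 1) div 2.
           (super_schur k j [i] + super_schur k j [n - i]) * qu_const (chi_dim2 n i g))
      + (if even n then super_schur k j [n div 2] * qu_const (chi3 n g + chi4 n g) else 0))"
proof
  fix d
  note n = assms(1)
  define N where "N = tdeg d"
  define v where "v \<longleftrightarrow> (\<forall>a\<in>Poly_Mapping.keys d. valid k j a)"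
  define fs where "fs \<longleftrightarrow> fermion_free_of_squares d"
  define bs where "bs \<longleftrightarrow> boson_free_of_squares d"
  have fin: "finite (rigid n d \<union> paired n d)" using card_paired(2)[OF n] by (simp add: rigid_eq[OF n])
  have disj: "rigid n d \<inter> paired n d = {}" by (auto simp: rigid_def paired_def)
  have d0: "d = 0 \<longleftrightarrow> N = 0" by (simp add: N_def tdeg_0_iff)
  have v0: "v \<and> fs" if "N = 0" using that by (simp add: d0[symmetric] v_def fs_def)
  have row: "row_coeff k j m d = (if v \<and> fs then if N = m then 1 else 0 else 0)" for m
    by (auto simp: row_coeff_def v_def fs_def N_def)
  have rhs: "Poly_Mapping.lookup
    (qu_const (chi1 n g)
      + super_schur k j [1, 1] * qu_const (chi2 n g)
      + super_schur k j [n] * qu_const (chi2 n g)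
      + (\<Sum>i = 1..(n - 1) div 2.
           (super_schur k j [i] + super_schur k j [n - i]) * qu_const (chi_dim2 n i g))
      + (if even n then super_schur k j [n div 2] * qu_const (chi3 n g + chi4 n g) else 0)) d
    = (if N = 0 then chi1 n g else 0) + (if v \<and> bs \<and> N = 2 then 1 else 0) * chi2 n g
      + (if v \<and> fs \<and> N = n then 1 else 0) * chi2 n g + (if v \<and> fs \<and> 0 < N \<and> N < n then F N else 0)"
    if F: "\<And>i. i \<le> n \<Longrightarrow> F (n - i) = F i" and chi: "\<And>i. chi_dim2 n i g = F i" 
      "even n \<Longrightarrow> chi3 n g + chi4 n g = F (n div 2)" for F
  proof -
    have "(\<Sum>i = 1..(n - 1) div 2. (row_coeff k j i d + row_coeff k j (n - i) d) * F i)
      + (if even n then row_coeff k j (n div 2) d * F (n div 2) else 0) 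
      = (if v \<and> fs \<and> 0 < N \<and> N < n then F N else 0)"
    proof (cases "v \<and> fs")
      case True
      then show ?thesis using sum_two_dimensional_characters[of n F N, OF n F] by (simp only: row True[THEN conjunct1] True[THEN conjunct2] simp_thms if_True)
    next
      case False
      then show ?thesis by (auto simp: row)
    qed
    moreover have "Poly_Mapping.lookup (if even n then super_schur k j [n div 2] * qu_const (chi3 n g + chi4 n g) else 0) d
      = (if even n then row_coeff k j (n div 2) d * F (n div 2) else 0)"
      by (simp add: lookup_mult_qu_const lookup_super_schur_row' chi)
    moreover have "Poly_Mapping.lookup (\<Sum>i = 1..(n - 1) div 2.
           (super_schur k j [i] + super_schur k j [n - i]) * qu_const (chi_dim2 n i g)) d
      = (\<Sum>i = 1..(n - 1) div 2. (row_coeff k j i d + row_coeff k j (n - i) d) * F i)"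
      by (simp add: lookup_sum lookup_mult_qu_const lookup_add lookup_super_schur_row' chi)
    moreover have "row_coeff k j n d = (if v \<and> fs \<and> N = n then 1 else 0)" by (auto simp: row)
    ultimately show ?thesis
      by (simp only: lookup_add lookup_mult_qu_const lookup_qu_const lookup_super_schur_11 lookup_super_schur_row'
          d0 v_def[symmetric] bs_def[symmetric] N_def[symmetric] add.assoc)
  qed
  have cards: "(of_nat (card (paired n d)) :: complex) = (if fs \<and> N = n then 1 else 0) + (if bs \<and> N = 2 then 1 else 0)"
    unfolding card_paired(1)[OF n] fs_def bs_def N_def by simp
  have split: "char_series n k j g d = (if v then (\<Sum>m\<in>rigid n d. T m) + of_nat (card (paired n d)) * c else 0)"
    if "\<And>m. m \<in> rigid n d \<Longrightarrow> coset_coord n m (act Pinv (act g (act Pmat (smonom m 1)))) = T m"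
      "\<And>m. m \<in> paired n d \<Longrightarrow> coset_coord n m (act Pinv (act g (act Pmat (smonom m 1)))) = c" for T c
  proof -
    have "(\<Sum>m\<in>rigid n d \<union> paired n d. coset_coord n m (act Pinv (act g (act Pmat (smonom m 1))))) = (\<Sum>m\<in>rigid n d. T m) + of_nat (card (paired n d)) * c"
      using fin disj that by (simp add: sum.union_disjoint)
    then show ?thesis unfolding char_series_eq_sum[OF assms fin] basis_index_def v_def[symmetric] by simp
  qed
  obtain l :: nat where "g = rot (2 * pi * l / n) \<or> g = rot (2 * pi * l / n) ** phi"
    using n by (elim dihedral_elements[OF _ assms(2), rotated]) simp
  then show "char_series n k j g d = Poly_Mapping.lookup
    (qu_const (chi1 n g)
      + super_schur k j [1, 1] * qu_const (chi2 n g)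
      + super_schur k j [n] * qu_const (chi2 n g)
      + (\<Sum>i = 1..(n - 1) div 2.
           (super_schur k j [i] + super_schur k j [n - i]) * qu_const (chi_dim2 n i g))
      + (if even n then super_schur k j [n div 2] * qu_const (chi3 n g + chi4 n g) else 0)) d"
  proof
    assume g: "g = rot (2 * pi * l / n)"
    define F where "F = (\<lambda>i::nat. 2 * complex_of_real (cos (2 * pi * real l * real i / n)))"
    have F: "F (n - i) = F i" if "i \<le> n" for i
    proof -
      have "2 * pi * real l * real (n - i) / n = - (2 * pi * real l * real i / n) + 2 * pi * real l"
        using that n by (simp add: field_simps of_nat_diff)
      moreover have "cis (2 * pi * real l) = 1" by (metis cis_multiple_2pi Ints_of_nat)
      then have "cos (2 * pi * real l) = 1" "sin (2 * pi * real l) = 0"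
        by (simp_all only: complex_eq_iff cis.sel one_complex.sel)
      then have "cos (x + 2 * pi * real l) = cos x" for x
        by (simp add: cos_add)
      ultimately show ?thesis unfolding F_def by (simp only: cos_minus)
    qed
    have a: "act Pinv (act g (act Pmat f)) = act (dmat (2 * pi * real l / n)) f" for f
    proof -
      have "act g (act Pmat f) = act (rot (2 * pi * l / n) ** Pmat) f" by (simp only: g act_compose)
      then show ?thesis by (simp only: rot_Pmat act_compose act_Pmat_Pinv)
    qed
    have lhs: "char_series n k j g d = (if v then (if fs \<and> N < n then if N = 0 then 1 else F N else 0) + of_nat (card (paired n d)) else 0)"
    proof -
      have "char_series n k j g d = (if v then (\<Sum>m\<in>rigid n d. cis (2 * pi * real l / n * (real (cdeg 2 m) - real (cdeg 1 m))))
          + of_nat (card (paired n d)) * 1 else 0)"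
      proof (rule split)
        fix m assume "m \<in> rigid n d"
        then show "coset_coord n m (act Pinv (act g (act Pmat (smonom m 1)))) = cis (2 * pi * real l / n * (real (cdeg 2 m) - real (cdeg 1 m)))"
          using trace_terms_rot[OF n, of m d l] unfolding a by simp
      next
        fix m assume "m \<in> paired n d"
        moreover from this have "m \<notin> rigid n d" using disj by blast
        ultimately show "coset_coord n m (act Pinv (act g (act Pmat (smonom m 1)))) = 1"
          using trace_terms_rot[OF n, of m d l] unfolding a by simp
      qed
      then show ?thesis
        unfolding sum_rigid[OF n] d0 fs_def[symmetric] N_def[symmetric] by (simp add: F_def)
    qed
    have chi: "chi1 n g = 1" "chi2 n g = 1" "chi_dim2 n i g = F i" "even n \<Longrightarrow> chi3 n g + chi4 n g = F (n div 2)" for i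
      using n by (simp_all add: g F_def chi1_values chi2_values chi_dim2_values chi34_values)
    have "(if v then (if fs \<and> N < n then if N = 0 then 1 else x else 0)
          + ((if fs \<and> N = n then 1 else 0) + (if bs \<and> N = 2 then 1 else 0)) else 0)
        = (if N = 0 then 1 else 0) + (if v \<and> bs \<and> N = 2 then 1 else 0) * 1
          + (if v \<and> fs \<and> N = n then 1 else 0) * 1 + (if v \<and> fs \<and> 0 < N \<and> N < n then x else 0)" for x :: complex
      using v0 n by (cases v; cases fs; cases bs; cases "N = 0"; cases "N < n") simp_all
    then have "char_series n k j g d = (if N = 0 then chi1 n g else 0) + (if v \<and> bs \<and> N = 2 then 1 else 0) * chi2 n g
      + (if v \<and> fs \<and> N = n then 1 else 0) * chi2 n g + (if v \<and> fs \<and> 0 < N \<and> N < n then F N else 0)"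
      unfolding lhs cards chi(1,2) .
    also note rhs[of F, OF F chi(3,4), symmetric]
    finally show ?thesis by blast
  next
    assume g: "g = rot (2 * pi * l / n) ** phi"
    have a: "act Pinv (act g (act Pmat f)) = act (dmat (2 * pi * real l / n)) (act swapmat f)" for f
    proof -
      have "act g (act Pmat f) = act (rot (2 * pi * l / n)) (act (phi ** Pmat) f)" by (simp add: g act_compose)
      also have "\<dots> = act (rot (2 * pi * l / n) ** Pmat) (act swapmat f)" by (simp add: phi_Pmat act_compose)
      finally show ?thesis by (simp add: rot_Pmat act_compose)
    qed
    have "(\<Sum>m\<in>rigid n d. if d = 0 then 1 else 0 :: complex) = (if N = 0 then 1 else 0)"
    proof (cases "d = 0")
      case True
      then have "fermion_free_of_squares d \<and> tdeg d < n" using n by (simp add: tdeg_def)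
      then have "(\<Sum>m\<in>rigid n d. 1 :: complex) = 1" using sum_rigid[OF n, of 0 d] True by simp
      then show ?thesis using True d0 by simp
    qed (simp add: d0)
    note nb = this
    have lhs: "char_series n k j g d = (if v then (if N = 0 then 1 else 0) - of_nat (card (paired n d)) else 0)"
    proof -
      have "char_series n k j g d = (if v then (\<Sum>m\<in>rigid n d. if d = 0 then 1 else 0) + of_nat (card (paired n d)) * (-1) else 0)"
      proof (rule split)
        fix m assume "m \<in> rigid n d"
        then show "coset_coord n m (act Pinv (act g (act Pmat (smonom m 1)))) = (if d = 0 then 1 else 0)"
          using trace_terms_reflection[OF n, of m d l] unfolding a by simp
      next
        fix m assume "m \<in> paired n d"
        moreover from this have "m \<notin> rigid n d" using disj by blast
        ultimately show "coset_coord n m (act Pinv (act g (act Pmat (smonom m 1)))) = -1"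
          using trace_terms_reflection[OF n, of m d l] unfolding a by simp
      qed
      then show ?thesis using nb by simp
    qed
    have chi: "chi1 n g = 1" "chi2 n g = -1" "chi_dim2 n i g = (\<lambda>_. 0) i" "even n \<Longrightarrow> chi3 n g + chi4 n g = (\<lambda>_. 0) (n div 2)" for i
      using n by (simp_all add: g chi1_values chi2_values chi_dim2_values chi34_values)
    have "(if v then (if N = 0 then 1 else 0)
          - ((if fs \<and> N = n then 1 else 0) + (if bs \<and> N = 2 then 1 else 0)) else 0)
        = (if N = 0 then 1 else 0) + (if v \<and> bs \<and> N = 2 then 1 else 0) * (- 1)
          + (if v \<and> fs \<and> N = n then 1 else 0) * (- 1) + (if v \<and> fs \<and> 0 < N \<and> N < n then 0 else (0 :: complex))"
      using v0 n by (cases v; cases fs; cases bs; cases "N = 0"; cases "N < n") simp_all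
    then have "char_series n k j g d = (if N = 0 then chi1 n g else 0) + (if v \<and> bs \<and> N = 2 then 1 else 0) * chi2 n g
      + (if v \<and> fs \<and> N = n then 1 else 0) * chi2 n g + (if v \<and> fs \<and> 0 < N \<and> N < n then (\<lambda>_. 0) N else 0)"
      unfolding lhs cards chi(1,2) .
    also note rhs[of "\<lambda>_. 0", OF refl chi(3,4), symmetric]
    finally show ?thesis by blast
  qed
qed

end
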